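(* Let $(R,\mathfrak m)$ be a $d$-dimensional local OK domain of prime characteristic $p>0$, and let $I_\bullet$ and $J_\bullet$ be $p$-families of $\mathfrak m$-primary ideals of $R$. Let $L_\bullet$ be the $p$-family with $L_q=I_qJ_q$. Then the volumes $\operatorname{vol}_R(I_\bullet),\operatorname{vol}_R(J_\bullet),\operatorname{vol}_R(L_\bullet)$ exist and \[\operatorname{vol}_R(I_\bullet)^{1/d}+\operatorname{vol}_R(J_\bullet)^{1/d}\ge\operatorname{vol}_R(L_\bullet)^{1/d}.\]
   Context: $p$ prime; $q$ denotes powers $p^e$, $e\ge0$, and $q\to\infty$ means $e\to\infty$. A $p$-family of ideals in a ring of characteristic $p$ is a sequence $\{I_q\}$ of ideals indexed by the powers $q$ of $p$ with $I_q^{[p]}\subseteq I_{pq}$ (where $I^{[p]}$ is generated by $p$-th powers of elements of $I$). For a $p$-family $I_\bullet$ of $\mathfrak m$-primary ideals of a $d$-dimensional local ring $(R,\mathfrak m)$, $\operatorname{vol}_R(I_\bullet)=\lim_{q\to\infty}\ell_R(R/I_q)/q^d$. OK domain: fix $\mathbf a\in\mathbb R^d$ with $\mathbb Q$-linearly independent coordinates and order $\mathbb Z^d$ by $\mathbf u\le\mathbf v$ iff $\langle\mathbf u,\mathbf a\rangle\le\langle\mathbf v,\mathbf a\rangle$. A valuation $\nu:\mathbb F^\times\to\mathbb Z^d$ (surjective homomorphism with $\nu(x+y)\ge\min\{\nu(x),\nu(y)\}$ when $x,y,x+y\ne0$) on the fraction field $\mathbb F$ of a $d$-dimensional local domain $(D,\mathfrak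 m,\Bbbk)$, with $\mathbb F_{\ge\mathbf u}=\{0\}\cup\{x:\nu(x)\ge\mathbf u\}$, valuation ring $V=\mathbb F_{\ge\mathbf0}$, maximal ideal $\mathfrak m_V$, residue field $\Bbbk_V$, is OK relative to $D$ if (i) $D\subseteq V$ and $\mathfrak m=\mathfrak m_V\cap D$; (ii) the closed convex cone generated by $\nu(D\setminus0)$ contains no nonzero $\mathbf u$ with $\langle\mathbf u,\mathbf a\rangle\le0$; (iii) $[\Bbbk_V:\Bbbk]<\infty$; (iv) there is $\mathbf v\in\mathbb Z^d$ with $D\cap\mathbb F_{\ge n\mathbf v}\subseteq\mathfrak m^n$ for all $n\ge0$. $D$ is an OK domain if such a valuation exists (for some $\mathbf a$). Excellent local domains of characteristic $p$ are OK. *)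

theory Defs
  imports Complex_Main "HOL-Computational_Algebra.Fraction_Field" "HOL-Computational_Algebra.Primes"
begin

definition is_ideal :: "'a::comm_ring_1 set \<Rightarrow> bool" where
  "is_ideal I \<longleftrightarrow> 0 \<in> I \<and> (\<forall>x\<in>I. \<forall>y\<in>I. x + y \<in> I) \<and> (\<forall>r. \<forall>x\<in>I. r * x \<in> I)"

definition ideal_gen :: "'a::comm_ring_1 set \<Rightarrow> 'a set" where
  "ideal_gen S = \<Inter>{I. is_ideal I \<and> S \<subseteq> I}"

definition ideal_prod :: "'a::comm_ring_1 set \<Rightarrow> 'a set \<Rightarrow> 'a set" where
  "ideal_prod I J = ideal_gen {x * y | x y. x \<in> I \<and> y \<in> J}"

fun ideal_pow :: "'a::comm_ring_1 set \<Rightarrow> nat \<Rightarrow> 'a set" where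
  "ideal_pow I 0 = UNIV"
| "ideal_pow I (Suc n) = ideal_prod I (ideal_pow I n)"

definition frob_bracket :: "nat \<Rightarrow> 'a::comm_ring_1 set \<Rightarrow> 'a set" where
  "frob_bracket p I = ideal_gen {x ^ p | x. x \<in> I}"

definition is_prime_ideal :: "'a::comm_ring_1 set \<Rightarrow> bool" where
  "is_prime_ideal P \<longleftrightarrow> is_ideal P \<and> P \<noteq> UNIV \<and> (\<forall>a b. a * b \<in> P \<longrightarrow> a \<in> P \<or> b \<in> P)"

definition is_maximal_ideal :: "'a::comm_ring_1 set \<Rightarrow> bool" where
  "is_maximal_ideal M \<longleftrightarrow> is_ideal M \<and> M \<noteq> UNIV \<and>
     (\<forall>J. is_ideal J \<and> M \<subseteq> J \<longrightarrow> J = M \<or> J = UNIV)"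

definition noetherian_ring :: "'a::comm_ring_1 itself \<Rightarrow> bool" where
  "noetherian_ring _ \<longleftrightarrow> (\<forall>I::'a set. is_ideal I \<longrightarrow> (\<exists>S. finite S \<and> I = ideal_gen S))"

definition local_ring :: "'a::comm_ring_1 set \<Rightarrow> bool" where
  "local_ring m \<longleftrightarrow> noetherian_ring TYPE('a) \<and> is_maximal_ideal m \<and>
     (\<forall>M. is_maximal_ideal M \<longrightarrow> M = m)"

definition prime_chain :: "(nat \<Rightarrow> 'a::comm_ring_1 set) \<Rightarrow> nat \<Rightarrow> bool" where
  "prime_chain P n \<longleftrightarrow> (\<forall>i\<le>n. is_prime_ideal (P i)) \<and> (\<forall>i<n. P i \<subset> P (Suc i))"

definition krull_dim_eq :: "'a::comm_ring_1 itself \<Rightarrow> nat \<Rightarrow> bool" where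
  "krull_dim_eq _ d \<longleftrightarrow> (\<exists>P::nat \<Rightarrow> 'a set. prime_chain P d) \<and>
     \<not> (\<exists>P::nat \<Rightarrow> 'a set. prime_chain P (Suc d))"

text \<open>Length of the R-module R/I: supremum of the lengths of strict chains of ideals
  from I up to R (these correspond to composition-type chains of submodules of R/I).\<close>
definition colength :: "'a::comm_ring_1 set \<Rightarrow> nat" where
  "colength I = Sup {n. \<exists>C::nat \<Rightarrow> 'a set. C 0 = I \<and> C n = UNIV \<and>
       (\<forall>i\<le>n. is_ideal (C i)) \<and> (\<forall>i<n. C i \<subset> C (Suc i))}"

definition primary_to :: "'a::comm_ring_1 set \<Rightarrow> 'a set \<Rightarrow> bool" where
  "primary_to m I \<longleftrightarrow> is_ideal I \<and> {x. \<exists>n. x ^ n \<in> I} = m"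

text \<open>p-family indexed by the exponent e (q = p^e).\<close>
definition p_family :: "nat \<Rightarrow> (nat \<Rightarrow> 'a::comm_ring_1 set) \<Rightarrow> bool" where
  "p_family p I \<longleftrightarrow> (\<forall>e. is_ideal (I e) \<and> frob_bracket p (I e) \<subseteq> I (Suc e))"

definition vol_seq :: "nat \<Rightarrow> nat \<Rightarrow> (nat \<Rightarrow> 'a::comm_ring_1 set) \<Rightarrow> nat \<Rightarrow> real" where
  "vol_seq p d I = (\<lambda>e. real (colength (I e)) / real (p ^ e) ^ d)"

definition vol :: "nat \<Rightarrow> nat \<Rightarrow> (nat \<Rightarrow> 'a::comm_ring_1 set) \<Rightarrow> real" where
  "vol p d I = lim (vol_seq p d I)"

definition emb :: "'a::idom \<Rightarrow> 'a fract" where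
  "emb r = Fract r 1"

text \<open>Vectors of Z^d / R^d are functions on nat vanishing from index d on.\<close>
definition ipa :: "nat \<Rightarrow> (nat \<Rightarrow> real) \<Rightarrow> (nat \<Rightarrow> int) \<Rightarrow> real" where
  "ipa d a u = (\<Sum>i<d. real_of_int (u i) * a i)"

definition cone_gen :: "nat \<Rightarrow> (nat \<Rightarrow> int) set \<Rightarrow> (nat \<Rightarrow> real) set" where
  "cone_gen d S = {c. \<exists>n (t::nat \<Rightarrow> real) w. (\<forall>j<n. t j \<ge> 0 \<and> w j \<in> S) \<and>
       c = (\<lambda>i. if i < d then (\<Sum>j<n. t j * real_of_int (w j i)) else 0)}"

definition closed_cone_gen :: "nat \<Rightarrow> (nat \<Rightarrow> int) set \<Rightarrow> (nat \<Rightarrow> real) set" where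
  "closed_cone_gen d S = {u. (\<forall>i\<ge>d. u i = 0) \<and>
       (\<forall>\<epsilon>>0. \<exists>c\<in>cone_gen d S. \<forall>i<d. \<bar>u i - c i\<bar> < \<epsilon>)}"

definition OK_valuation ::
    "'a::idom set \<Rightarrow> nat \<Rightarrow> (nat \<Rightarrow> real) \<Rightarrow> ('a fract \<Rightarrow> (nat \<Rightarrow> int)) \<Rightarrow> bool" where
  "OK_valuation m d a \<nu> \<longleftrightarrow>
     \<comment> \<open>a has Q-linearly independent coordinates\<close>
     (\<forall>c::nat \<Rightarrow> rat. (\<Sum>i<d. real_of_rat (c i) * a i) = 0 \<longrightarrow> (\<forall>i<d. c i = 0)) \<and>
     \<comment> \<open>nu is a valuation F^x \<rightarrow> Z^d (surjective homomorphism, ultrametric w.r.t. the order given by a)\<close>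
     \<nu> ` (UNIV - {0}) = {v. \<forall>i\<ge>d. v i = 0} \<and>
     (\<forall>x y. x \<noteq> 0 \<and> y \<noteq> 0 \<longrightarrow> \<nu> (x * y) = (\<lambda>i. \<nu> x i + \<nu> y i)) \<and>
     (\<forall>x y. x \<noteq> 0 \<and> y \<noteq> 0 \<and> x + y \<noteq> 0 \<longrightarrow>
        ipa d a (\<nu> (x + y)) \<ge> min (ipa d a (\<nu> x)) (ipa d a (\<nu> y))) \<and>
     \<comment> \<open>(i) D \<subseteq> V and m = m_V \<inter> D\<close>
     (\<forall>r. r \<noteq> 0 \<longrightarrow> ipa d a (\<nu> (emb r)) \<ge> 0) \<and>
     (\<forall>r. r \<in> m \<longleftrightarrow> r = 0 \<or> ipa d a (\<nu> (emb r)) > 0) \<and>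
     \<comment> \<open>(ii) the closed convex cone generated by nu(D minus 0) meets {<u,a> \<le> 0} only in 0\<close>
     (\<forall>u\<in>closed_cone_gen d (\<nu> ` emb ` (UNIV - {0})).
        (\<Sum>i<d. u i * a i) \<le> 0 \<longrightarrow> u = (\<lambda>_. 0)) \<and>
     \<comment> \<open>(iii) [k_V : k] finite: k_V is spanned over k by finitely many residues\<close>
     (\<exists>n (w::nat \<Rightarrow> 'a fract). (\<forall>j<n. w j = 0 \<or> ipa d a (\<nu> (w j)) \<ge> 0) \<and>
        (\<forall>v. v = 0 \<or> ipa d a (\<nu> v) \<ge> 0 \<longrightarrow>
           (\<exists>r::nat \<Rightarrow> 'a. let z = v - (\<Sum>j<n. emb (r j) * w j) in
                z = 0 \<or> ipa d a (\<nu> z) > 0))) \<and>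
     \<comment> \<open>(iv) D \<inter> F_{\<ge> n v} \<subseteq> m^n\<close>
     (\<exists>v::nat \<Rightarrow> int. (\<forall>i\<ge>d. v i = 0) \<and>
        (\<forall>n::nat. \<forall>r. (r = 0 \<or> ipa d a (\<nu> (emb r)) \<ge> real n * ipa d a v) \<longrightarrow>
            r \<in> ideal_pow m n))"

definition OK_domain :: "'a::idom set \<Rightarrow> nat \<Rightarrow> bool" where
  "OK_domain m d \<longleftrightarrow> (\<exists>a \<nu>. OK_valuation m d a \<nu>)"

end

theory Submission
  imports Defs "HOL-Library.Function_Algebras" "HOL-Library.FuncSet"
begin

text \<open>
  Let \<open>S\<close> be the value semigroup of the domain and \<open>T e\<close> the values of the nonzero elements of the
  \<open>e\<close>-th ideal. Filtering by the valuation, all graded pieces have length at most the residue degree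
  \<open>h\<close>, with equality after a fixed shift; hence the colength of the \<open>e\<close>-th ideal is
  \<open>h \<cdot> card (S - T e)\<close> up to an error of lower order, and only lattice points have to be counted.

  A \<open>p\<close>-family of semigroup ideals has a radial function \<open>r(x) = inf {k / p\<^sup>e. k x \<in> T e}\<close>, homogeneous
  of degree \<open>-1\<close>. Dilating by \<open>k\<close> and filling with translated cubes of side \<open>k\<close> shows that the
  number \<open>A(n)\<close> of points with \<open>r(x) > 1/n\<close> satisfies \<open>A(n) / n\<^sup>d \<rightarrow> V\<close>, and \<open>V\<close> is also the limit
  of \<open>card (S - T e) / p\<^bsup>de\<^esup>\<close>. By Abel summation the sum of \<open>r(x)\<^sup>d\<close> over a large ball grows like
  \<open>V\<close> times a logarithm of its radius. The radial function of the product family is at most the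
  sum of the two others, so convexity of \<open>t \<mapsto> t\<^sup>d\<close> under this logarithmic average gives the
  inequality.
\<close>

text \<open>The geometry is that of radial functions, not of convex bodies: the region
  \<open>\<Delta>\<close> of a \<open>p\<close>-family is stable under adding the cone but need not
  be convex. What survives is addition along a single ray, since multiples of the same
  \<open>x\<close> in two families add up to a multiple of \<open>x\<close> in the product family.
  The inequality thus becomes Minkowski's inequality in \<open>L^d\<close> on the space of
  directions. Integration over directions is never set up: \<open>rad T x ^ d\<close> has exactly
  the exponent at which lattice sums diverge logarithmically, and the coefficient of the logarithm
  plays the role of the integral. Every bounded error, in particular all behaviour near the origin,
  disappears against the divergent sum.

  Two constants absorb the lattice effects. \<open>c0\<close> is the price per unit of dilation for
  moving a cube into the semigroup, which is possible because surjectivity of the valuation makes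
  the semigroup generate the lattice. \<open>U\<close> is common to the three families: at level
  \<open>e\<close> each contains all semigroup points of value at least \<open>U * p ^ e\<close>, so
  every count takes place in a finite ball.\<close>

section \<open>Real sequences\<close>

text \<open>A Fekete-type principle. Each single value \<open>h t\<close> is, up to an error that
  vanishes along \<open>F\<close>, an eventual upper bound for \<open>h\<close>. The limit is the
  infimum of all eventual upper bounds, and the vanishing error keeps \<open>h\<close> from staying
  below it.\<close>

lemma eventually_dominated_imp_convergent:
  fixes h \<epsilon> :: "'b \<Rightarrow> real"
  assumes F: "F \<noteq> bot" and nonneg: "eventually (\<lambda>t. 0 \<le> h t) F" and \<epsilon>: "(\<epsilon> \<longlongrightarrow> 0) F"
    and dom: "eventually (\<lambda>t. \<forall>\<delta>>0. eventually (\<lambda>m. h m \<le> h t + \<epsilon> t + \<delta>) F) F"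
  shows "\<exists>V\<ge>0. (h \<longlongrightarrow> V) F"
proof -
  define B where "B = {v. eventually (\<lambda>m. h m \<le> v) F}"
  define V where "V = Inf B"
  have B_nonneg: "0 \<le> v" if "v \<in> B" for v
  proof -
    have "eventually (\<lambda>m. h m \<le> v \<and> 0 \<le> h m) F"
      using that nonneg unfolding B_def by (auto intro: eventually_conj)
    then obtain m where "h m \<le> v \<and> 0 \<le> h m" using F eventually_happens by blast
    then show ?thesis by linarith
  qed
  have bdd: "bdd_below B" by (meson B_nonneg bdd_belowI)
  obtain t0 where t0: "\<forall>\<delta>>0. eventually (\<lambda>m. h m \<le> h t0 + \<epsilon> t0 + \<delta>) F"
    using eventually_happens[OF dom] F by blast
  then have "h t0 + \<epsilon> t0 + 1 \<in> B" unfolding B_def by simp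
  then have ne: "B \<noteq> {}" by blast
  have V0: "0 \<le> V" unfolding V_def using ne B_nonneg by (rule cInf_greatest)
  have "(h \<longlongrightarrow> V) F"
  proof (rule tendstoI)
    fix e :: real assume e: "0 < e"
    then obtain v where v: "v \<in> B" "v < V + e"
      using cInf_lessD[OF ne, of "V + e"] unfolding V_def by auto
    have up: "eventually (\<lambda>m. h m < V + e) F"
      using v unfolding B_def by (auto elim: eventually_mono)
    have "eventually (\<lambda>t. \<epsilon> t < e / 3) F"
      using order_tendstoD(2)[OF \<epsilon>, of "e/3"] e by simp
    then have low: "eventually (\<lambda>t. V - e < h t) F"
      using dom
    proof eventually_elim
      case (elim t)
      then have "h t + \<epsilon> t + e/3 \<in> B" using e unfolding B_def by simp
      then have "V \<le> h t + \<epsilon> t + e/3" unfolding V_def using bdd by (rule cInf_lower)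
      then show ?case using elim e by linarith
    qed
    show "eventually (\<lambda>x. dist (h x) V < e) F"
      using up low by eventually_elim (auto simp: dist_real_def)
  qed
  then show ?thesis using V0 by blast
qed

text \<open>If \<open>g\<close> were positive, the terms would eventually exceed
  \<open>z n * (g / 2)\<close> and the sums would diverge with those of \<open>z\<close>. This turns
  an inequality of logarithmically divergent sums, valid up to a bounded error, into an inequality
  of limits.\<close>

lemma bounded_weighted_sums_imp_limit_nonpos:
  fixes z u :: "nat \<Rightarrow> real"
  assumes z: "\<And>n. 0 \<le> z n" and div: "filterlim (\<lambda>M. \<Sum>n<M. z n) at_top sequentially"
    and u: "u \<longlonglongrightarrow> g" and bd: "\<And>M. (\<Sum>n<M. z n * u n) \<le> C"
  shows "g \<le> 0"
proof (rule ccontr)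
  assume "\<not> g \<le> 0"
  then have g: "0 < g" by simp
  then have "eventually (\<lambda>n. g / 2 < u n) sequentially"
    by (intro order_tendstoD(1)[OF u]) simp
  then obtain k where k: "\<And>n. n \<ge> k \<Longrightarrow> g / 2 < u n" by (auto simp: eventually_sequentially)
  define D where "D = (\<Sum>n<k. z n * u n) - g / 2 * (\<Sum>n<k. z n)"
  have low: "g / 2 * (\<Sum>n<M. z n) + D \<le> (\<Sum>n<M. z n * u n)" if "k \<le> M" for M
    using that
  proof (induction M rule: dec_induct)
    case base then show ?case by (simp add: D_def)
  next
    case (step n)
    have "z n * (g / 2) \<le> z n * u n" using z[of n] k[of n] step by (intro mult_left_mono) auto
    with step show ?case by (simp add: algebra_simps)
  qed
  have "eventually (\<lambda>M. (C - D + 1) / (g / 2) \<le> (\<Sum>n<M. z n)) sequentially"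
    using div by (simp add: filterlim_at_top)
  from eventually_happens'[OF _ eventually_conj[OF this eventually_ge_at_top[of k]]]
  obtain M where M: "M \<ge> k" "(C - D + 1) / (g / 2) \<le> (\<Sum>n<M. z n)" by auto
  then have "C - D + 1 \<le> g / 2 * (\<Sum>n<M. z n)" using g by (simp add: field_simps)
  with low[OF M(1)] bd[of M] show False by linarith
qed

text \<open>Convexity of the power function. The induction step rests on \<open>u - v\<close> and
  \<open>u ^ n - v ^ n\<close> having the same sign.\<close>

lemma power_convex_comb_le:
  fixes u v :: real
  assumes "0 \<le> u" "0 \<le> v" "0 \<le> \<mu>" "0 \<le> \<nu>" "\<mu> + \<nu> = 1"
  shows "(\<mu> * u + \<nu> * v) ^ n \<le> \<mu> * u ^ n + \<nu> * v ^ n"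
proof (induction n)
  case 0 then show ?case using assms by simp
next
  case (Suc n)
  have "(\<mu> * u + \<nu> * v) ^ Suc n \<le> (\<mu> * u + \<nu> * v) * (\<mu> * u ^ n + \<nu> * v ^ n)"
    using Suc assms by (simp add: mult_left_mono)
  also have "\<dots> = (\<mu> + \<nu>) * (\<mu> * u ^ Suc n + \<nu> * v ^ Suc n) - \<mu> * \<nu> * ((u - v) * (u ^ n - v ^ n))"
    by (simp add: algebra_simps)
  also have "\<dots> \<le> \<mu> * u ^ Suc n + \<nu> * v ^ Suc n"
  proof -
    have "0 \<le> (u - v) * (u ^ n - v ^ n)"
    proof (cases "u \<le> v")
      case True
      then have "u ^ n \<le> v ^ n" using assms by (intro power_mono)
      with True show ?thesis by (intro mult_nonpos_nonpos) auto
    next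
      case False
      then have "v ^ n \<le> u ^ n" using assms by (intro power_mono) auto
      with False show ?thesis by (intro mult_nonneg_nonneg) auto
    qed
    then have "0 \<le> \<mu> * \<nu> * ((u - v) * (u ^ n - v ^ n))" using assms by (metis mult_nonneg_nonneg)
    then show ?thesis using assms by simp
  qed
  finally show ?case .
qed

text \<open>Apply convexity to \<open>f / i\<close> and \<open>g / j\<close> with weights
  \<open>i / (i + j)\<close> and \<open>j / (i + j)\<close>. The free parameters linearise
  Minkowski's inequality: the right side is additive in the \<open>d\<close>-th powers, so it can be
  summed over points before \<open>i\<close> and \<open>j\<close> are chosen.\<close>

lemma weighted_power_sum_le:
  fixes f g i j :: real
  assumes "0 \<le> f" "0 \<le> g" "0 < i" "0 < j" "0 < d"
  shows "(f + g) ^ d \<le> (i + j) ^ (d - 1) * (f ^ d / i ^ (d - 1) + g ^ d / j ^ (d - 1))"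
proof -
  obtain n where d: "d = Suc n" using assms by (cases d) auto
  define s where "s = i + j"
  have s: "0 < s" using assms by (simp add: s_def)
  have "(i / s * (f / i) + j / s * (g / j)) ^ d \<le> i / s * (f / i) ^ d + j / s * (g / j) ^ d"
    using assms s by (intro power_convex_comb_le) (auto simp: s_def add_divide_distrib[symmetric])
  moreover have "i / s * (f / i) + j / s * (g / j) = (f + g) / s" using assms by (simp add: add_divide_distrib)
  ultimately have "((f + g) / s) ^ d \<le> i / s * (f / i) ^ d + j / s * (g / j) ^ d" by simp
  then have "s ^ d * ((f + g) / s) ^ d \<le> s ^ d * (i / s * (f / i) ^ d + j / s * (g / j) ^ d)"
    using s by (intro mult_left_mono) auto
  moreover have "s ^ d * ((f + g) / s) ^ d = (f + g) ^ d"
    using s by (simp add: power_divide)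
  moreover have "s ^ d * (i / s * (f / i) ^ d + j / s * (g / j) ^ d) =
      s ^ (d - 1) * (f ^ d / i ^ (d - 1) + g ^ d / j ^ (d - 1))"
  proof -
    have "i / s * (f / i) ^ d = f ^ d / i ^ (d - 1) / s" "j / s * (g / j) ^ d = g ^ d / j ^ (d - 1) / s"
      using assms by (simp_all add: d power_divide)
    note e = this
    show ?thesis unfolding e add_divide_distrib[symmetric] using s by (simp add: d)
  qed
  ultimately show ?thesis by (simp add: s_def)
qed

lemma sum_inverse_Suc_at_top:
  "filterlim (\<lambda>M. \<Sum>n<M. 1 / (real n + 2)) at_top sequentially"
proof -
  have "ln (real M + 2) - ln 2 \<le> (\<Sum>n<M. 1 / (real n + 2))" for M
  proof (induction M)
    case (Suc M)
    have "ln (real M + 3) - ln (real M + 2) = ln (1 + 1 / (real M + 2))"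
      using ln_div[of "real M + 3" "real M + 2"] by (simp add: field_simps)
    also have "\<dots> \<le> 1 / (real M + 2)" by (rule ln_add_one_self_le_self) simp
    finally show ?case using Suc by (simp add: add.commute add.left_commute)
  qed simp
  moreover have "filterlim (\<lambda>M. ln (real M + 2) - ln 2) at_top sequentially"
  proof -
    have "filterlim (\<lambda>M. real M + 2) at_top sequentially"
      using filterlim_tendsto_add_at_top[OF tendsto_const filterlim_real_sequentially, of 2]
      by (simp add: add.commute)
    then have "filterlim (\<lambda>M. - ln 2 + ln (real M + 2)) at_top sequentially"
      by (intro filterlim_tendsto_add_at_top[OF tendsto_const] filterlim_compose[OF ln_at_top])
    then show ?thesis by simp
  qed
  ultimately show ?thesis
    by (auto intro: filterlim_at_top_mono)
qed

section \<open>Counting lattice points of a semigroup in a pointed cone\<close>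

definition nsm :: "nat \<Rightarrow> (nat \<Rightarrow> int) \<Rightarrow> nat \<Rightarrow> int" where
  "nsm k x = (\<lambda>i. int k * x i)"

lemma nsm_apply [simp]: "nsm k x i = int k * x i"
  by (simp add: nsm_def)

lemma nsm_0 [simp]: "nsm 0 x = 0" and nsm_1 [simp]: "nsm (Suc 0) x = x"
  by (auto simp: fun_eq_iff)

lemma nsm_add_left: "nsm (j + k) x = nsm j x + nsm k x"
  and nsm_add_right: "nsm k (x + y) = nsm k x + nsm k y"
  and nsm_nsm: "nsm j (nsm k x) = nsm (j * k) x"
  by (auto simp: fun_eq_iff algebra_simps)

lemma ipa_0 [simp]: "ipa d a 0 = 0"
  and ipa_add [simp]: "ipa d a (x + y) = ipa d a x + ipa d a y"
  and ipa_nsm [simp]: "ipa d a (nsm k x) = real k * ipa d a x"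
  by (auto simp: ipa_def sum.distrib algebra_simps sum_distrib_left)

lemma ipa_sum:
  fixes n :: nat
  shows "ipa d a (\<lambda>j. \<Sum>i<n. f i j) = (\<Sum>i<n. ipa d a (f i))"
proof (induction n)
  case 0
  have "(\<lambda>j. \<Sum>i<0. f i j) = (0 :: nat \<Rightarrow> int)" by auto
  then show ?case by simp
next
  case (Suc n)
  have "(\<lambda>j. \<Sum>i<Suc n. f i j) = (\<lambda>j. \<Sum>i<n. f i j) + f n" by (auto simp: fun_eq_iff)
  then show ?case using Suc by simp
qed

lemma tendsto_const_divide_at_top: "((\<lambda>t::real. c / t) \<longlongrightarrow> 0) at_top"
  by (rule tendsto_divide_0[OF tendsto_const filterlim_at_top_imp_at_infinity[OF filterlim_ident]])

text \<open>A half-open fundamental domain of the sublattice of multiples of \<open>P\<close>, so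
  that its translates by that sublattice are disjoint.\<close>

definition cube :: "nat \<Rightarrow> nat \<Rightarrow> (nat \<Rightarrow> int) set" where
  "cube d P = {y. (\<forall>i<d. 0 \<le> y i \<and> y i < int P) \<and> (\<forall>i\<ge>d. y i = 0)}"

lemma finite_int_box: "finite {y::nat \<Rightarrow> int. (\<forall>i<d. l \<le> y i \<and> y i < u) \<and> (\<forall>i\<ge>d. y i = 0)}"
  and card_int_box: "card {y::nat \<Rightarrow> int. (\<forall>i<d. l \<le> y i \<and> y i < u) \<and> (\<forall>i\<ge>d. y i = 0)} = nat (u - l) ^ d"
proof -
  let ?B = "{y::nat \<Rightarrow> int. (\<forall>i<d. l \<le> y i \<and> y i < u) \<and> (\<forall>i\<ge>d. y i = 0)}"
  let ?Q = "{..<d} \<rightarrow>\<^sub>E {l..<u}"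
  let ?f = "\<lambda>g i. if i < d then g i else (0::int)"
  have "bij_betw ?f ?Q ?B"
  proof (rule bij_betwI[where g = "\<lambda>y. restrict y {..<d}"])
    show "?f \<in> ?Q \<rightarrow> ?B" by (auto simp: PiE_iff)
    show "(\<lambda>y. restrict y {..<d}) \<in> ?B \<rightarrow> ?Q" by auto
    show "restrict (?f x) {..<d} = x" if "x \<in> ?Q" for x
      using that by (auto simp: fun_eq_iff PiE_iff extensional_def restrict_def)
    show "?f (restrict y {..<d}) = y" if "y \<in> ?B" for y
      using that by (auto simp: fun_eq_iff)
  qed
  moreover have "finite ?Q" by (intro finite_PiE) auto
  moreover have "card ?Q = nat (u - l) ^ d" by (simp add: card_PiE)
  ultimately show "finite ?B" "card ?B = nat (u - l) ^ d"
    using bij_betw_finite[of ?f ?Q ?B] bij_betw_same_card[of ?f ?Q ?B] by simp_all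
qed

lemma card_cube: "card (cube d P) = P ^ d"
  using card_int_box[of d 0 "int P"] by (simp add: cube_def)

text \<open>Division with remainder by \<open>P\<close> recovers \<open>x\<close> and
  \<open>y\<close> from the sum, so the cubes attached to distinct points of \<open>X\<close> do not
  overlap. The translation \<open>s\<close> is common to all cubes and leaves room to push them into
  the semigroup.\<close>

lemma card_dilated_le:
  assumes "finite Z" and supp: "\<And>x i. x \<in> X \<Longrightarrow> i \<ge> d \<Longrightarrow> x i = 0"
    and sub: "\<And>x y. x \<in> X \<Longrightarrow> y \<in> cube d P \<Longrightarrow> nsm P x + (nsm P s + y) \<in> Z"
  shows "P ^ d * card X \<le> card Z"
proof -
  let ?g = "\<lambda>(x, y). nsm P x + (nsm P s + y)"
  have inj: "inj_on ?g (X \<times> cube d P)"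
  proof (rule inj_onI, clarify)
    fix x y x' y'
    assume x: "x \<in> X" "x' \<in> X" and y: "y \<in> cube d P" "y' \<in> cube d P"
      and eq: "nsm P x + (nsm P s + y) = nsm P x' + (nsm P s + y')"
    have "x i = x' i \<and> y i = y' i" for i
    proof (cases "i < d")
      case True
      have e: "int P * (x i + s i) + y i = int P * (x' i + s i) + y' i"
        using fun_cong[OF eq, of i] by (simp add: algebra_simps)
      have r: "0 \<le> y i" "y i < int P" "0 \<le> y' i" "y' i < int P"
        using y True by (auto simp: cube_def)
      have "(int P * (x i + s i) + y i) div int P = x i + s i"
        "(int P * (x' i + s i) + y' i) div int P = x' i + s i"
        using r by simp_all
      with e have "x i = x' i" by simp
      with e show ?thesis by simp
    next
      case False
      then show ?thesis using x y supp[of x i] supp[of x' i] by (auto simp: cube_def)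
    qed
    then show "x = x' \<and> y = y'" by (auto simp: fun_eq_iff)
  qed
  have "card (X \<times> cube d P) \<le> card Z"
    using inj assms(1) sub by (intro card_inj_on_le[of ?g]) auto
  then show ?thesis by (simp add: card_cartesian_product card_cube mult.commute)
qed

text \<open>\<open>\<kappa>\<close> is the quantitative form of pointedness of the cone and makes
  the sublevel sets of the value finite. The pairs \<open>b i\<close>, \<open>b' i\<close> witness
  that \<open>S\<close> generates the whole lattice.\<close>

locale cone_semigroup =
  fixes d :: nat and a :: "nat \<Rightarrow> real" and S :: "(nat \<Rightarrow> int) set" and \<kappa> :: real
    and b b' :: "nat \<Rightarrow> nat \<Rightarrow> int"
  assumes d_pos: "0 < d"
    and zero_mem: "0 \<in> S"
    and add_mem: "\<And>x y. x \<in> S \<Longrightarrow> y \<in> S \<Longrightarrow> x + y \<in> S"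
    and supp: "\<And>x i. x \<in> S \<Longrightarrow> d \<le> i \<Longrightarrow> x i = 0"
    and \<kappa>_pos: "0 < \<kappa>"
    and coord_bound: "\<And>x i. x \<in> S \<Longrightarrow> i < d \<Longrightarrow> \<kappa> * real_of_int \<bar>x i\<bar> \<le> ipa d a x"
    and b_mem: "\<And>i. i < d \<Longrightarrow> b i \<in> S" and b'_mem: "\<And>i. i < d \<Longrightarrow> b' i \<in> S"
    and unit: "\<And>i j. i < d \<Longrightarrow> b i j - b' i j = (if i = j then 1 else 0)"
begin

abbreviation L :: "(nat \<Rightarrow> int) \<Rightarrow> real" where "L \<equiv> ipa d a"

lemma nsm_mem: "x \<in> S \<Longrightarrow> nsm k x \<in> S"
proof (induction k)
  case (Suc k)
  have "nsm (Suc k) x = nsm k x + x" by (auto simp: fun_eq_iff algebra_simps)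
  with Suc show ?case by (simp only: add_mem)
qed (simp add: zero_mem)

lemma sum_mem:
  fixes n :: nat
  shows "(\<And>i. i < n \<Longrightarrow> f i \<in> S) \<Longrightarrow> (\<lambda>j. \<Sum>i<n. f i j) \<in> S"
proof (induction n)
  case 0
  have "(\<lambda>j. \<Sum>i<0. f i j) = (0 :: nat \<Rightarrow> int)" by auto
  then show ?case by (simp add: zero_mem)
next
  case (Suc n)
  have "(\<lambda>j. \<Sum>i<Suc n. f i j) = (\<lambda>j. \<Sum>i<n. f i j) + f n" by (auto simp: fun_eq_iff)
  then show ?case using Suc add_mem by auto
qed

lemma L_nonneg: "x \<in> S \<Longrightarrow> 0 \<le> L x"
  by (rule order_trans[OF _ coord_bound[OF _ d_pos]]) (use \<kappa>_pos in auto)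

lemma L_pos:
  assumes "x \<in> S" "x \<noteq> 0"
  shows "0 < L x"
proof -
  obtain i where i: "x i \<noteq> 0" using assms(2) by (auto simp: fun_eq_iff)
  then have "i < d" using supp[OF assms(1), of i] by (meson not_le)
  then show ?thesis using coord_bound[OF assms(1), of i] \<kappa>_pos i
    by (smt (verit) mult_pos_pos of_int_0_less_iff zero_less_abs_iff)
qed

definition ball :: "real \<Rightarrow> (nat \<Rightarrow> int) set" where "ball t = {x \<in> S. L x < t}"
definition N :: "real \<Rightarrow> nat" where "N t = card (ball t)"

lemma ball_subset_box:
  "ball t \<subseteq> {y. (\<forall>i<d. - \<lceil>t / \<kappa>\<rceil> \<le> y i \<and> y i < \<lceil>t / \<kappa>\<rceil>) \<and> (\<forall>i\<ge>d. y i = 0)}"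
proof clarify
  fix x assume "x \<in> ball t"
  then have x: "x \<in> S" "L x < t" by (auto simp: ball_def)
  have "- \<lceil>t / \<kappa>\<rceil> \<le> x i \<and> x i < \<lceil>t / \<kappa>\<rceil>" if "i < d" for i
  proof -
    have "\<kappa> * real_of_int \<bar>x i\<bar> < t" using coord_bound[OF x(1) that] x(2) by linarith
    then have "real_of_int \<bar>x i\<bar> < t / \<kappa>" using \<kappa>_pos by (simp add: field_simps)
    then have "\<bar>x i\<bar> < \<lceil>t / \<kappa>\<rceil>" by (simp add: less_ceiling_iff)
    then show ?thesis by linarith
  qed
  then show "(\<forall>i<d. - \<lceil>t / \<kappa>\<rceil> \<le> x i \<and> x i < \<lceil>t / \<kappa>\<rceil>) \<and> (\<forall>i\<ge>d. x i = 0)"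
    using supp x by blast
qed

lemma finite_ball [simp]: "finite (ball t)"
  using finite_subset[OF ball_subset_box finite_int_box] .

lemma N_mono: "s \<le> t \<Longrightarrow> N s \<le> N t"
  unfolding N_def by (rule card_mono[OF finite_ball]) (auto simp: ball_def)

lemma N_upper:
  assumes "1 \<le> t"
  shows "real (N t) \<le> (2 / \<kappa> + 2) ^ d * t ^ d"
proof -
  let ?u = "\<lceil>t / \<kappa>\<rceil>"
  have "N t \<le> nat (?u - - ?u) ^ d"
    unfolding N_def using card_mono[OF finite_int_box ball_subset_box] card_int_box by metis
  moreover have "real (nat (?u - - ?u)) \<le> (2 / \<kappa> + 2) * t"
  proof -
    have "0 \<le> t / \<kappa>" using assms \<kappa>_pos by simp
    then have "0 \<le> ?u" by linarith
    then have "real (nat (?u - - ?u)) = 2 * real_of_int ?u" by simp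
    also have "\<dots> \<le> 2 * (t / \<kappa> + 1)" by (intro mult_left_mono of_int_ceiling_le_add_one) simp
    also have "\<dots> \<le> (2 / \<kappa> + 2) * t" using assms by (simp add: algebra_simps)
    finally show ?thesis .
  qed
  ultimately have "real (N t) \<le> ((2 / \<kappa> + 2) * t) ^ d"
    by (smt (verit, best) of_nat_le_iff of_nat_power of_nat_0_le_iff power_mono)
  then show ?thesis by (simp add: power_mult_distrib)
qed

text \<open>\<open>s0\<close> is the translation that moves cubes into \<open>S\<close>.
  \<open>s1\<close> acts as an interior point of the cone: a sufficiently large multiple of it
  absorbs any fixed lattice vector, of either sign. \<open>c0\<close> is the value of
  \<open>s1\<close>, and it also bounds the cost of a unit cube.\<close>

definition s0 :: "nat \<Rightarrow> int" where "s0 = (\<lambda>j. \<Sum>i<d. b' i j)"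
definition s1 :: "nat \<Rightarrow> int" where "s1 = (\<lambda>j. \<Sum>i<d. b i j + b' i j)"
definition c0 :: real where "c0 = (\<Sum>i<d. L (b i) + L (b' i))"

lemma c0_nonneg: "0 \<le> c0"
  unfolding c0_def by (intro sum_nonneg add_nonneg_nonneg L_nonneg b_mem b'_mem) auto

lemma L_s1: "L s1 = c0"
  using ipa_sum[of d a "\<lambda>i. b i + b' i" d] by (simp add: s1_def c0_def)

lemma vec_decomp:
  assumes "\<And>i. d \<le> i \<Longrightarrow> y i = 0"
  shows "y j = (\<Sum>i<d. y i * (b i j - b' i j))"
proof -
  have "(\<Sum>i<d. y i * (b i j - b' i j)) = (\<Sum>i<d. if i = j then y i else 0)"
    by (intro sum.cong) (auto simp: unit)
  also have "\<dots> = y j" using assms by (simp add: sum.delta)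
  finally show ?thesis by simp
qed

text \<open>Replacing the unit vectors by \<open>b i - b' i\<close> gives \<open>P * s0 + y\<close>
  as the sum of the \<open>y i * b i + (P - y i) * b' i\<close>, whose coefficients all lie between
  0 and \<open>P\<close>.\<close>

lemma cube_shift:
  assumes y: "y \<in> cube d P"
  shows "nsm P s0 + y \<in> S" "L (nsm P s0 + y) \<le> real P * c0"
proof -
  let ?f = "\<lambda>i. nsm (nat (y i)) (b i) + nsm (nat (int P - y i)) (b' i)"
  have r: "0 \<le> y i" "y i \<le> int P" if "i < d" for i using y that by (auto simp: cube_def less_imp_le)
  have "(nsm P s0 + y) j = (\<Sum>i<d. ?f i j)" for j
  proof -
    have "(nsm P s0 + y) j = (\<Sum>i<d. int P * b' i j + y i * (b i j - b' i j))"
      using vec_decomp[of y j] y by (simp add: cube_def s0_def sum_distrib_left sum.distrib)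
    also have "\<dots> = (\<Sum>i<d. ?f i j)"
      using r by (intro sum.cong) (auto simp: algebra_simps)
    finally show ?thesis .
  qed
  then have eq: "nsm P s0 + y = (\<lambda>j. \<Sum>i<d. ?f i j)" by blast
  show "nsm P s0 + y \<in> S" unfolding eq
    by (intro sum_mem add_mem nsm_mem b_mem b'_mem)
  have "L (nsm P s0 + y) = (\<Sum>i<d. real (nat (y i)) * L (b i) + real (nat (int P - y i)) * L (b' i))"
    unfolding eq ipa_sum ipa_add ipa_nsm ..
  also have "\<dots> \<le> (\<Sum>i<d. real P * L (b i) + real P * L (b' i))"
  proof (intro sum_mono add_mono mult_right_mono L_nonneg b_mem b'_mem)
    fix i assume "i \<in> {..<d}"
    then have "0 \<le> y i" "y i \<le> int P" using r by auto
    then show "real (nat (y i)) \<le> real P" "real (nat (int P - y i)) \<le> real P" by linarith+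
  qed auto
  also have "\<dots> = real P * c0" by (simp add: c0_def sum_distrib_left distrib_left)
  finally show "L (nsm P s0 + y) \<le> real P * c0" .
qed

text \<open>Fill with cubes of side \<open>k\<close> based at the \<open>k\<close>-fold multiples of
  the points of the smaller ball. Each cube costs at most \<open>k * c0\<close> of additional
  value.\<close>

lemma N_dilate:
  assumes "0 < k"
  shows "real k ^ d * real (N t) \<le> real (N (real k * (t + c0)))"
proof -
  have "k ^ d * card (ball t) \<le> card (ball (real k * (t + c0)))"
  proof (rule card_dilated_le[where s = s0])
    fix x y assume x: "x \<in> ball t" and y: "y \<in> cube d k"
    have "real k * L x < real k * t" using x assms by (simp add: ball_def)
    then show "nsm k x + (nsm k s0 + y) \<in> ball (real k * (t + c0))"
      using x cube_shift[OF y] add_mem[OF nsm_mem[of x k] cube_shift(1)[OF y]]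
      by (auto simp: ball_def distrib_left)
  qed (rule finite_ball, simp add: ball_def supp)
  then show ?thesis unfolding N_def by (metis of_nat_le_iff of_nat_mult of_nat_power)
qed

text \<open>The shift of the denominator by \<open>c0\<close> matches the loss under dilation: the
  quotient at one radius then bounds the quotients at all large radii from below asymptotically,
  which makes the supremum a limit.\<close>

definition density :: real where
  "density = (SUP t\<in>{1..}. real (N t) / (t + c0) ^ d)"

lemma N_le_density:
  assumes "1 \<le> t"
  shows "real (N t) \<le> density * (t + c0) ^ d"
proof -
  have "real (N s) / (s + c0) ^ d \<le> (2 / \<kappa> + 2) ^ d" if "1 \<le> s" for s
  proof -
    have "real (N s) \<le> (2 / \<kappa> + 2) ^ d * s ^ d" using N_upper[OF that] .
    also have "\<dots> \<le> (2 / \<kappa> + 2) ^ d * (s + c0) ^ d"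
      using that c0_nonneg \<kappa>_pos by (intro mult_left_mono power_mono) auto
    finally show ?thesis using that c0_nonneg by (simp add: field_simps)
  qed
  then have "bdd_above ((\<lambda>t. real (N t) / (t + c0) ^ d) ` {1..})" by (intro bdd_aboveI2) simp
  then have "real (N t) / (t + c0) ^ d \<le> density"
    unfolding density_def using assms by (intro cSUP_upper) auto
  then show ?thesis using assms c0_nonneg by (simp add: field_simps)
qed

lemma density_nonneg: "0 \<le> density"
proof -
  have "0 \<le> density * (1 + c0) ^ d" using N_le_density[of 1] of_nat_0_le_iff order_trans by blast
  moreover have "0 < (1 + c0) ^ d" using c0_nonneg by simp
  ultimately show ?thesis by (simp add: zero_le_mult_iff)
qed

lemma N_asymp: "((\<lambda>t. real (N t) / t ^ d) \<longlongrightarrow> density) at_top"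
proof (rule order_tendstoI)
  fix v assume v: "density < v"
  have "((\<lambda>t. density * (1 + c0 / t) ^ d) \<longlongrightarrow> density * (1 + 0) ^ d) at_top"
    by (intro tendsto_mult tendsto_power tendsto_add tendsto_const tendsto_const_divide_at_top)
  then have "eventually (\<lambda>t. density * (1 + c0 / t) ^ d < v) at_top"
    using v by (intro order_tendstoD(2)) auto
  then show "eventually (\<lambda>t. real (N t) / t ^ d < v) at_top"
    using eventually_ge_at_top[of 1]
  proof eventually_elim
    case (elim t)
    have "real (N t) / t ^ d \<le> density * (t + c0) ^ d / t ^ d"
      using N_le_density elim by (intro divide_right_mono) auto
    also have "\<dots> = density * (1 + c0 / t) ^ d"
    proof -
      have "(t + c0) / t = 1 + c0 / t" using elim by (simp add: add_divide_distrib)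
      then show ?thesis by (metis power_divide times_divide_eq_right)
    qed
    finally show ?case using elim by linarith
  qed
next
  fix v assume v: "v < density"
  have "\<exists>s\<ge>1. v < real (N s) / (s + c0) ^ d"
  proof (rule ccontr)
    assume "\<not> (\<exists>s\<ge>1. v < real (N s) / (s + c0) ^ d)"
    then have "density \<le> v" unfolding density_def by (intro cSUP_least) (auto simp: not_less)
    then show False using v by simp
  qed
  then obtain s where s: "1 \<le> s" "v < real (N s) / (s + c0) ^ d" by blast
  have "((\<lambda>m. (1 / (s + c0) - 1 / m) ^ d * real (N s)) \<longlongrightarrow> (1 / (s + c0) - 0) ^ d * real (N s)) at_top"
    by (intro tendsto_mult tendsto_power tendsto_diff tendsto_const tendsto_const_divide_at_top)
  then have "eventually (\<lambda>m. v < (1 / (s + c0) - 1 / m) ^ d * real (N s)) at_top"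
    using s by (intro order_tendstoD(1)) (auto simp: power_divide)
  then show "eventually (\<lambda>m. v < real (N m) / m ^ d) at_top"
    using eventually_ge_at_top[of "s + c0"]
  proof eventually_elim
    case (elim m)
    have sc: "0 < s + c0" using s c0_nonneg by linarith
    \<comment> \<open>Rounding down ensures \<open>k * (s + c0) \<le> m\<close>, so the dilated
      count at \<open>s\<close> stays inside the ball of radius \<open>m\<close>.\<close>
    define k where "k = nat \<lfloor>m / (s + c0)\<rfloor>"
    have q1: "1 \<le> m / (s + c0)" using elim sc by simp
    then have kr: "real k = real_of_int \<lfloor>m / (s + c0)\<rfloor>" unfolding k_def by simp
    then have k: "real k \<le> m / (s + c0)" "m / (s + c0) - 1 < real k" by linarith+
    have k0: "0 < k" using k(2) q1 by (cases k) auto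
    have "(m / (s + c0) - 1) ^ d * real (N s) \<le> real k ^ d * real (N s)"
      using k q1 by (intro mult_right_mono power_mono) auto
    also have "\<dots> \<le> real (N (real k * (s + c0)))" using N_dilate[OF k0] .
    also have "\<dots> \<le> real (N m)" using k sc by (intro of_nat_mono N_mono) (simp add: field_simps)
    finally have "(m / (s + c0) - 1) ^ d * real (N s) / m ^ d \<le> real (N m) / m ^ d"
      using elim sc by (intro divide_right_mono) auto
    moreover have "(m / (s + c0) - 1) ^ d * real (N s) / m ^ d = (1 / (s + c0) - 1 / m) ^ d * real (N s)"
    proof -
      have "(m / (s + c0) - 1) / m = 1 / (s + c0) - 1 / m" using elim sc by (simp add: diff_divide_distrib)
      then show ?thesis by (metis power_divide times_divide_eq_left)
    qed
    ultimately show ?case using elim by linarith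
  qed
qed

end

section \<open>Radial functions of p-families in a semigroup\<close>

locale p_cone_semigroup = cone_semigroup +
  fixes p :: nat and U :: real
  assumes p_gt_1: "1 < p" and U_pos: "0 < U"
begin

text \<open>The last clause is what remains of primariness: the level \<open>e\<close> contains
  everything beyond a fixed multiple of \<open>p ^ e\<close>, with the same \<open>U\<close> for all
  families to be compared.\<close>

definition pfam :: "(nat \<Rightarrow> (nat \<Rightarrow> int) set) \<Rightarrow> bool" where
  "pfam T \<longleftrightarrow> (\<forall>e. T e \<subseteq> S \<and> (\<forall>x\<in>S. \<forall>y\<in>T e. x + y \<in> T e) \<and>
     (\<forall>x\<in>T e. nsm p x \<in> T (Suc e)) \<and> (\<forall>x\<in>S. U * real p ^ e \<le> L x \<longrightarrow> x \<in> T e))"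

lemma pfam_subset: "pfam T \<Longrightarrow> x \<in> T e \<Longrightarrow> x \<in> S"
  and pfam_add: "pfam T \<Longrightarrow> x \<in> S \<Longrightarrow> y \<in> T e \<Longrightarrow> x + y \<in> T e"
  and pfam_far: "pfam T \<Longrightarrow> x \<in> S \<Longrightarrow> U * real p ^ e \<le> L x \<Longrightarrow> x \<in> T e"
  unfolding pfam_def by blast+

lemma pfam_pow:
  assumes "pfam T" "x \<in> T e"
  shows "nsm (p ^ f) x \<in> T (e + f)"
proof (induction f)
  case (Suc f)
  then have "nsm p (nsm (p ^ f) x) \<in> T (Suc (e + f))" using assms(1) unfolding pfam_def by blast
  then show ?case by (simp add: nsm_nsm del: nsm_apply)
qed (use assms in \<open>simp del: nsm_apply\<close>)

lemma pfam_multiple_mono: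
  assumes "pfam T" "x \<in> S" "nsm j x \<in> T e" "j \<le> k"
  shows "nsm k x \<in> T e"
  using pfam_add[OF assms(1) nsm_mem[OF assms(2), of "k - j"] assms(3)] assms(4)
  by (simp add: nsm_add_left[symmetric] del: nsm_apply)

text \<open>The convex-geometric picture: the sets \<open>T e / p ^ e\<close> exhaust a region \<open>\<Delta>\<close> of the cone, and
  \<open>rad T x\<close> is the infimum of all \<open>t\<close> with \<open>t x \<in> \<Delta>\<close>.\<close>

definition rad :: "(nat \<Rightarrow> (nat \<Rightarrow> int) set) \<Rightarrow> (nat \<Rightarrow> int) \<Rightarrow> real" where
  "rad T x = Inf {real k / real p ^ e | k e. 0 < k \<and> nsm k x \<in> T e}"

lemma p_pow_pos [simp]: "0 < real p ^ e"
  using p_gt_1 by simp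

lemma rad_le:
  assumes "0 < k" "nsm k x \<in> T e"
  shows "rad T x \<le> real k / real p ^ e"
  unfolding rad_def
proof (rule cInf_lower)
  show "bdd_below {real k / real p ^ e |k e. 0 < k \<and> nsm k x \<in> T e}"
    by (rule bdd_belowI[of _ 0]) auto
qed (use assms in blast)

lemma rad_set_nonempty:
  assumes "pfam T" "x \<in> S" "x \<noteq> 0"
  shows "{real k / real p ^ e | k e. 0 < k \<and> nsm k x \<in> T e} \<noteq> {}"
proof -
  have Lx: "0 < L x" using L_pos assms by blast
  define k where "k = Suc (nat \<lceil>U / L x\<rceil>)"
  have "U / L x \<le> real k" unfolding k_def by linarith
  then have "U * real p ^ 0 \<le> L (nsm k x)" using Lx by (simp add: field_simps)
  then have "nsm k x \<in> T 0" using pfam_far[OF assms(1) nsm_mem[OF assms(2)]] by blast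
  moreover have "0 < k" by (simp add: k_def)
  ultimately show ?thesis by blast
qed

lemma rad_nonneg: "pfam T \<Longrightarrow> x \<in> S \<Longrightarrow> x \<noteq> 0 \<Longrightarrow> 0 \<le> rad T x"
  unfolding rad_def by (rule cInf_greatest[OF rad_set_nonempty]) auto

text \<open>One approximant \<open>j / p ^ e\<close> below \<open>v\<close> is enough: the Frobenius
  condition carries it to every later level, and all larger multiples of \<open>x\<close> follow
  because each level is an ideal of \<open>S\<close>. So the infimum is a threshold valid on all
  late levels.\<close>

lemma rad_less_imp_mem:
  assumes "pfam T" "x \<in> S" "x \<noteq> 0" "rad T x < v"
  shows "\<exists>e0. \<forall>f\<ge>e0. \<forall>k. v * real p ^ f \<le> real k \<longrightarrow> nsm k x \<in> T f"
proof -
  obtain j e where j: "nsm j x \<in> T e" "real j / real p ^ e < v"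
    using cInf_lessD[OF rad_set_nonempty[OF assms(1-3)]] assms(4) unfolding rad_def by blast
  have "nsm k x \<in> T f" if "e \<le> f" "v * real p ^ f \<le> real k" for f k
  proof -
    have m: "nsm (p ^ (f - e) * j) x \<in> T f"
      using pfam_pow[OF assms(1) j(1), of "f - e"] that by (simp add: nsm_nsm del: nsm_apply)
    have "real j < v * real p ^ e" using j(2) by (simp only: pos_divide_less_eq[OF p_pow_pos])
    then have "real p ^ (f - e) * real j \<le> real p ^ (f - e) * (v * real p ^ e)"
      by (intro mult_left_mono) auto
    also have "\<dots> = v * real p ^ f" using that(1) by (simp add: power_add[symmetric])
    finally have "real (p ^ (f - e) * j) \<le> real k" using that(2) by simp
    then have "p ^ (f - e) * j \<le> k" by linarith
    then show ?thesis using pfam_multiple_mono[OF assms(1,2) m] by blast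
  qed
  then show ?thesis by blast
qed

text \<open>The additive constant \<open>C\<close> vanishes after division by \<open>p ^ f\<close>;
  it is there to absorb the rounding of real multiples to integers.\<close>

lemma rad_leI:
  assumes "\<And>f. e0 \<le> f \<Longrightarrow> \<exists>k>0. nsm k x \<in> T f \<and> real k \<le> v * real p ^ f + C"
  shows "rad T x \<le> v"
proof -
  have "(\<lambda>f. v + C * inverse (real p ^ f)) \<longlonglongrightarrow> v + C * 0"
    using p_gt_1 by (intro tendsto_add tendsto_mult tendsto_const LIMSEQ_inverse_realpow_zero) simp
  moreover have "rad T x \<le> v + C * inverse (real p ^ f)" if "e0 \<le> f" for f
  proof -
    obtain k where k: "0 < k" "nsm k x \<in> T f" "real k \<le> v * real p ^ f + C"
      using assms \<open>e0 \<le> f\<close> by blast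
    have "rad T x \<le> real k / real p ^ f" using rad_le k by blast
    also have "\<dots> \<le> (v * real p ^ f + C) / real p ^ f" using k by (intro divide_right_mono) auto
    also have "\<dots> = v + C * inverse (real p ^ f)"
      using p_pow_pos[of f] by (simp add: field_simps)
    finally show ?thesis .
  qed
  ultimately show ?thesis by (intro LIMSEQ_le_const[of _ v]) auto
qed

lemma rad_add_le:
  assumes "pfam T" "x \<in> S" "x \<noteq> 0" "s \<in> S"
  shows "rad T (x + s) \<le> rad T x"
  unfolding rad_def
proof (rule cInf_superset_mono[OF rad_set_nonempty[OF assms(1-3)]])
  show "bdd_below {real k / real p ^ e |k e. 0 < k \<and> nsm k (x + s) \<in> T e}"
    by (rule bdd_belowI[of _ 0]) auto
  have "nsm k (x + s) \<in> T e" if "nsm k x \<in> T e" for k e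
    using pfam_add[OF assms(1) nsm_mem[OF assms(4)] that, of k] by (simp add: nsm_add_right add.commute del: nsm_apply)
  then show "{real k / real p ^ e |k e. 0 < k \<and> nsm k x \<in> T e}
      \<subseteq> {real k / real p ^ e |k e. 0 < k \<and> nsm k (x + s) \<in> T e}" by blast
qed

text \<open>The half of homogeneity that dilation arguments use: a multiple \<open>j * k\<close> of
  \<open>x\<close> is the multiple \<open>j\<close> of \<open>k x\<close>, and rounding
  \<open>w * p ^ f\<close> up to \<open>j\<close> costs at most 1.\<close>

lemma rad_nsm_le:
  assumes "pfam T" "x \<in> S" "x \<noteq> 0" "0 < k"
  shows "rad T (nsm k x) \<le> rad T x / real k"
proof (rule dense_ge)
  fix w assume "rad T x / real k < w"
  then have w: "rad T x < w * real k" using assms(4) by (simp add: field_simps)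
  then have w0: "0 < w" using rad_nonneg[OF assms(1-3)] assms(4)
    by (smt (verit) of_nat_0_le_iff mult_nonpos_nonneg)
  obtain e0 where e0: "\<And>f j. e0 \<le> f \<Longrightarrow> w * real k * real p ^ f \<le> real j \<Longrightarrow> nsm j x \<in> T f"
    using rad_less_imp_mem[OF assms(1-3) w] by blast
  show "rad T (nsm k x) \<le> w"
  proof (rule rad_leI)
    fix f assume f: "e0 \<le> f"
    define j where "j = nat \<lceil>w * real p ^ f\<rceil>"
    have wp: "0 < w * real p ^ f" using w0 p_pow_pos[of f] by (intro mult_pos_pos)
    have "real j = of_int \<lceil>w * real p ^ f\<rceil>" unfolding j_def using wp by simp
    then have j: "w * real p ^ f \<le> real j" "real j \<le> w * real p ^ f + 1" by linarith+
    then have "w * real k * real p ^ f \<le> real (j * k)"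
      using mult_right_mono[OF j(1), of "real k"] by (simp add: ac_simps)
    then have "nsm j (nsm k x) \<in> T f" using e0[OF f] by (simp add: nsm_nsm)
    moreover have "0 < j" using j(1) wp by (cases j) auto
    ultimately show "\<exists>j>0. nsm j (nsm k x) \<in> T f \<and> real j \<le> w * real p ^ f + 1" using j by blast
  qed
qed

lemma rad_le_inverse_L:
  assumes "pfam T" "x \<in> S" "x \<noteq> 0"
  shows "rad T x \<le> U / L x"
proof (rule rad_leI)
  fix f :: nat
  have Lx: "0 < L x" using L_pos assms by blast
  define j where "j = nat \<lceil>U / L x * real p ^ f\<rceil>"
  have pos: "0 < U / L x * real p ^ f" using U_pos Lx p_pow_pos[of f] by (intro mult_pos_pos divide_pos_pos)
  have "real j = of_int \<lceil>U / L x * real p ^ f\<rceil>" unfolding j_def using pos by simp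
  then have j: "U / L x * real p ^ f \<le> real j" "real j \<le> U / L x * real p ^ f + 1" by linarith+
  have "U * real p ^ f \<le> L (nsm j x)" using j(1) Lx by (simp add: field_simps)
  then have "nsm j x \<in> T f" using pfam_far[OF assms(1) nsm_mem[OF assms(2)]] by blast
  moreover have "0 < j" using j(1) pos by (cases j) auto
  ultimately show "\<exists>j>0. nsm j x \<in> T f \<and> real j \<le> U / L x * real p ^ f + 1" using j by blast
qed

text \<open>Just above the two radii, multiples \<open>j x\<close> and \<open>j' x\<close> of the
  same point lie in the two families on every late level, and their sum is
  \<open>(j + j') x\<close>. Only points of one ray are added, so no convexity is involved.\<close>

lemma rad_triangle:
  assumes "pfam T" "pfam T'" "x \<in> S" "x \<noteq> 0"
    and sum: "\<And>e y z. y \<in> T e \<Longrightarrow> z \<in> T' e \<Longrightarrow> y + z \<in> T'' e"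
  shows "rad T'' x \<le> rad T x + rad T' x"
proof (rule field_le_epsilon)
  fix \<epsilon> :: real assume \<epsilon>: "0 < \<epsilon>"
  define v where "v = rad T x + \<epsilon> / 2"
  define v' where "v' = rad T' x + \<epsilon> / 2"
  obtain e0 where e0: "\<And>f j. e0 \<le> f \<Longrightarrow> v * real p ^ f \<le> real j \<Longrightarrow> nsm j x \<in> T f"
    using rad_less_imp_mem[OF assms(1,3,4), of v] \<epsilon> by (auto simp: v_def)
  obtain e1 where e1: "\<And>f j. e1 \<le> f \<Longrightarrow> v' * real p ^ f \<le> real j \<Longrightarrow> nsm j x \<in> T' f"
    using rad_less_imp_mem[OF assms(2,3,4), of v'] \<epsilon> by (auto simp: v'_def)
  have v: "0 < v" "0 < v'" using rad_nonneg assms(1-4) \<epsilon>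
    by (auto simp: v_def v'_def add_nonneg_pos)
  have "rad T'' x \<le> v + v'"
  proof (rule rad_leI)
    fix f assume f: "max e0 e1 \<le> f"
    define j where "j = nat \<lceil>v * real p ^ f\<rceil>"
    define j' where "j' = nat \<lceil>v' * real p ^ f\<rceil>"
    have pos: "0 < v * real p ^ f" "0 < v' * real p ^ f" using v p_pow_pos[of f] by simp_all
    have "real j = of_int \<lceil>v * real p ^ f\<rceil>" "real j' = of_int \<lceil>v' * real p ^ f\<rceil>"
      unfolding j_def j'_def using pos by simp_all
    then have j: "v * real p ^ f \<le> real j" "real j \<le> v * real p ^ f + 1"
      "v' * real p ^ f \<le> real j'" "real j' \<le> v' * real p ^ f + 1" by linarith+
    have "nsm (j + j') x \<in> T'' f" unfolding nsm_add_left
      using f by (intro sum e0 e1 j(1) j(3)) auto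
    moreover have "0 < j + j'" using j(1) pos by (cases j) auto
    moreover have "real (j + j') \<le> (v + v') * real p ^ f + 2" using j by (simp add: algebra_simps)
    ultimately show "\<exists>k>0. nsm k x \<in> T'' f \<and> real k \<le> (v + v') * real p ^ f + 2" by blast
  qed
  then show "rad T'' x \<le> rad T x + rad T' x + \<epsilon>" by (simp add: v_def v'_def)
qed

text \<open>The lattice points of the \<open>t\<close>-fold dilate of the part of the cone outside
  \<open>\<Delta>\<close>. The origin belongs to every dilate and is put in by hand, as
  \<open>rad\<close> has no geometric meaning there.\<close>

definition low :: "(nat \<Rightarrow> (nat \<Rightarrow> int) set) \<Rightarrow> real \<Rightarrow> (nat \<Rightarrow> int) set" where
  "low T t = {x \<in> S. x = 0 \<or> 1 / t < rad T x}"

definition A :: "(nat \<Rightarrow> (nat \<Rightarrow> int) set) \<Rightarrow> real \<Rightarrow> nat" where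
  "A T t = card (low T t)"

lemma low_subset_ball:
  assumes "pfam T" "0 < t"
  shows "low T t \<subseteq> ball (U * t)"
proof
  fix x assume x: "x \<in> low T t"
  show "x \<in> ball (U * t)"
  proof (cases "x = 0")
    case True then show ?thesis using U_pos assms zero_mem by (simp add: ball_def)
  next
    case False
    then have xS: "x \<in> S" "1 / t < rad T x" using x by (auto simp: low_def)
    then have "1 / t < U / L x" using rad_le_inverse_L[OF assms(1) xS(1) False] by linarith
    then show ?thesis using L_pos[OF xS(1) False] assms xS by (simp add: ball_def field_simps)
  qed
qed

lemma finite_low: "pfam T \<Longrightarrow> 0 < t \<Longrightarrow> finite (low T t)"
  by (rule finite_subset[OF low_subset_ball finite_ball])

lemma A_mono:
  assumes "pfam T" "0 < s" "s \<le> t"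
  shows "A T s \<le> A T t"
proof -
  have "1 / t \<le> 1 / s" using assms by (simp add: frac_le)
  then have "low T s \<subseteq> low T t" by (auto simp: low_def)
  then show ?thesis unfolding A_def using assms finite_low[of T t] by (intro card_mono) auto
qed

lemma card_ball_minus_low:
  assumes "pfam T" "0 < t" "U * t \<le> u"
  shows "real (card (ball u - low T t)) = real (N u) - real (A T t)"
proof -
  have "low T t \<subseteq> ball u" using low_subset_ball[OF assms(1,2)] assms(3) by (auto simp: ball_def)
  then show ?thesis unfolding N_def A_def
    using card_Diff_subset[of "low T t" "ball u"] finite_low[OF assms(1,2)] card_mono[of "ball u" "low T t"]
    by (simp add: of_nat_diff)
qed

text \<open>Adding semigroup elements can only decrease \<open>rad\<close>, so cubes fill the
  complement of \<open>low\<close>, not \<open>low\<close> itself. The filling is done inside a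
  ball, and subtracting from the number of its points yields an upper bound for \<open>A\<close>.
  The radius \<open>U * t\<close> suffices because \<open>low T t\<close> lies in that ball.\<close>

lemma A_dilate:
  assumes T: "pfam T" and t: "0 < t" and k: "0 < k"
  shows "real (A T (real k * t)) \<le> real (N (real k * (U * t + c0))) - real k ^ d * (real (N (U * t)) - real (A T t))"
proof -
  let ?X = "ball (U * t) - low T t" and ?Z = "ball (real k * (U * t + c0)) - low T (real k * t)"
  have "k ^ d * card ?X \<le> card ?Z"
  proof (rule card_dilated_le[where s = s0])
    fix x y assume x: "x \<in> ?X" and y: "y \<in> cube d k"
    have xS: "x \<in> S" "x \<noteq> 0" "rad T x \<le> 1 / t" "L x < U * t"
      using x by (auto simp: ball_def low_def)
    have s: "nsm k s0 + y \<in> S" "L (nsm k s0 + y) \<le> real k * c0" using cube_shift[OF y] by blast+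
    have kx: "nsm k x \<in> S" "0 < L (nsm k x)" using nsm_mem xS L_pos k by auto
    then have kx0: "nsm k x \<noteq> 0" by (metis ipa_0 less_irrefl)
    have "rad T (nsm k x + (nsm k s0 + y)) \<le> rad T (nsm k x)" using rad_add_le[OF T kx(1) kx0 s(1)] .
    also have "\<dots> \<le> rad T x / real k" using rad_nsm_le[OF T xS(1,2) k] .
    also have "\<dots> \<le> 1 / t / real k" using xS k by (intro divide_right_mono) auto
    finally have r: "rad T (nsm k x + (nsm k s0 + y)) \<le> 1 / (real k * t)" by (simp add: mult.commute)
    have "0 < L (nsm k x + (nsm k s0 + y))" unfolding ipa_add[of d a "nsm k x"]
      using kx L_nonneg[OF s(1)] by linarith
    then have n0: "nsm k x + (nsm k s0 + y) \<noteq> 0" by (metis ipa_0 less_irrefl)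
    have "real k * L x < real k * (U * t)" using xS k by simp
    then have "L (nsm k x + (nsm k s0 + y)) < real k * (U * t + c0)"
      unfolding ipa_add[of d a "nsm k x"] using s(2) by (simp add: distrib_left)
    then show "nsm k x + (nsm k s0 + y) \<in> ?Z"
      using r n0 add_mem[OF kx(1) s(1)] by (auto simp: ball_def low_def)
  qed (auto simp: ball_def supp finite_ball[unfolded ball_def])
  then have "real k ^ d * real (card ?X) \<le> real (card ?Z)"
    by (metis of_nat_le_iff of_nat_mult of_nat_power)
  moreover have "U * (real k * t) \<le> real k * (U * t + c0)"
    using c0_nonneg by (simp add: algebra_simps)
  ultimately show ?thesis
    using card_ball_minus_low[OF T t order_refl] card_ball_minus_low[OF T, of "real k * t"] t k by simp
qed

text \<open>The gap between the upper bound for the number of points in a slightly enlarged dilated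
  ball and the actual number in the original one, both normalised. Of the \<open>3 * c0\<close>, up
  to two parts come from the enlargement of the radius and one from
  \<open>N_le_density\<close>.\<close>

definition defect :: "real \<Rightarrow> real" where
  "defect t = density * (U + 3 * c0 / t) ^ d - real (N (U * t)) / t ^ d"

lemma N_U_asymp: "((\<lambda>t. real (N (U * t)) / t ^ d) \<longlongrightarrow> density * U ^ d) at_top"
proof -
  have "((\<lambda>t. real (N (U * t)) / (U * t) ^ d * U ^ d) \<longlongrightarrow> density * U ^ d) at_top"
    by (intro tendsto_mult tendsto_const filterlim_compose[OF N_asymp]
        filterlim_tendsto_pos_mult_at_top[OF tendsto_const U_pos filterlim_ident])
  then show ?thesis using U_pos by (simp add: power_mult_distrib)
qed

lemma defect_tendsto: "(defect \<longlongrightarrow> 0) at_top"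
proof -
  have "((\<lambda>t. density * (U + 3 * c0 / t) ^ d) \<longlongrightarrow> density * (U + 0) ^ d) at_top"
    by (intro tendsto_mult tendsto_power tendsto_add tendsto_const tendsto_const_divide_at_top)
  from tendsto_diff[OF this N_U_asymp] show ?thesis unfolding defect_def by simp
qed

text \<open>The computation shared by the two cube fillings, with \<open>x\<close> the number of
  points of \<open>low\<close>: one enlarges the radius by \<open>c0\<close>, the other by
  \<open>2 * c0\<close>. The resulting error does not depend on the dilation factor
  \<open>k\<close>.\<close>

lemma dilated_count_le_defect:
  assumes t: "0 < t" and k: "1 \<le> k" and big: "1 \<le> U * t" and c: "c \<le> 2 * c0" "0 \<le> c"
  shows "(real (N (real k * (U * t + c))) - real k ^ d * (real (N (U * t)) - x)) / (real k * t) ^ d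
      \<le> x / t ^ d + defect t"
proof -
  have "1 \<le> real k * (U * t + c)"
    using mult_mono[of 1 "real k" 1 "U * t + c"] k big c by simp
  then have "real (N (real k * (U * t + c))) \<le> density * (real k * (U * t + c) + c0) ^ d"
    by (rule N_le_density)
  also have "\<dots> \<le> density * (real k * (U * t + 3 * c0)) ^ d"
  proof (intro mult_left_mono power_mono)
    have "c0 \<le> real k * c0" using k c0_nonneg by (simp add: mult_le_cancel_right1)
    moreover have "real k * c \<le> real k * (2 * c0)" using c by (intro mult_left_mono) auto
    ultimately show "real k * (U * t + c) + c0 \<le> real k * (U * t + 3 * c0)" by (simp add: algebra_simps)
    show "0 \<le> real k * (U * t + c) + c0" using \<open>1 \<le> real k * (U * t + c)\<close> c0_nonneg by linarith
  qed (rule density_nonneg)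
  also have "\<dots> = density * (U + 3 * c0 / t) ^ d * (real k * t) ^ d"
  proof -
    have "real k * (U * t + 3 * c0) = (U + 3 * c0 / t) * (real k * t)" using t by (simp add: field_simps)
    then show ?thesis by (metis power_mult_distrib mult.assoc)
  qed
  finally have "real (N (real k * (U * t + c))) / (real k * t) ^ d \<le> density * (U + 3 * c0 / t) ^ d"
    using t k by (simp add: field_simps)
  moreover have "real k ^ d * (real (N (U * t)) - x) / (real k * t) ^ d = real (N (U * t)) / t ^ d - x / t ^ d"
    using k by (simp add: power_mult_distrib diff_divide_distrib)
  ultimately show ?thesis unfolding defect_def by (simp add: diff_divide_distrib)
qed

text \<open>For fixed \<open>t\<close> the dilation bound controls all radii \<open>k * t\<close>.
  Other radii are reached by monotonicity, with a loss factor \<open>(1 + t / m) ^ d\<close> that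
  tends to 1.\<close>

lemma A_asymp:
  assumes T: "pfam T"
  shows "\<exists>V\<ge>0. ((\<lambda>t. real (A T t) / t ^ d) \<longlongrightarrow> V) at_top"
proof (rule eventually_dominated_imp_convergent[OF _ _ defect_tendsto])
  show "eventually (\<lambda>t. 0 \<le> real (A T t) / t ^ d) at_top"
    using eventually_gt_at_top[of 0] by eventually_elim simp
  show "eventually (\<lambda>t. \<forall>\<delta>>0. eventually (\<lambda>m. real (A T m) / m ^ d
      \<le> real (A T t) / t ^ d + defect t + \<delta>) at_top) at_top"
    using eventually_ge_at_top[of "1 / U"] eventually_gt_at_top[of 0]
  proof (eventually_elim, intro allI impI)
    fix t \<delta> :: real assume tU: "1 / U \<le> t" and t: "0 < t" and \<delta>: "0 < \<delta>"
    define Q where "Q = real (A T t) / t ^ d + defect t"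
    have big: "1 \<le> U * t" using tU U_pos by (simp add: field_simps)
    have dil: "real (A T (real k * t)) / (real k * t) ^ d \<le> Q" if "1 \<le> k" for k
    proof -
      have "real (A T (real k * t)) / (real k * t) ^ d
        \<le> (real (N (real k * (U * t + c0))) - real k ^ d * (real (N (U * t)) - real (A T t))) / (real k * t) ^ d"
        using A_dilate[OF T t, of k] that t by (intro divide_right_mono) auto
      also have "\<dots> \<le> Q" unfolding Q_def
        using dilated_count_le_defect[OF t that big, of c0] c0_nonneg by simp
      finally show ?thesis .
    qed
    have Q: "0 \<le> Q" using dil[of 1] t by (intro order_trans[OF _ dil[of 1]]) auto
    have "((\<lambda>m. Q * (1 + t / m) ^ d) \<longlongrightarrow> Q * (1 + 0) ^ d) at_top"
      by (intro tendsto_mult tendsto_power tendsto_add tendsto_const tendsto_const_divide_at_top)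
    then have "eventually (\<lambda>m. Q * (1 + t / m) ^ d < Q + \<delta>) at_top"
      using \<delta> by (intro order_tendstoD(2)) auto
    then have "eventually (\<lambda>m. real (A T m) / m ^ d \<le> Q + \<delta>) at_top"
      using eventually_gt_at_top[of 0]
    proof eventually_elim
      case (elim m)
      define k where "k = nat \<lceil>m / t\<rceil>"
      have "real k = of_int \<lceil>m / t\<rceil>" unfolding k_def using elim t by simp
      then have k: "m / t \<le> real k" "real k \<le> m / t + 1" by linarith+
      have "0 < m / t" using elim t by simp
      then have k1: "1 \<le> k" using k(1) by (cases k) auto
      have kt: "m \<le> real k * t" "real k * t \<le> m + t" using k t by (simp_all add: field_simps)
      have "real (A T m) \<le> real (A T (real k * t))"
        using A_mono[OF T, of m "real k * t"] elim kt by simp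
      also have "\<dots> \<le> Q * (real k * t) ^ d"
        using dil[OF k1] t k1 by (simp add: pos_divide_le_eq)
      also have "\<dots> \<le> Q * (m + t) ^ d" using Q kt elim by (intro mult_left_mono power_mono) auto
      finally have "real (A T m) / m ^ d \<le> Q * (m + t) ^ d / m ^ d"
        using elim by (intro divide_right_mono) auto
      also have "\<dots> = Q * (1 + t / m) ^ d"
      proof -
        have "(m + t) / m = 1 + t / m" using elim by (simp add: add_divide_distrib)
        then show ?thesis by (metis power_divide times_divide_eq_right)
      qed
      finally show ?case using elim by linarith
    qed
    then show "eventually (\<lambda>m. real (A T m) / m ^ d \<le> real (A T t) / t ^ d + defect t + \<delta>) at_top"
      by (simp add: Q_def)
  qed
qed simp

section \<open>Comparison of the complements of \<open>T e\<close> with the layers of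
  \<open>rad\<close>\<close>

text \<open>A point with \<open>rad T x \<le> p\<^sup>-\<^sup>e\<close> need not lie in \<open>T e\<close>, but after a fixed shift
  into the interior of the cone all its large \<open>p\<close>-power multiples lie in the family.\<close>

lemma shifted_multiple_mem:
  assumes T: "pfam T" and x: "x \<in> S" "x \<noteq> 0" "rad T x \<le> 1 / real p ^ e"
  shows "eventually (\<lambda>f. nsm (p ^ f) (x + s1) \<in> T (e + f)) sequentially"
proof -
  define M where "M = Suc (nat (\<Sum>i<d. \<bar>x i\<bar>))"
  have M: "\<bar>x i\<bar> \<le> int M" if "i < d" for i
  proof -
    have "\<bar>x i\<bar> \<le> (\<Sum>i<d. \<bar>x i\<bar>)" using that by (intro member_le_sum) auto
    then show ?thesis unfolding M_def by linarith
  qed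
  have M1: "1 \<le> M" by (simp add: M_def)
  \<comment> \<open>The margin puts \<open>v\<close> strictly above \<open>rad T x\<close>. On level
    \<open>e + f\<close> it asks for \<open>P / (2 * M)\<close> copies of \<open>x\<close> beyond
    \<open>P\<close>, which the \<open>w\<close> below provides.\<close>
  define v where "v = (1 + 1 / (2 * real M)) / real p ^ e"
  have "1 / real p ^ e < v" unfolding v_def using M1 p_gt_1 by (intro divide_strict_right_mono) auto
  then have "rad T x < v" using x by linarith
  then obtain e0 where e0: "\<And>f j. e0 \<le> f \<Longrightarrow> v * real p ^ f \<le> real j \<Longrightarrow> nsm j x \<in> T f"
    using rad_less_imp_mem[OF T x(1,2)] by blast
  have "nsm (p ^ f) (x + s1) \<in> T (e + f)" if f: "e0 \<le> f" "2 * M \<le> f" for f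
  proof -
    define P where "P = p ^ f"
    \<comment> \<open>The number of extra copies of \<open>x\<close>: enough to pass the threshold
      \<open>v\<close>, yet few enough that every coordinate of \<open>w x\<close> is at most
      \<open>P\<close> in absolute value.\<close>
    define w where "w = P div M"
    have "f < p ^ f" using p_gt_1 by (simp add: power_gt_expt)
    then have "2 * M \<le> P" using f unfolding P_def by linarith
    have wM: "w * M \<le> P" by (simp add: w_def)
    have "P < (w + 1) * M" using M1 unfolding w_def by (simp add: dividend_less_div_times)
    then have "real P < real ((w + 1) * M)" by (simp only: of_nat_less_iff)
    then have wlow: "real P < (real w + 1) * real M" by (simp add: algebra_simps)
    have "real P / (2 * real M) \<le> real w"
    proof -
      have "2 * real M \<le> real P" using \<open>2 * M \<le> P\<close> by linarith
      moreover have "real P \<le> real w * real M + real M" using wlow by (simp add: algebra_simps)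
      ultimately have "real P \<le> real w * (2 * real M)" by linarith
      then show ?thesis using M1 by (simp add: divide_le_eq)
    qed
    moreover have "v * real p ^ (e + f) = real P + real P / (2 * real M)"
    proof -
      have "v * real p ^ e = 1 + 1 / (2 * real M)" using p_pow_pos[of e] by (simp add: v_def)
      then have "v * real p ^ (e + f) = (1 + 1 / (2 * real M)) * real P"
        by (simp add: P_def power_add mult.assoc[symmetric])
      then show ?thesis by (simp add: distrib_right)
    qed
    ultimately have "v * real p ^ (e + f) \<le> real (P + w)" by simp
    then have 1: "nsm (P + w) x \<in> T (e + f)" using e0 f by simp
    \<comment> \<open>These summands add up to \<open>P * s1 - w x\<close> with nonnegative
      coefficients on \<open>b\<close> and \<open>b'\<close>, so that vector lies in
      \<open>S\<close>. Adding it to \<open>(P + w) x\<close> cancels the extra copies and leaves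
      \<open>P * (x + s1)\<close>.\<close>
    let ?g = "\<lambda>i. nsm (nat (int P - int w * x i)) (b i) + nsm (nat (int P + int w * x i)) (b' i)"
    have wx: "\<bar>int w * x i\<bar> \<le> int P" if "i < d" for i
    proof -
      have "\<bar>int w * x i\<bar> \<le> int w * int M"
        using M[OF that] by (simp add: abs_mult mult_left_mono)
      then show ?thesis using wM by (metis of_nat_le_iff of_nat_mult order_trans)
    qed
    have nn: "0 \<le> int P - int w * x i" "0 \<le> int P + int w * x i" if "i < d" for i
      using wx[OF that] by linarith+
    have 2: "(\<lambda>j. \<Sum>i<d. ?g i j) \<in> S"
      by (intro sum_mem add_mem nsm_mem b_mem b'_mem)
    have "(\<Sum>i<d. ?g i j) = int P * s1 j - int w * x j" for j
    proof -
      have "(\<Sum>i<d. ?g i j) = (\<Sum>i<d. int P * (b i j + b' i j) - int w * (x i * (b i j - b' i j)))"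
        using nn by (intro sum.cong) (auto simp: algebra_simps)
      also have "\<dots> = int P * s1 j - int w * x j"
        using vec_decomp[of x j] supp[OF x(1)] by (simp add: s1_def sum_distrib_left sum_subtractf)
      finally show ?thesis .
    qed
    then have "nsm P (x + s1) = (\<lambda>j. \<Sum>i<d. ?g i j) + nsm (P + w) x"
      by (auto simp: fun_eq_iff algebra_simps)
    then show ?thesis using pfam_add[OF T 2 1] by (simp only: P_def)
  qed
  then show ?thesis unfolding eventually_sequentially by (intro exI[of _ "max e0 (2 * M)"]) auto
qed

lemma finite_complement:
  assumes "pfam T"
  shows "finite (S - T e)" "S - T e \<subseteq> ball (U * real p ^ e)"
proof -
  show *: "S - T e \<subseteq> ball (U * real p ^ e)"
    using pfam_far[OF assms] by (auto simp: ball_def not_le[symmetric])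
  show "finite (S - T e)" using finite_subset[OF * finite_ball] .
qed

text \<open>A nonzero member of \<open>T e\<close> has \<open>rad\<close> at most
  \<open>1 / p ^ e\<close>, by the multiple \<open>k = 1\<close>. The extra 1 pays for the origin,
  which always lies in \<open>low\<close> but possibly also in \<open>T e\<close>.\<close>

lemma complement_lower:
  assumes T: "pfam T"
  shows "A T (real p ^ e) \<le> card (S - T e) + 1"
proof -
  have "low T (real p ^ e) \<subseteq> insert 0 (S - T e)"
  proof
    fix x assume x: "x \<in> low T (real p ^ e)"
    have "x \<notin> T e" if "x \<noteq> 0"
      using rad_le[of 1 x T e] x that by (auto simp: low_def)
    then show "x \<in> insert 0 (S - T e)" using x by (auto simp: low_def)
  qed
  then have "card (low T (real p ^ e)) \<le> card (insert 0 (S - T e))"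
    using finite_complement[OF T] by (intro card_mono) auto
  also have "\<dots> \<le> card (S - T e) + 1" using card_insert_le_m1 finite_complement[OF T]
    by (simp add: card_insert_if)
  finally show ?thesis by (simp add: A_def)
qed

text \<open>Cube filling by the factor \<open>p ^ f\<close> inside \<open>T (e + f)\<close>: the
  shift by \<open>s1\<close> puts the multiples into the family, the shift by \<open>s0\<close>
  makes the cubes semigroup translates. As only finitely many points are dilated, one
  \<open>f\<close> serves them all.\<close>

lemma complement_upper:
  assumes T: "pfam T" and big: "1 \<le> U * real p ^ e"
  shows "eventually (\<lambda>f. real (card (S - T (e + f))) / (real p ^ (e + f)) ^ d
     \<le> real (A T (real p ^ e)) / (real p ^ e) ^ d + defect (real p ^ e)) sequentially"
proof -
  let ?q = "real p ^ e"
  let ?X = "ball (U * ?q) - low T ?q"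
  have "eventually (\<lambda>f. \<forall>x\<in>?X. nsm (p ^ f) (x + s1) \<in> T (e + f)) sequentially"
  proof (intro eventually_ball_finite ballI shifted_multiple_mem[OF T])
    show "x \<in> S" "x \<noteq> 0" "rad T x \<le> 1 / ?q" if "x \<in> ?X" for x
      using that by (auto simp: ball_def low_def)
  qed simp
  then show ?thesis
  proof eventually_elim
    case (elim f)
    define P where "P = p ^ f"
    have P: "1 \<le> P" using p_gt_1 by (simp add: P_def)
    \<comment> \<open>One \<open>c0\<close> is the value of \<open>s1\<close>, the other the cost of
      the cube.\<close>
    define u where "u = real P * (U * ?q + 2 * c0)"
    let ?Z = "ball u \<inter> T (e + f)"
    have "P ^ d * card ?X \<le> card ?Z"
    proof (rule card_dilated_le[where s = "s1 + s0"])
      fix x y assume x: "x \<in> ?X" and y: "y \<in> cube d P"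
      have s: "nsm P s0 + y \<in> S" "L (nsm P s0 + y) \<le> real P * c0" using cube_shift[OF y] by blast+
      have 1: "nsm P (x + s1) \<in> T (e + f)" using elim x by (simp only: P_def)
      have eq: "nsm P x + (nsm P (s1 + s0) + y) = (nsm P s0 + y) + nsm P (x + s1)"
        by (auto simp: fun_eq_iff algebra_simps)
      have m: "nsm P x + (nsm P (s1 + s0) + y) \<in> T (e + f)"
        unfolding eq using pfam_add[OF T s(1) 1] .
      have "L x < U * ?q" using x by (simp add: ball_def)
      then have "real P * L x < real P * (U * ?q)" using P by simp
      then have "L (nsm P x + (nsm P (s1 + s0) + y)) < u"
        unfolding eq ipa_add[of d a "nsm P s0 + y"] using s(2)
        by (simp add: u_def L_s1 algebra_simps)
      then show "nsm P x + (nsm P (s1 + s0) + y) \<in> ?Z"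
        using m pfam_subset[OF T m] unfolding ball_def by blast
    qed (auto simp: ball_def supp finite_ball[unfolded ball_def])
    then have 1: "real P ^ d * real (card ?X) \<le> real (card ?Z)"
      by (metis of_nat_le_iff of_nat_mult of_nat_power)
    have qP: "real p ^ (e + f) = real P * ?q" by (simp add: P_def power_add)
    have "U * real p ^ (e + f) \<le> u" unfolding u_def qP using c0_nonneg by (simp add: algebra_simps)
    then have "S - T (e + f) \<subseteq> ball u" using finite_complement(2)[OF T, of "e + f"] by (auto simp: ball_def)
    then have "ball u = ?Z \<union> (S - T (e + f))" by (auto simp: ball_def)
    then have "N u = card ?Z + card (S - T (e + f))" unfolding N_def
      using card_Un_disjoint[of ?Z "S - T (e + f)"] finite_complement[OF T] by auto
    then have "real (card (S - T (e + f))) \<le> real (N u) - real P ^ d * (real (N (U * ?q)) - real (A T ?q))"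
      using 1 card_ball_minus_low[OF T p_pow_pos order_refl, of e] by simp
    then have "real (card (S - T (e + f))) / (real P * ?q) ^ d
      \<le> (real (N u) - real P ^ d * (real (N (U * ?q)) - real (A T ?q))) / (real P * ?q) ^ d"
      by (intro divide_right_mono) auto
    also have "\<dots> \<le> real (A T ?q) / ?q ^ d + defect ?q"
      unfolding u_def using dilated_count_le_defect[OF p_pow_pos P big, of "2 * c0"] c0_nonneg by simp
    finally show ?case by (simp add: qP)
  qed
qed

lemma p_pow_at_top: "filterlim (\<lambda>e. real p ^ e) at_top sequentially"
proof (rule filterlim_at_top_mono[OF filterlim_real_sequentially])
  have "real e \<le> real p ^ e" for e
    using power_gt_expt[of p e] p_gt_1 by (simp flip: of_nat_power)
  then show "eventually (\<lambda>e. real e \<le> real p ^ e) sequentially" by simp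
qed

lemma complement_asymp:
  assumes T: "pfam T" and V: "((\<lambda>t. real (A T t) / t ^ d) \<longlongrightarrow> V) at_top"
  shows "(\<lambda>e. real (card (S - T e)) / (real p ^ e) ^ d) \<longlonglongrightarrow> V"
proof -
  let ?h = "\<lambda>e. real (A T (real p ^ e)) / (real p ^ e) ^ d"
  have h: "?h \<longlonglongrightarrow> V" using filterlim_compose[OF V p_pow_at_top] .
  show ?thesis
  proof (rule order_tendstoI)
    fix v assume v: "v < V"
    have "(\<lambda>e. 1 / (real p ^ e) ^ d) \<longlonglongrightarrow> 0"
    proof -
      have "filterlim (\<lambda>e. (real p ^ e) ^ d) at_top sequentially"
        using filterlim_compose[OF filterlim_pow_at_top[OF d_pos filterlim_ident] p_pow_at_top] .
      from filterlim_compose[OF tendsto_const_divide_at_top this] show ?thesis .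
    qed
    from tendsto_diff[OF h this] have "(\<lambda>e. ?h e - 1 / (real p ^ e) ^ d) \<longlonglongrightarrow> V" by simp
    then have "eventually (\<lambda>e. v < ?h e - 1 / (real p ^ e) ^ d) sequentially"
      using v by (rule order_tendstoD(1))
    then show "eventually (\<lambda>e. v < real (card (S - T e)) / (real p ^ e) ^ d) sequentially"
    proof eventually_elim
      case (elim e)
      have "(real (A T (real p ^ e)) - 1) / (real p ^ e) ^ d \<le> real (card (S - T e)) / (real p ^ e) ^ d"
        using complement_lower[OF T, of e] by (intro divide_right_mono) auto
      then show ?case using elim by (simp add: diff_divide_distrib)
    qed
  next
    fix v assume v: "V < v"
    have "(\<lambda>e. ?h e + defect (real p ^ e)) \<longlonglongrightarrow> V + 0"
      by (intro tendsto_add h filterlim_compose[OF defect_tendsto p_pow_at_top])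
    then have ev1: "eventually (\<lambda>e. ?h e + defect (real p ^ e) < v) sequentially"
      using v by (intro order_tendstoD(2)) auto
    have ev2: "eventually (\<lambda>e. 1 / U \<le> real p ^ e) sequentially"
      using p_pow_at_top by (simp add: filterlim_at_top)
    obtain e where e: "?h e + defect (real p ^ e) < v" "1 / U \<le> real p ^ e"
      using eventually_happens'[OF _ eventually_conj[OF ev1 ev2]] by auto
    have "1 \<le> U * real p ^ e" using e U_pos by (simp add: field_simps)
    from complement_upper[OF T this]
    obtain f0 where f0: "\<And>f. f0 \<le> f \<Longrightarrow> real (card (S - T (e + f))) / (real p ^ (e + f)) ^ d
       \<le> ?h e + defect (real p ^ e)" by (auto simp: eventually_sequentially)
    show "eventually (\<lambda>e. real (card (S - T e)) / (real p ^ e) ^ d < v) sequentially"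
      unfolding eventually_sequentially
    proof (intro exI allI impI)
      fix n assume "e + f0 \<le> n"
      then show "real (card (S - T n)) / (real p ^ n) ^ d < v"
        using f0[of "n - e"] e by (simp add: le_diff_conv2)
    qed
  qed
qed

end

section \<open>The Brunn--Minkowski type inequality\<close>

definition step_weight :: "nat \<Rightarrow> nat \<Rightarrow> real" where
  "step_weight d n = 1 / (real n + 1) ^ d - 1 / (real n + 2) ^ d"

text \<open>A discrete layer-cake formula for \<open>r ^ d\<close> with levels
  \<open>1 / (n + 1)\<close>, truncated after \<open>M\<close> layers.\<close>

definition layer_sum :: "nat \<Rightarrow> nat \<Rightarrow> real \<Rightarrow> real" where
  "layer_sum d M r = (\<Sum>n<M. if 1 / (real n + 1) < r then step_weight d n else 0)"

lemma step_weight_nonneg: "0 \<le> step_weight d n"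
  unfolding step_weight_def by (simp add: frac_le power_mono)

lemma layer_sum_nonneg: "0 \<le> layer_sum d M r"
  unfolding layer_sum_def by (intro sum_nonneg) (simp add: step_weight_nonneg)

lemma layer_sum_telescope:
  assumes k: "\<And>n. 1 / (real n + 1) < r \<longleftrightarrow> k \<le> n"
  shows "layer_sum d M r = (if k \<le> M then 1 / (real k + 1) ^ d - 1 / (real M + 1) ^ d else 0)"
proof (induction M)
  case 0 then show ?case by (simp add: layer_sum_def)
next
  case (Suc M)
  have "layer_sum d (Suc M) r = layer_sum d M r + (if k \<le> M then step_weight d M else 0)"
    by (simp add: layer_sum_def k)
  then show ?case using Suc by (auto simp: step_weight_def le_Suc_eq add.commute)
qed

lemma layer_threshold:
  fixes r :: real
  assumes "0 < r"
  obtains k where "\<And>n. 1 / (real n + 1) < r \<longleftrightarrow> k \<le> n"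
proof -
  define k where "k = (LEAST n. 1 / (real n + 1) < r)"
  obtain n where "1 / r < real n" using reals_Archimedean2 by blast
  then have "1 / r < real n + 1" by simp
  then have ex: "1 / (real n + 1) < r" using assms by (simp add: field_simps)
  have kk: "1 / (real k + 1) < r" unfolding k_def using ex by (rule LeastI)
  have "1 / (real m + 1) < r \<longleftrightarrow> k \<le> m" for m
  proof
    show "k \<le> m" if "1 / (real m + 1) < r" unfolding k_def using that by (rule Least_le)
    show "1 / (real m + 1) < r" if "k \<le> m"
      using kk that by (intro order.strict_trans1[OF _ kk] frac_le) auto
  qed
  then show ?thesis using that by blast
qed

lemma layer_sum_le_power:
  assumes "0 \<le> r" "0 < d"
  shows "layer_sum d M r \<le> r ^ d"
proof (cases "r = 0")
  case True
  then show ?thesis using assms by (simp add: layer_sum_def not_less)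
next
  case False
  then obtain k where k: "\<And>n. 1 / (real n + 1) < r \<longleftrightarrow> k \<le> n" using layer_threshold[of r] assms by auto
  have "layer_sum d M r \<le> (1 / (real k + 1)) ^ d"
    unfolding layer_sum_telescope[OF k] by (simp add: power_divide)
  also have "\<dots> \<le> r ^ d" using k[of k] by (intro power_mono) auto
  finally show ?thesis .
qed

text \<open>The layers see \<open>r\<close> only through the integer \<open>k\<close> with
  \<open>1 / (k + 1) < r \<le> 1 / k\<close>. This rounding costs a factor \<open>1 + 1 / k\<close>,
  close to 1 once \<open>r\<close> is at most \<open>1 / K\<close>; the term
  \<open>1 / M ^ d\<close> makes up for the truncation.\<close>

lemma power_le_layer_sum:
  fixes r :: real
  assumes "0 \<le> r" "0 < d" "1 \<le> K" "r \<le> 1 / real K" "1 \<le> M"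
  shows "r ^ d \<le> (1 + 1 / real K) ^ d * (layer_sum d M r + 1 / real M ^ d)"
proof (cases "r = 0")
  case True
  have "0 \<le> (1 + 1 / real K) ^ d * (layer_sum d M r + 1 / real M ^ d)"
    using layer_sum_nonneg[of d M r] by (intro mult_nonneg_nonneg add_nonneg_nonneg) auto
  with True show ?thesis using assms by (simp add: zero_power)
next
  case False
  then obtain k where k: "\<And>n. 1 / (real n + 1) < r \<longleftrightarrow> k \<le> n" using layer_threshold[of r] assms by auto
  have "1 / (real k + 1) < 1 / real K" using k[of k] assms by linarith
  then have Kk: "K \<le> k" using assms by (simp add: field_simps)
  then obtain k' where k': "k = Suc k'" using assms by (cases k) auto
  have rk: "r \<le> 1 / real k" using k[of k'] by (simp add: k' add.commute)
  have factor: "1 \<le> (1 + 1 / real K) ^ d" by (intro one_le_power) simp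
  show ?thesis
  proof (cases "k \<le> M")
    case True
    have "1 / real k = (1 + 1 / real k) * (1 / (real k + 1))" using Kk assms by (simp add: field_simps)
    also have "\<dots> \<le> (1 + 1 / real K) * (1 / (real k + 1))"
      using Kk assms by (intro mult_right_mono add_left_mono frac_le) auto
    finally have "r ^ d \<le> ((1 + 1 / real K) * (1 / (real k + 1))) ^ d"
      using rk assms by (intro power_mono) auto
    also have "\<dots> = (1 + 1 / real K) ^ d * (1 / (real k + 1) ^ d)"
      by (simp add: power_mult_distrib power_divide)
    also have "\<dots> \<le> (1 + 1 / real K) ^ d * (layer_sum d M r + 1 / real M ^ d)"
    proof (intro mult_left_mono)
      have "1 / (real M + 1) ^ d \<le> 1 / real M ^ d" using assms by (intro frac_le power_mono) auto
      then show "1 / (real k + 1) ^ d \<le> layer_sum d M r + 1 / real M ^ d"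
        unfolding layer_sum_telescope[OF k] using True by simp
    qed (use factor in simp)
    finally show ?thesis .
  next
    case False
    have "r \<le> 1 / real M" using rk False assms by (intro order_trans[OF rk] frac_le) auto
    then have "r ^ d \<le> (1 / real M) ^ d" using assms by (intro power_mono)
    also have "\<dots> \<le> layer_sum d M r + 1 / real M ^ d"
      using layer_sum_nonneg[of d M r] by (simp add: power_divide)
    also have "\<dots> \<le> (1 + 1 / real K) ^ d * (layer_sum d M r + 1 / real M ^ d)"
      using mult_right_mono[OF factor, of "layer_sum d M r + 1 / real M ^ d"] layer_sum_nonneg[of d M r]
      by simp
    finally show ?thesis .
  qed
qed

text \<open>Each term equals \<open>1 - ((n + 1) / (n + 2)) ^ d\<close>, which is at least
  \<open>1 / (n + 2)\<close>. This is where the logarithm comes from.\<close>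

lemma sum_step_weight_at_top:
  assumes "0 < d"
  shows "filterlim (\<lambda>M. \<Sum>n<M. step_weight d n * (real n + 1) ^ d) at_top sequentially"
proof (rule filterlim_at_top_mono[OF sum_inverse_Suc_at_top], intro always_eventually allI sum_mono)
  fix M n :: nat
  have "((real n + 1) / (real n + 2)) ^ d \<le> ((real n + 1) / (real n + 2)) ^ 1"
    using assms by (intro power_decreasing) auto
  then have "1 - (real n + 1) / (real n + 2) \<le> 1 - ((real n + 1) / (real n + 2)) ^ d" by simp
  moreover have "1 - (real n + 1) / (real n + 2) = 1 / (real n + 2)" by (simp add: field_simps)
  moreover have "step_weight d n * (real n + 1) ^ d = 1 - ((real n + 1) / (real n + 2)) ^ d"
    by (simp add: step_weight_def left_diff_distrib power_divide)
  ultimately show "1 / (real n + 2) \<le> step_weight d n * (real n + 1) ^ d" by simp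
qed

section \<open>Logarithmic sums of the radial function\<close>

context p_cone_semigroup
begin

definition W :: "(nat \<Rightarrow> (nat \<Rightarrow> int) set) \<Rightarrow> nat \<Rightarrow> real" where
  "W T M = (\<Sum>x\<in>ball (U * real M) - {0}. rad T x ^ d)"

definition Y :: "(nat \<Rightarrow> (nat \<Rightarrow> int) set) \<Rightarrow> nat \<Rightarrow> real" where
  "Y T M = (\<Sum>n<M. step_weight d n * real (A T (real n + 1)))"

text \<open>Exchange the sum over layers with the sum over points. The ball of radius
  \<open>U * M\<close> contains all layers involved, and the origin, which lies in each of them, is
  split off.\<close>

lemma Y_eq_layer_sums:
  assumes T: "pfam T" and M: "1 \<le> M"
  shows "Y T M = (\<Sum>n<M. step_weight d n) + (\<Sum>x\<in>ball (U * real M) - {0}. layer_sum d M (rad T x))"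
proof -
  let ?B = "ball (U * real M)"
  let ?g = "\<lambda>x n. if x \<in> low T (real n + 1) then step_weight d n else 0"
  have "step_weight d n * real (A T (real n + 1)) = (\<Sum>x\<in>?B. ?g x n)" if "n < M" for n
  proof -
    have "U * (real n + 1) \<le> U * real M" using that U_pos by (intro mult_left_mono) auto
    then have "low T (real n + 1) \<subseteq> ?B"
      using low_subset_ball[OF T, of "real n + 1"] by (fastforce simp: ball_def)
    then have "low T (real n + 1) = {x \<in> ?B. x \<in> low T (real n + 1)}" by blast
    then have "real (A T (real n + 1)) = real (card {x \<in> ?B. x \<in> low T (real n + 1)})"
      by (simp add: A_def)
    then show ?thesis by (simp add: sum.If_cases Int_def mult.commute)
  qed
  then have "Y T M = (\<Sum>n<M. \<Sum>x\<in>?B. ?g x n)" unfolding Y_def by (intro sum.cong) auto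
  also have "\<dots> = (\<Sum>x\<in>?B. \<Sum>n<M. ?g x n)" by (rule sum.swap)
  also have "\<dots> = (\<Sum>n<M. ?g 0 n) + (\<Sum>x\<in>?B - {0}. \<Sum>n<M. ?g x n)"
    by (rule sum.remove) (use M U_pos zero_mem in \<open>auto simp: ball_def finite_ball[unfolded ball_def]\<close>)
  also have "(\<Sum>n<M. ?g 0 n) = (\<Sum>n<M. step_weight d n)" using zero_mem by (simp add: low_def)
  also have "(\<Sum>x\<in>?B - {0}. \<Sum>n<M. ?g x n) = (\<Sum>x\<in>?B - {0}. layer_sum d M (rad T x))"
    unfolding layer_sum_def by (intro sum.cong) (auto simp: low_def ball_def)
  finally show ?thesis .
qed

lemma Y_le_W:
  assumes T: "pfam T" and M: "1 \<le> M"
  shows "Y T M \<le> 2 ^ d + W T M"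
proof -
  \<comment> \<open>The contribution of the origin is that of a point whose radius exceeds every
    level; all levels are at most 1, so 2 will do.\<close>
  have "(\<Sum>n<M. step_weight d n) = layer_sum d M 2"
    unfolding layer_sum_def by (intro sum.cong) (auto simp: divide_less_eq)
  also have "\<dots> \<le> 2 ^ d" using layer_sum_le_power[of 2 d M] d_pos by simp
  moreover have "(\<Sum>x\<in>ball (U * real M) - {0}. layer_sum d M (rad T x)) \<le> W T M"
    unfolding W_def
    by (intro sum_mono layer_sum_le_power rad_nonneg[OF T] d_pos) (auto simp: ball_def)
  ultimately show ?thesis unfolding Y_eq_layer_sums[OF assms] by simp
qed

text \<open>The error \<open>C\<close> does not depend on \<open>M\<close>. Points with
  \<open>rad\<close> above \<open>1 / K\<close> form a finite set and contribute \<open>CK\<close>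
  at most; elsewhere the truncation error \<open>1 / M ^ d\<close> is summed over at most
  \<open>C1 * M ^ d\<close> points.\<close>

lemma W_le_Y:
  assumes T: "pfam T" and K: "1 \<le> K"
  obtains C where "\<And>M. 1 \<le> M \<Longrightarrow> W T M \<le> (1 + 1 / real K) ^ d * Y T M + C"
proof -
  define CK where "CK = (\<Sum>x\<in>low T (real K) - {0}. rad T x ^ d)"
  define C1 where "C1 = density * (U + 1 + c0) ^ d"
  define F where "F = (1 + 1 / real K) ^ d"
  have F: "0 \<le> F" by (simp add: F_def)
  have "W T M \<le> F * Y T M + (F * C1 + CK)" if M: "1 \<le> M" for M
  proof -
    let ?B = "ball (U * real M) - {0}"
    have "real (N (U * real M)) \<le> real (N ((U + 1) * real M))"
      by (intro of_nat_mono N_mono) (simp add: algebra_simps)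
    also have "\<dots> \<le> density * ((U + 1) * real M + c0) ^ d"
    proof (rule N_le_density)
      have "1 * 1 \<le> (U + 1) * real M" using U_pos M by (intro mult_mono) auto
      then show "1 \<le> (U + 1) * real M" by simp
    qed
    also have "\<dots> \<le> density * ((U + 1 + c0) * real M) ^ d"
    proof (intro mult_left_mono power_mono density_nonneg)
      have "c0 * 1 \<le> c0 * real M" using c0_nonneg M by (intro mult_left_mono) auto
      then show "(U + 1) * real M + c0 \<le> (U + 1 + c0) * real M" by (simp add: algebra_simps)
    qed (use U_pos c0_nonneg in simp)
    finally have "real (N (U * real M)) \<le> C1 * real M ^ d" by (simp add: C1_def power_mult_distrib)
    then have N1: "real (N (U * real M)) / real M ^ d \<le> C1" using M by (simp add: field_simps)
    have "rad T x ^ d \<le> F * (layer_sum d M (rad T x) + 1 / real M ^ d)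
        + (if x \<in> low T (real K) then rad T x ^ d else 0)" if "x \<in> ?B" for x
    proof -
      have x: "x \<in> S" "x \<noteq> 0" using that by (auto simp: ball_def)
      have r0: "0 \<le> rad T x" using rad_nonneg[OF T x] .
      have nn: "0 \<le> F * (layer_sum d M (rad T x) + 1 / real M ^ d)"
        using F layer_sum_nonneg by (intro mult_nonneg_nonneg add_nonneg_nonneg) auto
      show ?thesis
      proof (cases "x \<in> low T (real K)")
        case True then show ?thesis using nn by simp
      next
        case False
        then have "rad T x \<le> 1 / real K" using x by (auto simp: low_def)
        from power_le_layer_sum[OF r0 d_pos K this M] show ?thesis using False by (simp add: F_def)
      qed
    qed
    then have "W T M \<le> (\<Sum>x\<in>?B. F * (layer_sum d M (rad T x) + 1 / real M ^ d)
        + (if x \<in> low T (real K) then rad T x ^ d else 0))"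
      unfolding W_def by (rule sum_mono)
    also have "\<dots> = F * ((\<Sum>x\<in>?B. layer_sum d M (rad T x)) + real (card ?B) / real M ^ d)
        + (\<Sum>x\<in>?B \<inter> low T (real K). rad T x ^ d)"
      by (simp add: sum.distrib sum_distrib_left[symmetric] sum.If_cases distrib_left)
    also have "\<dots> \<le> F * (Y T M + C1) + CK"
    proof (intro add_mono mult_left_mono F)
      show "(\<Sum>x\<in>?B. layer_sum d M (rad T x)) \<le> Y T M"
        unfolding Y_eq_layer_sums[OF T M] using step_weight_nonneg by (simp add: sum_nonneg)
      have "card ?B \<le> N (U * real M)" unfolding N_def by (intro card_mono) auto
      then have "real (card ?B) / real M ^ d \<le> real (N (U * real M)) / real M ^ d"
        by (intro divide_right_mono) auto
      then show "real (card ?B) / real M ^ d \<le> C1" using N1 by linarith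
      show "(\<Sum>x\<in>?B \<inter> low T (real K). rad T x ^ d) \<le> CK"
        unfolding CK_def using finite_low[OF T, of "real K"] K rad_nonneg[OF T]
        by (intro sum_mono2) (auto simp: low_def)
    qed
    finally show ?thesis by (simp add: distrib_left)
  qed
  then show ?thesis using that unfolding F_def by blast
qed

text \<open>The pointwise inequality is summed to one for \<open>W\<close> and moved to
  \<open>Y\<close>, at the price of a bounded error and a factor \<open>(1 + 1 / K) ^ d\<close>. The
  divergent weights \<open>z\<close> remove the error in the limit over \<open>M\<close>, and
  \<open>K\<close> tends to infinity afterwards.\<close>

lemma volume_weighted_bound:
  assumes T: "pfam T" "pfam T'" "pfam T''"
    and sum: "\<And>e y z. y \<in> T e \<Longrightarrow> z \<in> T' e \<Longrightarrow> y + z \<in> T'' e"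
    and V: "((\<lambda>t. real (A T t) / t ^ d) \<longlongrightarrow> V) at_top"
    and V': "((\<lambda>t. real (A T' t) / t ^ d) \<longlongrightarrow> V') at_top"
    and V'': "((\<lambda>t. real (A T'' t) / t ^ d) \<longlongrightarrow> V'') at_top"
    and ij: "0 < i" "0 < j"
  shows "V'' \<le> (i + j) ^ (d - 1) * (V / i ^ (d - 1) + V' / j ^ (d - 1))"
proof -
  define \<alpha> where "\<alpha> = (i + j) ^ (d - 1) / i ^ (d - 1)"
  define \<beta> where "\<beta> = (i + j) ^ (d - 1) / j ^ (d - 1)"
  have pos: "0 \<le> \<alpha>" "0 \<le> \<beta>" using ij by (auto simp: \<alpha>_def \<beta>_def)
  have W_le: "W T'' M \<le> \<alpha> * W T M + \<beta> * W T' M" for M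
  proof -
    have "rad T'' x ^ d \<le> \<alpha> * rad T x ^ d + \<beta> * rad T' x ^ d" if "x \<in> ball (U * real M) - {0}" for x
    proof -
      have x: "x \<in> S" "x \<noteq> 0" using that by (auto simp: ball_def)
      have "rad T'' x ^ d \<le> (rad T x + rad T' x) ^ d"
        using rad_triangle[OF T(1,2) x sum] rad_nonneg[OF T(3) x] by (intro power_mono) auto
      also have "\<dots> \<le> (i + j) ^ (d - 1) * (rad T x ^ d / i ^ (d - 1) + rad T' x ^ d / j ^ (d - 1))"
        using rad_nonneg T x ij d_pos by (intro weighted_power_sum_le) auto
      also have "\<dots> = \<alpha> * rad T x ^ d + \<beta> * rad T' x ^ d" by (simp add: \<alpha>_def \<beta>_def distrib_left)
      finally show ?thesis .
    qed
    then show ?thesis unfolding W_def sum_distrib_left sum.distrib[symmetric] by (intro sum_mono) auto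
  qed
  define h where "h T n = real (A T (real n + 1)) / (real n + 1) ^ d" for T and n :: nat
  have shift: "filterlim (\<lambda>n. real n + 1) at_top sequentially"
    by (rule filterlim_at_top_mono[OF filterlim_real_sequentially]) simp
  have h: "h T \<longlonglongrightarrow> V" "h T' \<longlonglongrightarrow> V'" "h T'' \<longlonglongrightarrow> V''"
    unfolding h_def using filterlim_compose[OF V shift] filterlim_compose[OF V' shift]
      filterlim_compose[OF V'' shift] by simp_all
  define z where "z n = step_weight d n * (real n + 1) ^ d" for n
  have Yz: "Y T M = (\<Sum>n<M. z n * h T n)" for T M
    unfolding Y_def z_def h_def by (intro sum.cong) (auto simp: add_pos_nonneg less_imp_neq[symmetric])
  have K_bound: "V'' \<le> (1 + 1 / real K) ^ d * (\<alpha> * V + \<beta> * V')" if K: "1 \<le> K" for K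
  proof -
    define F where "F = (1 + 1 / real K) ^ d"
    obtain C where C: "\<And>M. 1 \<le> M \<Longrightarrow> W T M \<le> F * Y T M + C"
      using W_le_Y[OF T(1) K] unfolding F_def by blast
    obtain C' where C': "\<And>M. 1 \<le> M \<Longrightarrow> W T' M \<le> F * Y T' M + C'"
      using W_le_Y[OF T(2) K] unfolding F_def by blast
    define B where "B = max 0 (2 ^ d + \<alpha> * C + \<beta> * C')"
    have "V'' - F * (\<alpha> * V + \<beta> * V') \<le> 0"
    proof (rule bounded_weighted_sums_imp_limit_nonpos)
      show "0 \<le> z n" for n unfolding z_def by (simp add: step_weight_nonneg)
      show "filterlim (\<lambda>M. \<Sum>n<M. z n) at_top sequentially"
        unfolding z_def by (rule sum_step_weight_at_top[OF d_pos])
      show "(\<lambda>n. h T'' n - F * (\<alpha> * h T n + \<beta> * h T' n)) \<longlonglongrightarrow> V'' - F * (\<alpha> * V + \<beta> * V')"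
        by (intro tendsto_diff tendsto_mult tendsto_add tendsto_const h)
      show "(\<Sum>n<M. z n * (h T'' n - F * (\<alpha> * h T n + \<beta> * h T' n))) \<le> B" for M
      proof (cases "M = 0")
        case True then show ?thesis by (simp add: B_def)
      next
        case False
        then have M: "1 \<le> M" by simp
        have "Y T'' M \<le> 2 ^ d + (\<alpha> * W T M + \<beta> * W T' M)"
          using Y_le_W[OF T(3) M] W_le[of M] by linarith
        also have "\<dots> \<le> 2 ^ d + (\<alpha> * (F * Y T M + C) + \<beta> * (F * Y T' M + C'))"
          by (intro add_left_mono add_mono mult_left_mono C C' M pos)
        finally have "Y T'' M - F * (\<alpha> * Y T M + \<beta> * Y T' M) \<le> B"
          by (simp add: B_def algebra_simps)
        moreover have "(\<Sum>n<M. z n * (h T'' n - F * (\<alpha> * h T n + \<beta> * h T' n))) =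
            Y T'' M - F * (\<alpha> * Y T M + \<beta> * Y T' M)"
          unfolding Yz by (simp add: sum_distrib_left sum_subtractf sum.distrib[symmetric] algebra_simps)
        ultimately show ?thesis by simp
      qed
    qed
    then show ?thesis by (simp add: F_def)
  qed
  have "(\<lambda>K. (1 + 1 / real K) ^ d * (\<alpha> * V + \<beta> * V')) \<longlonglongrightarrow> (1 + 0) ^ d * (\<alpha> * V + \<beta> * V')"
    by (intro tendsto_mult tendsto_power tendsto_add tendsto_const lim_1_over_n)
  then have "V'' \<le> (1 + 0) ^ d * (\<alpha> * V + \<beta> * V')"
    by (rule LIMSEQ_le_const) (use K_bound in blast)
  then show ?thesis by (simp add: \<alpha>_def \<beta>_def distrib_left)
qed

text \<open>Choosing \<open>i\<close> and \<open>j\<close> as the \<open>d\<close>-th roots of the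
  volumes turns the weighted bound into \<open>(i + j) ^ d\<close>. The extra \<epsilon>/2 keeps
  them positive when a volume vanishes.\<close>

lemma volume_root_triangle:
  assumes T: "pfam T" "pfam T'" "pfam T''"
    and sum: "\<And>e y z. y \<in> T e \<Longrightarrow> z \<in> T' e \<Longrightarrow> y + z \<in> T'' e"
    and V: "((\<lambda>t. real (A T t) / t ^ d) \<longlongrightarrow> V) at_top" "0 \<le> V"
    and V': "((\<lambda>t. real (A T' t) / t ^ d) \<longlongrightarrow> V') at_top" "0 \<le> V'"
    and V'': "((\<lambda>t. real (A T'' t) / t ^ d) \<longlongrightarrow> V'') at_top" "0 \<le> V''"
  shows "V'' powr (1 / real d) \<le> V powr (1 / real d) + V' powr (1 / real d)"
proof (rule field_le_epsilon)
  fix \<epsilon> :: real assume \<epsilon>: "0 < \<epsilon>"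
  define i where "i = V powr (1 / real d) + \<epsilon> / 2"
  define j where "j = V' powr (1 / real d) + \<epsilon> / 2"
  have ij: "0 < i" "0 < j" using \<epsilon> by (auto simp: i_def j_def add_nonneg_pos)
  have root: "v \<le> k ^ d" if "v powr (1 / real d) \<le> k" "0 \<le> v" "0 < k" for v k :: real
  proof -
    have "(v powr (1 / real d)) powr real d \<le> k powr real d"
      using that by (intro powr_mono2) auto
    then show ?thesis using that d_pos by (simp add: powr_powr powr_realpow)
  qed
  have le: "V \<le> i ^ d" "V' \<le> j ^ d" using root V V' ij \<epsilon> by (auto simp: i_def j_def)
  have dd: "x ^ d = x * x ^ (d - 1)" for x :: real using d_pos by (cases d) auto
  have "V'' \<le> (i + j) ^ (d - 1) * (V / i ^ (d - 1) + V' / j ^ (d - 1))"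
    by (rule volume_weighted_bound[OF T sum V(1) V'(1) V''(1) ij])
  also have "\<dots> \<le> (i + j) ^ (d - 1) * (i + j)"
    using le ij by (intro mult_left_mono add_mono) (auto simp: dd divide_le_eq)
  also have "\<dots> = (i + j) ^ d" by (simp add: dd)
  finally have "V'' powr (1 / real d) \<le> ((i + j) ^ d) powr (1 / real d)"
    using V'' by (intro powr_mono2) auto
  also have "\<dots> = i + j"
    using ij d_pos by (simp add: powr_realpow[symmetric] powr_powr)
  finally show "V'' powr (1 / real d) \<le> V powr (1 / real d) + V' powr (1 / real d) + \<epsilon>"
    by (simp add: i_def j_def)
qed

end

section \<open>Lengths of modules inside the fraction field\<close>

lemma emb_0 [simp]: "emb 0 = 0" and emb_1 [simp]: "emb 1 = 1"
  and emb_add: "emb (x + y) = emb x + emb y" and emb_mult: "emb (x * y) = emb x * emb y"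
  and emb_eq_iff [simp]: "emb x = emb y \<longleftrightarrow> x = y"
  by (simp_all add: emb_def Zero_fract_def One_fract_def eq_fract)

lemma emb_eq_0_iff [simp]: "emb x = 0 \<longleftrightarrow> x = 0"
  using emb_eq_iff[of x 0] by simp

lemma emb_uminus: "emb (- x) = - emb x"
  using emb_add[of x "- x"] by (simp add: eq_neg_iff_add_eq_0 add.commute)

lemma fract_eq_divide_emb:
  obtains x y where "q = emb x / emb y" "y \<noteq> 0"
  by (cases q) (simp add: emb_def)

text \<open>Modules are kept as subsets of the fraction field, so that ideals of the domain and the
  pieces of the valuation filtration can be added, intersected and scaled in one place.\<close>

definition submod :: "'a::idom fract set \<Rightarrow> bool" where
  "submod M \<longleftrightarrow> 0 \<in> M \<and> (\<forall>x\<in>M. \<forall>y\<in>M. x + y \<in> M) \<and> (\<forall>r. \<forall>x\<in>M. emb r * x \<in> M)"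

definition msum :: "'a::idom fract set \<Rightarrow> 'a fract set \<Rightarrow> 'a fract set" where
  "msum M P = {x + y | x y. x \<in> M \<and> y \<in> P}"

lemma submod_0: "submod M \<Longrightarrow> 0 \<in> M"
  and submod_add: "submod M \<Longrightarrow> x \<in> M \<Longrightarrow> y \<in> M \<Longrightarrow> x + y \<in> M"
  and submod_smult: "submod M \<Longrightarrow> x \<in> M \<Longrightarrow> emb r * x \<in> M"
  by (auto simp: submod_def)

lemma submod_uminus: "submod M \<Longrightarrow> x \<in> M \<Longrightarrow> - x \<in> M"
  using submod_smult[of M x "- 1"] by (simp add: emb_uminus)

lemma submod_diff: "submod M \<Longrightarrow> x \<in> M \<Longrightarrow> y \<in> M \<Longrightarrow> x - y \<in> M"
  using submod_add[of M x "- y"] submod_uminus by auto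

lemma submod_Int: "submod M \<Longrightarrow> submod P \<Longrightarrow> submod (M \<inter> P)"
  by (auto simp: submod_def)

lemma submod_msum:
  assumes "submod M" "submod P"
  shows "submod (msum M P)"
  unfolding submod_def
proof (intro conjI ballI allI)
  show "0 \<in> msum M P" using assms submod_0 unfolding msum_def by (force intro: exI[of _ 0])
  fix x assume "x \<in> msum M P"
  then obtain u v where x: "x = u + v" "u \<in> M" "v \<in> P" by (auto simp: msum_def)
  show "emb r * x \<in> msum M P" for r
  proof -
    have "emb r * x = emb r * u + emb r * v" using x by (simp add: distrib_left)
    moreover have "emb r * u \<in> M" "emb r * v \<in> P" using x assms submod_smult by blast+
    ultimately show ?thesis unfolding msum_def by blast
  qed
  fix y assume "y \<in> msum M P"
  then obtain u' v' where y: "y = u' + v'" "u' \<in> M" "v' \<in> P" by (auto simp: msum_def)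
  have "x + y = (u + u') + (v + v')" using x y by simp
  then show "x + y \<in> msum M P" using x y submod_add assms unfolding msum_def by blast
qed

lemma msum_mono: "M \<subseteq> M' \<Longrightarrow> msum M P \<subseteq> msum M' P"
  by (auto simp: msum_def)

lemma msum_memI1: "submod P \<Longrightarrow> x \<in> M \<Longrightarrow> x \<in> msum M P"
  unfolding msum_def using submod_0 by force

lemma msum_memI2: "submod M \<Longrightarrow> x \<in> P \<Longrightarrow> x \<in> msum M P"
  unfolding msum_def using submod_0 by force

lemma msum_commute:
  fixes M P :: "'a::idom fract set"
  shows "msum M P = msum P M"
proof -
  have "msum M P \<subseteq> msum P M" for M P :: "'a fract set"
  proof
    fix z assume "z \<in> msum M P"
    then obtain x y where "z = y + x" "x \<in> M" "y \<in> P" unfolding msum_def by (auto simp: add.commute)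
    then show "z \<in> msum P M" unfolding msum_def by blast
  qed
  then show ?thesis by blast
qed

lemma msum_absorb:
  assumes "submod M" "submod P" "M \<subseteq> P"
  shows "msum M P = P" "msum P M = P"
proof -
  have "msum M P \<subseteq> P" using assms(3) submod_add[OF assms(2)] unfolding msum_def by blast
  moreover have "P \<subseteq> msum M P" using msum_memI2[OF assms(1)] by blast
  ultimately show "msum M P = P" by blast
  then show "msum P M = P" by (simp add: msum_commute)
qed

section \<open>Strict chains of submodules and lengths of quotients\<close>

inductive chain :: "'a::idom fract set \<Rightarrow> 'a fract set \<Rightarrow> nat \<Rightarrow> bool" for M where
  chain_0: "submod M \<Longrightarrow> chain M M 0"
| chain_Suc: "chain M P n \<Longrightarrow> P \<subset> N \<Longrightarrow> submod N \<Longrightarrow> chain M N (Suc n)"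

lemma chain_submod: "chain M N n \<Longrightarrow> submod M \<and> submod N \<and> M \<subseteq> N"
  by (induction rule: chain.induct) auto

lemma chain_eq_imp_0: "chain M M n \<Longrightarrow> n = 0"
proof (erule chain.cases)
  fix P k N assume "M = N" "n = Suc k" "chain M P k" "P \<subset> N"
  then show "n = 0" using chain_submod[of M P k] by blast
qed

lemma chain_append: "chain P N k \<Longrightarrow> chain M P n \<Longrightarrow> chain M N (n + k)"
proof (induction rule: chain.induct)
  case (chain_Suc Q k N)
  then have "chain M N (Suc (n + k))" by (intro chain.chain_Suc[of M Q]) auto
  then show ?case by simp
qed simp

lemma chain_extend: "chain M P n \<Longrightarrow> P \<subseteq> N \<Longrightarrow> submod N \<Longrightarrow> \<exists>k. n \<le> k \<and> chain M N k \<and> (P \<noteq> N \<longrightarrow> n < k)"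
proof (cases "P = N")
  case False
  assume "chain M P n" "P \<subseteq> N" "submod N"
  then have "chain M N (Suc n)" using False by (intro chain_Suc[of M P n N]) auto
  then show ?thesis by (intro exI[of _ "Suc n"]) simp
qed auto

text \<open>The modular law: a strict step survives the intersection with \<open>P\<close> or the sum with \<open>P\<close>.\<close>

lemma chain_split:
  assumes "chain M N n" "submod P"
  shows "\<exists>a b. chain (M \<inter> P) (N \<inter> P) a \<and> chain (msum M P) (msum N P) b \<and> n \<le> a + b"
  using assms(1)
proof (induction rule: chain.induct)
  case chain_0
  then have "chain (M \<inter> P) (M \<inter> P) 0" "chain (msum M P) (msum M P) 0"
    using assms(2) by (auto intro: chain.chain_0 submod_Int submod_msum)
  then show ?case by blast
next
  case (chain_Suc Q n N)
  then obtain a b where ab: "chain (M \<inter> P) (Q \<inter> P) a" "chain (msum M P) (msum Q P) b" "n \<le> a + b" by blast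
  have Q: "submod Q" using chain_submod chain_Suc by blast
  obtain a' where a': "a \<le> a'" "chain (M \<inter> P) (N \<inter> P) a'" "Q \<inter> P \<noteq> N \<inter> P \<Longrightarrow> a < a'"
    using chain_extend[OF ab(1), of "N \<inter> P"] chain_Suc submod_Int assms(2) by blast
  obtain b' where b': "b \<le> b'" "chain (msum M P) (msum N P) b'" "msum Q P \<noteq> msum N P \<Longrightarrow> b < b'"
    using chain_extend[OF ab(2), of "msum N P"] chain_Suc submod_msum assms(2) msum_mono[of Q N P] by blast
  have "Q \<inter> P \<noteq> N \<inter> P \<or> msum Q P \<noteq> msum N P"
  proof (rule ccontr)
    assume "\<not> ?thesis"
    then have e: "Q \<inter> P = N \<inter> P" "msum Q P = msum N P" by auto
    have "N \<subseteq> Q"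
    proof
      fix x assume x: "x \<in> N"
      then have "x \<in> msum Q P" using msum_memI1[OF assms(2) x] e by simp
      then obtain u v where uv: "x = u + v" "u \<in> Q" "v \<in> P" by (auto simp: msum_def)
      have "x - u \<in> N" using submod_diff[OF \<open>submod N\<close> x] uv chain_Suc by blast
      then have "v \<in> Q" using uv e by auto
      then show "x \<in> Q" using uv submod_add[OF Q] by blast
    qed
    then show False using chain_Suc by blast
  qed
  then have "Suc n \<le> a' + b'" using a' b' ab(3) by linarith
  then show ?case using a' b' by blast
qed

text \<open>\<open>n\<close> is the length of the quotient of \<open>N\<close> by \<open>M\<close>.
  As a relation it also asserts that the length is finite.\<close>

definition flen :: "'a::idom fract set \<Rightarrow> 'a fract set \<Rightarrow> nat \<Rightarrow> bool" where
  "flen M N n \<longleftrightarrow> chain M N n \<and> (\<forall>k. chain M N k \<longrightarrow> k \<le> n)"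

lemma flen_unique: "flen M N n \<Longrightarrow> flen M N k \<Longrightarrow> n = k"
  by (auto simp: flen_def intro: antisym)

lemma flen_submod: "flen M N n \<Longrightarrow> submod M \<and> submod N \<and> M \<subseteq> N"
  unfolding flen_def using chain_submod[of M N n] by blast

lemma flen_refl: "submod M \<Longrightarrow> flen M M 0"
  unfolding flen_def using chain_0[of M] chain_eq_imp_0[of M] by auto

lemma chain_exists: "submod M \<Longrightarrow> submod N \<Longrightarrow> M \<subseteq> N \<Longrightarrow> \<exists>n. chain M N n"
  using chain_extend[OF chain_0, of M N] by blast

lemma flen_exists:
  assumes "submod M" "submod N" "M \<subseteq> N" "\<And>k. chain M N k \<Longrightarrow> k \<le> K"
  shows "\<exists>n\<le>K. flen M N n"
proof -
  obtain n0 where "chain M N n0" using chain_exists assms by blast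
  then have "chain M N (GREATEST n. chain M N n)"
    using GreatestI_nat[of "chain M N" n0 K] assms(4) by blast
  moreover have "k \<le> (GREATEST n. chain M N n)" if "chain M N k" for k
    using Greatest_le_nat[of "chain M N" k K] that assms(4) by blast
  ultimately show ?thesis unfolding flen_def using assms(4) by blast
qed

text \<open>Splitting any chain at \<open>P\<close> leaves a chain from \<open>M\<close> to
  \<open>P\<close> and one from \<open>P\<close> to \<open>N\<close>, whose lengths are bounded by
  \<open>a\<close> and \<open>b\<close>.\<close>

lemma flen_add:
  assumes a: "flen M P a" and b: "flen P N b"
  shows "flen M N (a + b)"
  unfolding flen_def
proof (intro conjI allI impI)
  show "chain M N (a + b)" using chain_append a b unfolding flen_def by blast
  fix k assume "chain M N k"
  have s: "submod M" "submod P" "submod N" "M \<subseteq> P" "P \<subseteq> N" using flen_submod a b by auto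
  obtain u v where "chain (M \<inter> P) (N \<inter> P) u" "chain (msum M P) (msum N P) v" "k \<le> u + v"
    using chain_split[OF \<open>chain M N k\<close> s(2)] by blast
  moreover have "M \<inter> P = M" "N \<inter> P = P" "msum M P = P" "msum N P = N"
    using s msum_absorb(1)[OF s(1,2,4)] msum_absorb(2)[OF s(2,3,5)] by auto
  ultimately show "k \<le> a + b" using a b unfolding flen_def by (metis add_mono order_trans)
qed

lemma flen_intermediate:
  assumes n: "flen M N n" and P: "submod P" "M \<subseteq> P" "P \<subseteq> N"
  obtains a b where "flen M P a" "flen P N b" "n = a + b"
proof -
  have s: "submod M" "submod N" using flen_submod n by auto
  obtain a0 b0 where c0: "chain M P a0" "chain P N b0" using chain_exists s P by metis
  have "k \<le> n" if "chain M P k" for k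
    using chain_append[OF c0(2) that] n unfolding flen_def by (metis add_leD1)
  then obtain a where a: "flen M P a" using flen_exists s P by metis
  have "k \<le> n" if "chain P N k" for k
    using chain_append[OF that c0(1)] n unfolding flen_def by (metis add_leD2)
  then obtain b where b: "flen P N b" using flen_exists s P by metis
  show ?thesis using that[OF a b] flen_unique[OF n flen_add[OF a b]] by blast
qed

text \<open>Splitting transports chains in both directions between the two quotients of the second
  isomorphism theorem, since in each direction one of the two resulting chains is trivial. No
  isomorphism has to be built.\<close>

lemma flen_second_iso:
  assumes M: "submod M" and P: "submod P" and n: "flen P (msum M P) n"
  shows "flen (M \<inter> P) M n"
proof -
  have sub: "M \<subseteq> msum M P" "P \<subseteq> msum M P" using M P msum_memI1 msum_memI2 by blast+
  have up: "\<exists>b\<ge>k. chain P (msum M P) b" if c: "chain (M \<inter> P) M k" for k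
  proof -
    obtain a b where ab: "chain (M \<inter> P \<inter> P) (M \<inter> P) a" "chain (msum (M \<inter> P) P) (msum M P) b" "k \<le> a + b"
      using chain_split[OF c P] by blast
    have "a = 0" using ab(1) chain_eq_imp_0 by (simp add: Int_assoc)
    moreover have "msum (M \<inter> P) P = P" using msum_absorb(1)[OF submod_Int[OF M P] P] by blast
    ultimately show ?thesis using ab by auto
  qed
  have down: "\<exists>a\<ge>k. chain (M \<inter> P) M a" if c: "chain P (msum M P) k" for k
  proof -
    obtain a b where ab: "chain (P \<inter> M) (msum M P \<inter> M) a" "chain (msum P M) (msum (msum M P) M) b" "k \<le> a + b"
      using chain_split[OF c M] by blast
    note c' = msum_commute[of P M]
    have "msum (msum M P) M = msum M P" using msum_absorb(2)[OF M submod_msum[OF M P] sub(1)] .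
    then have "b = 0" using ab(2) chain_eq_imp_0 c' by simp
    moreover have "msum M P \<inter> M = M" using sub by blast
    ultimately show ?thesis using ab by (auto simp: Int_commute)
  qed
  have bd: "k \<le> n" if "chain (M \<inter> P) M k" for k
    using up[OF that] n unfolding flen_def by (meson order_trans)
  obtain a where a: "a \<ge> n" "chain (M \<inter> P) M a" using down n unfolding flen_def by blast
  then have "a = n" using bd by (simp add: antisym)
  then show ?thesis unfolding flen_def using a bd by blast
qed

lemma submod_scale:
  assumes M: "submod M"
  shows "submod ((*) x ` M)"
  unfolding submod_def
proof (intro conjI ballI allI)
  show "0 \<in> (*) x ` M" using submod_0[OF M] by (intro image_eqI[of _ _ 0]) auto
  fix y assume "y \<in> (*) x ` M"
  then obtain u where u: "y = x * u" "u \<in> M" by blast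
  show "emb r * y \<in> (*) x ` M" for r
    using u submod_smult[OF M] by (intro image_eqI[of _ _ "emb r * u"]) auto
  fix z assume "z \<in> (*) x ` M"
  then obtain v where "z = x * v" "v \<in> M" by blast
  then show "y + z \<in> (*) x ` M"
    using u submod_add[OF M] by (intro image_eqI[of _ _ "u + v"]) (auto simp: distrib_left)
qed

lemma chain_scale:
  assumes "chain M N n" "x \<noteq> 0"
  shows "chain ((*) x ` M) ((*) x ` N) n"
  using assms(1)
proof (induction rule: chain.induct)
  case chain_0 then show ?case by (intro chain.chain_0 submod_scale)
next
  case (chain_Suc P n N)
  have "inj ((*) x)" using assms(2) by (auto intro: injI)
  then have "(*) x ` P \<subset> (*) x ` N" using chain_Suc(2) by (simp add: inj_image_subset_iff psubset_eq inj_image_eq_iff)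
  then show ?case using chain_Suc by (intro chain.chain_Suc submod_scale)
qed

lemma flen_scale:
  assumes "flen M N n" "x \<noteq> 0"
  shows "flen ((*) x ` M) ((*) x ` N) n"
  unfolding flen_def
proof (intro conjI allI impI)
  show "chain ((*) x ` M) ((*) x ` N) n" using assms chain_scale unfolding flen_def by blast
  fix k assume "chain ((*) x ` M) ((*) x ` N) k"
  then have "chain ((*) (inverse x) ` (*) x ` M) ((*) (inverse x) ` (*) x ` N) k"
    by (rule chain_scale) (use assms(2) in simp)
  moreover have "(*) (inverse x) ` (*) x ` Z = Z" for Z
    using assms(2) by (simp add: image_image mult.assoc[symmetric] del: mult_cancel_left)
  ultimately have "chain M N k" by (simp only:)
  then show "k \<le> n" using assms(1) unfolding flen_def by blast
qed

text \<open>The quotient is generated by the class of \<open>w\<close> and killed by the maximal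
  ideal, hence a vector space of dimension at most one over the residue field.\<close>

lemma flen_cyclic_step:
  assumes M: "submod M" and max: "is_maximal_ideal \<mm>" and small: "\<And>r. r \<in> \<mm> \<Longrightarrow> emb r * w \<in> M"
  shows "\<exists>n. flen M (msum M {emb r * w | r. True}) n"
proof -
  let ?N = "msum M {emb r * w | r. True}"
  have W: "submod {emb r * w | r. True}"
    unfolding submod_def
    by (auto intro: exI[of _ 0]) (metis distrib_right emb_add, metis mult.assoc emb_mult)
  have N: "submod ?N" "M \<subseteq> ?N" using submod_msum[OF M W] msum_memI1[OF W] by blast+
  have simple: "Q = ?N" if Q: "submod Q" "M \<subset> Q" "Q \<subseteq> ?N" for Q
  proof -
    obtain q where q: "q \<in> Q" "q \<notin> M" using Q by blast
    then obtain x r where xr: "q = x + emb r * w" "x \<in> M" using Q(3) by (auto simp: msum_def)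
    have rw: "emb r * w \<in> Q" using submod_diff[OF Q(1) q(1), of x] xr Q(2) by auto
    have "emb r * w \<notin> M" using q xr submod_add[OF M] by blast
    then have r: "r \<notin> \<mm>" using small by blast
    \<comment> \<open>As \<open>r\<close> lies outside the maximal ideal, the ideal generated by
      both is everything. So \<open>1 = \<mu> + s * r\<close>, which recovers \<open>w\<close> from
      the multiple \<open>r w\<close> and an element of \<open>M\<close>.\<close>
    define J where "J = {\<mu> + s * r | \<mu> s. \<mu> \<in> \<mm>}"
    have id: "is_ideal \<mm>" using max by (simp add: is_maximal_ideal_def)
    have "is_ideal J" unfolding is_ideal_def
    proof (intro conjI ballI allI)
      have "0 = 0 + 0 * r" by simp
      then show "0 \<in> J" using id unfolding J_def is_ideal_def by blast
      fix u assume "u \<in> J"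
      then obtain \<mu> s where u: "u = \<mu> + s * r" "\<mu> \<in> \<mm>" by (auto simp: J_def)
      have "c * u = c * \<mu> + (c * s) * r" for c using u by (simp add: algebra_simps)
      then show "c * u \<in> J" for c using id u unfolding J_def is_ideal_def by blast
      fix v assume "v \<in> J"
      then obtain \<mu>' s' where v: "v = \<mu>' + s' * r" "\<mu>' \<in> \<mm>" by (auto simp: J_def)
      have "u + v = (\<mu> + \<mu>') + (s + s') * r" using u v by (simp add: algebra_simps)
      then show "u + v \<in> J" using id u v unfolding J_def is_ideal_def by blast
    qed
    moreover have "\<mm> \<subseteq> J" unfolding J_def by (force intro: exI[of _ 0])
    moreover have "r \<in> J" using id unfolding J_def is_ideal_def by (force intro: exI[of _ 0] exI[of _ 1])
    ultimately have "J = UNIV" using max r unfolding is_maximal_ideal_def by blast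
    then obtain \<mu> s where one: "1 = \<mu> + s * r" "\<mu> \<in> \<mm>" unfolding J_def by blast
    have "w = emb (\<mu> + s * r) * w" by (simp only: one(1)[symmetric] emb_1 mult_1_left)
    then have "w = emb \<mu> * w + emb s * (emb r * w)" by (simp only: emb_add emb_mult distrib_right mult.assoc)
    moreover have "emb \<mu> * w \<in> Q" using small one Q by blast
    ultimately have "w \<in> Q" using submod_add[OF Q(1)] submod_smult[OF Q(1) rw] by metis
    then have "?N \<subseteq> Q" using Q submod_add[OF Q(1)] submod_smult[OF Q(1)] by (auto simp: msum_def)
    then show ?thesis using Q by blast
  qed
  have "k \<le> 1" if "chain M ?N k" for k
    using that
  proof (cases rule: chain.cases)
    case (chain_Suc P n)
    then have "\<not> M \<subset> P" using simple[of P] chain_submod by blast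
    then have "P = M" using chain_submod chain_Suc by blast
    then show ?thesis using chain_Suc(1,2) chain_eq_imp_0[of M n] by simp
  qed simp
  then show ?thesis using flen_exists[OF M N, of 1] by blast
qed

lemma chain_iff_fun:
  "chain M N n \<longleftrightarrow> (\<exists>C. C 0 = M \<and> C n = N \<and> (\<forall>i\<le>n. submod (C i)) \<and> (\<forall>i<n. C i \<subset> C (Suc i)))"
proof
  show "\<exists>C. C 0 = M \<and> C n = N \<and> (\<forall>i\<le>n. submod (C i)) \<and> (\<forall>i<n. C i \<subset> C (Suc i))" if "chain M N n"
    using that
  proof (induction rule: chain.induct)
    case chain_0 then show ?case by (intro exI[of _ "\<lambda>_. M"]) auto
  next
    case (chain_Suc P n N)
    then obtain C where C: "C 0 = M" "C n = P" "\<forall>i\<le>n. submod (C i)" "\<forall>i<n. C i \<subset> C (Suc i)" by blast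
    show ?case using C chain_Suc
      by (intro exI[of _ "C(Suc n := N)"]) (auto simp: less_Suc_eq le_Suc_eq)
  qed
  show "chain M N n" if ex: "\<exists>C. C 0 = M \<and> C n = N \<and> (\<forall>i\<le>n. submod (C i)) \<and> (\<forall>i<n. C i \<subset> C (Suc i))"
  proof -
    obtain C where C: "C 0 = M" "C n = N" "\<forall>i\<le>n. submod (C i)" "\<forall>i<n. C i \<subset> C (Suc i)" using ex by blast
    have "chain M (C k) k" if "k \<le> n" for k
      using that
    proof (induction k)
      case 0 then show ?case using C by (auto intro: chain_0)
    next
      case (Suc k) then show ?case using C by (intro chain_Suc[of M "C k"]) auto
    qed
    then show ?thesis using C by blast
  qed
qed

lemma submod_emb_image: "is_ideal I \<Longrightarrow> submod (emb ` I)"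
  unfolding submod_def is_ideal_def
  by (auto simp: image_iff emb_add[symmetric] emb_mult[symmetric] simp del: emb_eq_iff)

lemma is_ideal_emb_vimage: "submod M \<Longrightarrow> is_ideal (emb -` M)"
  unfolding submod_def is_ideal_def by (auto simp: emb_add emb_mult)

text \<open>The embedding identifies chains of ideals above \<open>I\<close> with chains of
  submodules. The hypothesis makes the supremum of natural numbers in \<open>colength\<close> an
  attained maximum.\<close>

lemma colength_eq_flen:
  fixes I :: "'a::idom set"
  assumes I: "is_ideal I" and n: "flen (emb ` I) (emb ` UNIV) n"
  shows "colength I = n"
proof -
  have inj: "inj (emb :: 'a \<Rightarrow> 'a fract)" by (auto intro: injI)
  have "{n. \<exists>C::nat \<Rightarrow> 'a set. C 0 = I \<and> C n = UNIV \<and> (\<forall>i\<le>n. is_ideal (C i)) \<and> (\<forall>i<n. C i \<subset> C (Suc i))}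
      = {n. chain (emb ` I) (emb ` UNIV) n}" (is "?L = ?R")
  proof (intro equalityI subsetI; clarify)
    fix k and C :: "nat \<Rightarrow> 'a set"
    assume C: "I = C 0" "C k = UNIV" "\<forall>i\<le>k. is_ideal (C i)" "\<forall>i<k. C i \<subset> C (Suc i)"
    have "emb ` C i \<subset> emb ` C (Suc i)" if "i < k" for i
      using C(4) that inj by (auto simp: inj_image_subset_iff psubset_eq inj_image_eq_iff)
    then show "chain (emb ` C 0) (emb ` UNIV) k"
      unfolding chain_iff_fun using C by (intro exI[of _ "\<lambda>i. emb ` C i"]) (auto intro: submod_emb_image)
  next
    fix k assume "chain (emb ` I) (emb ` UNIV) k"
    then obtain C where C: "C 0 = emb ` I" "C k = emb ` UNIV" "\<forall>i\<le>k. submod (C i)" "\<forall>i<k. C i \<subset> C (Suc i)"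
      unfolding chain_iff_fun by blast
    have le: "C i \<subseteq> emb ` UNIV" if "i \<le> k" for i
      using that
    proof (induction rule: inc_induct)
      case base then show ?case using C by simp
    next
      case (step i) then show ?case using C by blast
    qed
    have "emb -` C i \<subset> emb -` C (Suc i)" if i: "i < k" for i
    proof -
      obtain x where x: "x \<in> C (Suc i)" "x \<notin> C i" using C(4) i by blast
      then obtain y where "x = emb y" using le[of "Suc i"] i by auto
      then show ?thesis using C(4) i x by blast
    qed
    then show "\<exists>C. C 0 = I \<and> C k = UNIV \<and> (\<forall>i\<le>k. is_ideal (C i)) \<and> (\<forall>i<k. C i \<subset> C (Suc i))"
      using C inj by (intro exI[of _ "\<lambda>i. emb -` C i"]) (auto intro: is_ideal_emb_vimage simp: inj_vimage_image_eq)
  qed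
  then have "colength I = Sup ?R" unfolding colength_def by simp
  also have "\<dots> = n" using n unfolding flen_def by (intro cSup_eq_maximum) auto
  finally show ?thesis .
qed

section \<open>Valuations of OK domains\<close>

text \<open>Bolzano-Weierstrass, one coordinate at a time, by passing to monotone
  subsequences.\<close>

lemma bounded_coords_convergent_subseq:
  fixes y :: "nat \<Rightarrow> nat \<Rightarrow> real"
  assumes "\<And>n j. \<bar>y n j\<bar> \<le> 1"
  shows "\<exists>\<phi> u. strict_mono \<phi> \<and> (\<forall>j<d. (\<lambda>n. y (\<phi> n) j) \<longlonglongrightarrow> u j)"
proof (induction d)
  case 0
  have "strict_mono (\<lambda>n::nat. n)" by (simp add: strict_mono_def)
  then show ?case by blast
next
  case (Suc d)
  then obtain \<phi> u where \<phi>: "strict_mono \<phi>" "\<forall>j<d. (\<lambda>n. y (\<phi> n) j) \<longlonglongrightarrow> u j" by blast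
  obtain \<psi> :: "nat \<Rightarrow> nat" where \<psi>: "strict_mono \<psi>" "monoseq (\<lambda>n. y (\<phi> (\<psi> n)) d)"
    using seq_monosub[of "\<lambda>n. y (\<phi> n) d"] by auto
  have "Bseq (\<lambda>n. y (\<phi> (\<psi> n)) d)" using assms by (intro BseqI[of 1]) auto
  then obtain l where l: "(\<lambda>n. y (\<phi> (\<psi> n)) d) \<longlonglongrightarrow> l"
    using Bseq_monoseq_convergent \<psi>(2) convergent_def by blast
  have "(\<lambda>n. y ((\<phi> \<circ> \<psi>) n) j) \<longlonglongrightarrow> (u(d := l)) j" if "j < Suc d" for j
  proof (cases "j = d")
    case True then show ?thesis using l by simp
  next
    case False
    then have "(\<lambda>n. y (\<phi> n) j) \<longlonglongrightarrow> u j" using \<phi>(2) that by simp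
    from LIMSEQ_subseq_LIMSEQ[OF this \<psi>(1)] show ?thesis using False by (simp add: o_def)
  qed
  then show ?case using strict_mono_o[OF \<phi>(1) \<psi>(1)] by blast
qed

text \<open>Compactness. If no \<kappa> works, there are points whose value is negligible compared
  with a coordinate. Scaled to coordinate sum 1 in absolute value, they have a limit in the closed
  cone with value at most 0 but coordinate sum 1, against pointedness.\<close>

lemma pointed_cone_coord_bound:
  assumes nonneg: "\<And>x. x \<in> S \<Longrightarrow> 0 \<le> ipa d a x"
    and pointed: "\<And>u. u \<in> closed_cone_gen d S \<Longrightarrow> (\<Sum>i<d. u i * a i) \<le> 0 \<Longrightarrow> u = (\<lambda>_. 0)"
  shows "\<exists>\<kappa>>0. \<forall>x\<in>S. \<forall>i<d. \<kappa> * real_of_int \<bar>x i\<bar> \<le> ipa d a x"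
proof (rule ccontr)
  assume neg: "\<not> ?thesis"
  have "\<exists>x\<in>S. \<exists>i<d. ipa d a x < inverse (real (Suc n)) * real_of_int \<bar>x i\<bar>" for n
  proof (rule ccontr)
    assume "\<not> (\<exists>x\<in>S. \<exists>i<d. ipa d a x < inverse (real (Suc n)) * real_of_int \<bar>x i\<bar>)"
    then have "\<forall>x\<in>S. \<forall>i<d. inverse (real (Suc n)) * real_of_int \<bar>x i\<bar> \<le> ipa d a x" by (meson not_le)
    moreover have "0 < inverse (real (Suc n))" by simp
    ultimately show False using neg by blast
  qed
  then obtain x k where x: "\<And>n. x n \<in> S" "\<And>n. k n < d"
      "\<And>n. ipa d a (x n) < inverse (real (Suc n)) * real_of_int \<bar>x n (k n)\<bar>" by metis
  define N where "N n = (\<Sum>i<d. real_of_int \<bar>x n i\<bar>)" for n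
  have kN: "real_of_int \<bar>x n (k n)\<bar> \<le> N n" for n
    unfolding N_def using x(2)[of n] by (intro member_le_sum) auto
  have N_pos: "0 < N n" for n
  proof -
    have "0 < inverse (real (Suc n)) * real_of_int \<bar>x n (k n)\<bar>"
      using x(3)[of n] nonneg[OF x(1)[of n]] by linarith
    then have "0 < real_of_int \<bar>x n (k n)\<bar>" by (simp add: zero_less_mult_iff)
    then show ?thesis using kN[of n] by linarith
  qed
  define y where "y n j = (if j < d then real_of_int (x n j) / N n else 0)" for n j
  have y_le: "\<bar>y n j\<bar> \<le> 1" for n j
  proof (cases "j < d")
    case True
    have "real_of_int \<bar>x n j\<bar> \<le> N n" unfolding N_def using True by (intro member_le_sum) auto
    then show ?thesis using True N_pos[of n] by (simp add: y_def abs_divide)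
  qed (simp add: y_def)
  obtain \<phi> u where \<phi>: "strict_mono \<phi>" and u: "\<And>j. j < d \<Longrightarrow> (\<lambda>n. y (\<phi> n) j) \<longlonglongrightarrow> u j"
    using bounded_coords_convergent_subseq[of y d] y_le by blast
  define u' where "u' j = (if j < d then u j else 0)" for j
  have y_cone: "y n \<in> cone_gen d S" for n
    unfolding cone_gen_def y_def using x(1)[of n] N_pos[of n]
    by (intro CollectI exI[of _ "Suc 0"] exI[of _ "\<lambda>_. 1 / N n"] exI[of _ "\<lambda>_. x n"]) (auto simp: fun_eq_iff)
  have "u' \<in> closed_cone_gen d S"
    unfolding closed_cone_gen_def
  proof (intro CollectI conjI allI impI)
    show "u' i = 0" if "d \<le> i" for i using that by (simp add: u'_def)
    fix \<epsilon> :: real assume \<epsilon>: "0 < \<epsilon>"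
    have "eventually (\<lambda>n. \<forall>j\<in>{..<d}. \<bar>u j - y (\<phi> n) j\<bar> < \<epsilon>) sequentially"
    proof (intro eventually_ball_finite ballI)
      fix j assume "j \<in> {..<d}"
      then have "eventually (\<lambda>n. dist (y (\<phi> n) j) (u j) < \<epsilon>) sequentially"
        using u[of j] \<epsilon> by (auto dest: tendstoD)
      then show "eventually (\<lambda>n. \<bar>u j - y (\<phi> n) j\<bar> < \<epsilon>) sequentially"
        by (simp add: dist_real_def abs_minus_commute)
    qed simp
    then obtain n where "\<forall>j\<in>{..<d}. \<bar>u j - y (\<phi> n) j\<bar> < \<epsilon>"
      using eventually_happens'[OF sequentially_bot] by blast
    then show "\<exists>c\<in>cone_gen d S. \<forall>i<d. \<bar>u' i - c i\<bar> < \<epsilon>"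
      using y_cone[of "\<phi> n"] by (intro bexI[of _ "y (\<phi> n)"]) (auto simp: u'_def)
  qed
  moreover have "(\<Sum>i<d. u' i * a i) \<le> 0"
  proof -
    have "(\<lambda>n. \<Sum>i<d. y (\<phi> n) i * a i) \<longlonglongrightarrow> (\<Sum>i<d. u i * a i)"
      by (intro tendsto_sum tendsto_mult tendsto_const u) auto
    moreover have "(\<lambda>n. inverse (real (Suc n))) \<longlonglongrightarrow> 0" by (rule LIMSEQ_inverse_real_of_nat)
    moreover have "(\<Sum>i<d. y (\<phi> n) i * a i) \<le> inverse (real (Suc n))" for n
    proof -
      let ?m = "\<phi> n"
      have "(\<Sum>i<d. y ?m i * a i) = ipa d a (x ?m) / N ?m"
        unfolding ipa_def y_def sum_divide_distrib by (intro sum.cong) auto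
      also have "\<dots> \<le> inverse (real (Suc ?m)) * N ?m / N ?m"
        using x(3)[of ?m] kN[of ?m] N_pos[of ?m]
        by (intro divide_right_mono) (auto intro: order_trans[OF less_imp_le mult_left_mono])
      also have "\<dots> = inverse (real (Suc ?m))" using N_pos[of ?m] by simp
      also have "\<dots> \<le> inverse (real (Suc n))"
        using strict_mono_imp_increasing[OF \<phi>, of n] by (intro le_imp_inverse_le) auto
      finally show ?thesis .
    qed
    ultimately have "(\<Sum>i<d. u i * a i) \<le> 0" by (intro LIMSEQ_le) auto
    then show ?thesis by (simp add: u'_def)
  qed
  ultimately have "u' = (\<lambda>_. 0)" by (rule pointed)
  then have u0: "u j = 0" if "j < d" for j using that by (auto simp: u'_def fun_eq_iff split: if_splits)
  have "(\<lambda>n. \<Sum>j<d. \<bar>y (\<phi> n) j\<bar>) \<longlonglongrightarrow> (\<Sum>j<d. \<bar>u j\<bar>)"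
    by (intro tendsto_sum tendsto_rabs u) auto
  moreover have "(\<Sum>j<d. \<bar>y n j\<bar>) = 1" for n
  proof -
    have "(\<Sum>j<d. \<bar>y n j\<bar>) = N n / N n"
      unfolding N_def[of n] sum_divide_distrib using N_pos[of n]
      by (intro sum.cong) (auto simp: y_def abs_divide N_def)
    then show ?thesis using N_pos[of n] by simp
  qed
  ultimately have "(\<lambda>n::nat. 1::real) \<longlonglongrightarrow> 0" using u0 by simp
  then show False using LIMSEQ_unique[OF _ tendsto_const] by fastforce
qed

locale ok_valuation =
  fixes m :: "'a::idom set" and d :: nat and a :: "nat \<Rightarrow> real" and \<nu> :: "'a fract \<Rightarrow> nat \<Rightarrow> int"
  assumes OK: "OK_valuation m d a \<nu>" and max: "is_maximal_ideal m"
begin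

definition vl :: "'a fract \<Rightarrow> real" where "vl x = ipa d a (\<nu> x)"

lemma nu_image: "\<nu> ` (UNIV - {0}) = {v. \<forall>i\<ge>d. v i = 0}"
  using OK unfolding OK_valuation_def by (elim conjE)

lemma nu_surj:
  assumes "\<And>i. d \<le> i \<Longrightarrow> v i = 0"
  shows "\<exists>x. x \<noteq> 0 \<and> \<nu> x = v"
proof -
  have "v \<in> \<nu> ` (UNIV - {0})" unfolding nu_image using assms by simp
  then show ?thesis by blast
qed

lemma nu_supp:
  assumes "x \<noteq> 0" "d \<le> i"
  shows "\<nu> x i = 0"
proof -
  have "\<nu> x \<in> {v. \<forall>i\<ge>d. v i = 0}" unfolding nu_image[symmetric] using assms by blast
  then show ?thesis using assms by blast
qed

lemma nu_mult: "x \<noteq> 0 \<Longrightarrow> y \<noteq> 0 \<Longrightarrow> \<nu> (x * y) = \<nu> x + \<nu> y"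
proof -
  have "\<forall>x y. x \<noteq> 0 \<and> y \<noteq> 0 \<longrightarrow> \<nu> (x * y) = (\<lambda>i. \<nu> x i + \<nu> y i)"
    using OK unfolding OK_valuation_def by (elim conjE)
  then show "x \<noteq> 0 \<Longrightarrow> y \<noteq> 0 \<Longrightarrow> \<nu> (x * y) = \<nu> x + \<nu> y" by (simp add: plus_fun_def)
qed

lemma vl_mult: "x \<noteq> 0 \<Longrightarrow> y \<noteq> 0 \<Longrightarrow> vl (x * y) = vl x + vl y"
  by (simp add: vl_def nu_mult)

lemma vl_add: "x \<noteq> 0 \<Longrightarrow> y \<noteq> 0 \<Longrightarrow> x + y \<noteq> 0 \<Longrightarrow> min (vl x) (vl y) \<le> vl (x + y)"
proof -
  have "\<forall>x y. x \<noteq> 0 \<and> y \<noteq> 0 \<and> x + y \<noteq> 0 \<longrightarrow> min (vl x) (vl y) \<le> vl (x + y)"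
    using OK unfolding OK_valuation_def vl_def by (elim conjE)
  then show "x \<noteq> 0 \<Longrightarrow> y \<noteq> 0 \<Longrightarrow> x + y \<noteq> 0 \<Longrightarrow> min (vl x) (vl y) \<le> vl (x + y)" by simp
qed

lemma vl_emb_nonneg: "r \<noteq> 0 \<Longrightarrow> 0 \<le> vl (emb r)"
proof -
  have "\<forall>r. r \<noteq> 0 \<longrightarrow> 0 \<le> vl (emb r)"
    using OK unfolding OK_valuation_def vl_def by (elim conjE)
  then show "r \<noteq> 0 \<Longrightarrow> 0 \<le> vl (emb r)" by simp
qed

lemma mem_m_iff: "r \<in> m \<longleftrightarrow> r = 0 \<or> 0 < vl (emb r)"
proof -
  have "\<forall>r. r \<in> m \<longleftrightarrow> r = 0 \<or> 0 < vl (emb r)"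
    using OK unfolding OK_valuation_def vl_def by (elim conjE)
  then show ?thesis by simp
qed

lemma nu_1: "\<nu> 1 = 0"
  using nu_mult[of 1 1] by (simp add: fun_eq_iff)

lemma vl_inverse: "x \<noteq> 0 \<Longrightarrow> vl (inverse x) = - vl x"
  using vl_mult[of x "inverse x"] by (simp add: vl_def nu_1)

lemma vl_divide: "x \<noteq> 0 \<Longrightarrow> y \<noteq> 0 \<Longrightarrow> vl (x / y) = vl x - vl y"
  by (simp add: divide_inverse vl_mult vl_inverse)

text \<open>Rational independence of \<open>a\<close>. Real values therefore determine lattice
  points, and counting values is counting points.\<close>

lemma ipa_inj:
  assumes "\<And>i. d \<le> i \<Longrightarrow> u i = 0" "\<And>i. d \<le> i \<Longrightarrow> v i = 0" "ipa d a u = ipa d a v"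
  shows "u = v"
proof -
  have ind: "\<forall>c::nat \<Rightarrow> rat. (\<Sum>i<d. real_of_rat (c i) * a i) = 0 \<longrightarrow> (\<forall>i<d. c i = 0)"
    using OK unfolding OK_valuation_def by (elim conjE)
  have "(\<Sum>i<d. real_of_rat (rat_of_int (u i - v i)) * a i) = ipa d a u - ipa d a v"
    unfolding ipa_def sum_subtractf[symmetric] by (intro sum.cong) (auto simp: left_diff_distrib of_rat_diff)
  then have "\<forall>i<d. rat_of_int (u i - v i) = 0" 
    using spec[OF ind, of "\<lambda>i. rat_of_int (u i - v i)"] assms(3) by simp
  then have "u i = v i" if "i < d" for i using that by simp
  then show ?thesis using assms(1,2) by (auto simp: fun_eq_iff) (metis not_le)
qed

section \<open>The filtration by value and its graded pieces\<close>

definition atl :: "'a fract set \<Rightarrow> real \<Rightarrow> 'a fract set" where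
  "atl M t = {x \<in> M. x = 0 \<or> t \<le> vl x}"

definition gtr :: "'a fract set \<Rightarrow> real \<Rightarrow> 'a fract set" where
  "gtr M t = {x \<in> M. x = 0 \<or> t < vl x}"

lemma submod_atl:
  assumes M: "submod M"
  shows "submod (atl M t)"
  unfolding submod_def
proof (intro conjI ballI allI)
  show "0 \<in> atl M t" using submod_0[OF M] by (simp add: atl_def)
  fix x assume x: "x \<in> atl M t"
  show "emb r * x \<in> atl M t" for r
  proof (cases "r = 0 \<or> x = 0")
    case False
    then have "vl (emb r * x) = vl (emb r) + vl x" "0 \<le> vl (emb r)"
      by (auto simp: vl_mult vl_emb_nonneg)
    then show ?thesis using x submod_smult[OF M] False by (auto simp: atl_def)
  qed (use submod_0[OF M] in \<open>auto simp: atl_def\<close>)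
  fix y assume y: "y \<in> atl M t"
  have xy: "x + y \<in> M" using x y submod_add[OF M] by (auto simp: atl_def)
  show "x + y \<in> atl M t"
  proof (cases "x = 0 \<or> y = 0 \<or> x + y = 0")
    case True then show ?thesis using x y xy by (auto simp: atl_def)
  next
    case False
    then have "t \<le> vl x" "t \<le> vl y" using x y by (auto simp: atl_def)
    then have "t \<le> min (vl x) (vl y)" by simp
    also have "\<dots> \<le> vl (x + y)" using False by (intro vl_add) auto
    finally show ?thesis using xy by (simp add: atl_def)
  qed
qed

lemma submod_gtr:
  assumes M: "submod M"
  shows "submod (gtr M t)"
  unfolding submod_def
proof (intro conjI ballI allI)
  show "0 \<in> gtr M t" using submod_0[OF M] by (simp add: gtr_def)
  fix x assume x: "x \<in> gtr M t"
  show "emb r * x \<in> gtr M t" for r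
  proof (cases "r = 0 \<or> x = 0")
    case False
    then have "vl (emb r * x) = vl (emb r) + vl x" "0 \<le> vl (emb r)"
      by (auto simp: vl_mult vl_emb_nonneg)
    then show ?thesis using x submod_smult[OF M] False by (auto simp: gtr_def)
  qed (use submod_0[OF M] in \<open>auto simp: gtr_def\<close>)
  fix y assume y: "y \<in> gtr M t"
  have xy: "x + y \<in> M" using x y submod_add[OF M] by (auto simp: gtr_def)
  show "x + y \<in> gtr M t"
  proof (cases "x = 0 \<or> y = 0 \<or> x + y = 0")
    case True then show ?thesis using x y xy by (auto simp: gtr_def)
  next
    case False
    then have "t < vl x" "t < vl y" using x y by (auto simp: gtr_def)
    then have "t < min (vl x) (vl y)" by simp
    also have "\<dots> \<le> vl (x + y)" using False by (intro vl_add) auto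
    finally show ?thesis using xy by (simp add: gtr_def)
  qed
qed

lemma submod_UNIV [simp]: "submod UNIV"
  by (simp add: submod_def)

lemma residue_generators:
  "\<exists>(n::nat) w. (\<forall>j<n. w j \<in> atl UNIV 0) \<and>
     (\<forall>v\<in>atl UNIV 0. \<exists>r. v - (\<Sum>j<n. emb (r j) * w j) \<in> gtr UNIV 0)"
proof -
  have "\<exists>n (w::nat \<Rightarrow> 'a fract). (\<forall>j<n. w j = 0 \<or> ipa d a (\<nu> (w j)) \<ge> 0) \<and>
        (\<forall>v. v = 0 \<or> ipa d a (\<nu> v) \<ge> 0 \<longrightarrow>
           (\<exists>r::nat \<Rightarrow> 'a. let z = v - (\<Sum>j<n. emb (r j) * w j) in z = 0 \<or> ipa d a (\<nu> z) > 0))"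
    using OK unfolding OK_valuation_def by (elim conjE)
  then show ?thesis unfolding atl_def gtr_def vl_def Let_def by simp
qed

text \<open>Adjoin the finitely many generators of the residue field of the valuation one by one.
  Multiplying a generator by an element of \<open>m\<close> makes its value positive or gives 0, so
  each step has finite length.\<close>

lemma residue_length: "\<exists>h. flen (gtr UNIV 0) (atl UNIV 0) h"
proof -
  obtain n and w :: "nat \<Rightarrow> 'a fract" where w: "\<And>j. j < n \<Longrightarrow> w j \<in> atl UNIV 0"
    and gen: "\<And>v. v \<in> atl UNIV 0 \<Longrightarrow> \<exists>r. v - (\<Sum>j<n. emb (r j) * w j) \<in> gtr UNIV 0"
    using residue_generators by blast
  have "\<exists>N h. flen (gtr UNIV 0) N h \<and> N \<subseteq> atl UNIV 0 \<and> (\<forall>r. (\<Sum>j<k. emb (r j) * w j) \<in> N)" if "k \<le> n" for k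
    using that
  proof (induction k)
    case 0
    have "flen (gtr UNIV 0) (gtr UNIV 0) 0" by (intro flen_refl submod_gtr) simp
    moreover have "gtr UNIV 0 \<subseteq> atl UNIV 0" by (auto simp: gtr_def atl_def)
    moreover have "0 \<in> gtr UNIV 0" by (simp add: gtr_def)
    ultimately show ?case by (intro exI[of _ "gtr UNIV 0"] exI[of _ 0]) simp
  next
    case (Suc k)
    then obtain N h where N: "flen (gtr UNIV 0) N h" "N \<subseteq> atl UNIV 0" "\<And>r. (\<Sum>j<k. emb (r j) * w j) \<in> N"
      by auto
    have sN: "submod N" "gtr UNIV 0 \<subseteq> N" using flen_submod[OF N(1)] by auto
    have wk: "w k \<in> atl UNIV 0" using w Suc by simp
    have "emb r * w k \<in> N" if "r \<in> m" for r
    proof -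
      have "emb r * w k \<in> gtr UNIV 0"
        using that wk vl_mult[of "emb r" "w k"]
        by (cases "r = 0 \<or> w k = 0") (auto simp: mem_m_iff atl_def gtr_def)
      then show ?thesis using sN by blast
    qed
    then obtain k' where k': "flen N (msum N {emb r * w k | r. True}) k'"
      using flen_cyclic_step[OF sN(1) max, of "w k"] by blast
    let ?N = "msum N {emb r * w k | r. True}"
    have "?N \<subseteq> atl UNIV 0"
      using N(2) submod_add[OF submod_atl[of UNIV 0]] submod_smult[OF submod_atl[of UNIV 0] wk]
      by (auto simp: msum_def)
    moreover have "(\<Sum>j<Suc k. emb (r j) * w j) \<in> ?N" for r
      using N(3)[of r] by (auto simp: msum_def)
    ultimately show ?case using flen_add[OF N(1) k'] by blast
  qed
  from this[of n] obtain N h where N: "flen (gtr UNIV 0) N h" "N \<subseteq> atl UNIV 0"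
    "\<And>r. (\<Sum>j<n. emb (r j) * w j) \<in> N" by auto
  have sN: "submod N" "gtr UNIV 0 \<subseteq> N" using flen_submod[OF N(1)] by auto
  have "atl UNIV 0 \<subseteq> N"
  proof
    fix v :: "'a fract" assume "v \<in> atl UNIV 0"
    then obtain r where "v - (\<Sum>j<n. emb (r j) * w j) \<in> N" using gen sN(2) by blast
    from submod_add[OF sN(1) this N(3)[of r]] show "v \<in> N" by simp
  qed
  then show ?thesis using N by (metis subset_antisym)
qed

text \<open>The number \<open>h\<close> of the overview: the length over the domain of the residue
  field of the valuation.\<close>

definition res_len :: nat where
  "res_len = (THE h. flen (gtr UNIV 0) (atl UNIV 0) h)"

lemma flen_res_len: "flen (gtr UNIV 0) (atl UNIV 0) res_len"
proof -
  obtain h where h: "flen (gtr UNIV 0) (atl UNIV 0) h" using residue_length by (rule exE)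
  then have "res_len = h" unfolding res_len_def using flen_unique[OF _ h] by (rule the_equality)
  then show ?thesis using h by simp
qed

lemma flen_graded_UNIV:
  assumes "x \<noteq> 0"
  shows "flen (gtr UNIV (vl x)) (atl UNIV (vl x)) res_len"
proof -
  have im: "y \<in> (*) x ` Z \<longleftrightarrow> y / x \<in> Z" for y Z
    using assms by (auto simp: image_iff intro: bexI[of _ "y / x"])
  have "(*) x ` gtr UNIV 0 = gtr UNIV (vl x)" "(*) x ` atl UNIV 0 = atl UNIV (vl x)"
  proof -
    have "y / x = 0 \<or> 0 < vl (y / x) \<longleftrightarrow> y = 0 \<or> vl x < vl y"
      "y / x = 0 \<or> 0 \<le> vl (y / x) \<longleftrightarrow> y = 0 \<or> vl x \<le> vl y" for y
      using assms vl_divide[of y x] by (cases "y = 0"; simp)+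
    then show "(*) x ` gtr UNIV 0 = gtr UNIV (vl x)" "(*) x ` atl UNIV 0 = atl UNIV (vl x)"
      unfolding set_eq_iff im gtr_def atl_def by simp_all
  qed
  then show ?thesis using flen_scale[OF flen_res_len assms] by simp
qed

text \<open>By the second isomorphism theorem the graded piece of \<open>M\<close> embeds into that
  of the whole field, which is a rescaled copy of the residue field. Equality of lengths holds once
  the embedding is onto.\<close>

lemma flen_graded:
  assumes M: "submod M" and x: "x \<noteq> 0"
  shows "\<exists>k\<le>res_len. flen (gtr M (vl x)) (atl M (vl x)) k \<and>
    (atl UNIV (vl x) \<subseteq> msum (atl M (vl x)) (gtr UNIV (vl x)) \<longrightarrow> k = res_len)"
proof -
  let ?t = "vl x"
  let ?P = "gtr UNIV ?t" and ?A = "atl M ?t"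
  have s: "submod ?A" "submod ?P" using M submod_atl submod_gtr submod_UNIV by blast+
  have sub: "msum ?A ?P \<subseteq> atl UNIV ?t"
  proof
    fix z assume "z \<in> msum ?A ?P"
    then obtain y y' where z: "z = y + y'" "y \<in> ?A" "y' \<in> ?P" unfolding msum_def by blast
    then have "y \<in> atl UNIV ?t" "y' \<in> atl UNIV ?t" by (auto simp: atl_def gtr_def)
    then show "z \<in> atl UNIV ?t" using z(1) submod_add[OF submod_atl[OF submod_UNIV]] by blast
  qed
  have "?P \<subseteq> msum ?A ?P" using msum_memI2[OF s(1)] by blast
  from flen_intermediate[OF flen_graded_UNIV[OF x] submod_msum[OF s] this sub]
  obtain k l where kl: "flen ?P (msum ?A ?P) k" "flen (msum ?A ?P) (atl UNIV ?t) l" "res_len = k + l" .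
  have "?A \<inter> ?P = gtr M ?t" by (auto simp: atl_def gtr_def)
  then have "flen (gtr M ?t) ?A k" using flen_second_iso[OF s kl(1)] by simp
  moreover have "k = res_len" if "atl UNIV ?t \<subseteq> msum ?A ?P"
  proof -
    have "msum ?A ?P = atl UNIV ?t" using that sub by blast
    then show ?thesis using kl(1) flen_unique[OF _ flen_graded_UNIV[OF x]] by simp
  qed
  ultimately show ?thesis using kl(3) by (intro exI[of _ k]) auto
qed

text \<open>Induction on the possible values, removing the smallest one \<open>t\<close>: passing
  from \<open>M\<close> to \<open>gtr M t\<close> splits off one graded piece. \<open>A\<close>
  contains all values of \<open>M\<close> below \<open>\<tau>\<close>, and \<open>B\<close> consists
  of values at which the piece is full.\<close>

lemma flen_filtration:
  assumes "finite A" "submod M"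
    and "\<And>t. t \<in> A \<Longrightarrow> t < \<tau> \<and> (\<exists>x. x \<noteq> 0 \<and> vl x = t)"
    and "\<And>x. x \<in> M \<Longrightarrow> x \<noteq> 0 \<Longrightarrow> vl x < \<tau> \<Longrightarrow> vl x \<in> A"
    and "B \<subseteq> A" and "\<And>t. t \<in> B \<Longrightarrow> atl UNIV t \<subseteq> msum (atl M t) (gtr UNIV t)"
  shows "\<exists>k. flen (atl M \<tau>) M k \<and> res_len * card B \<le> k \<and> k \<le> res_len * card A"
  using assms
proof (induction A arbitrary: M B rule: finite_linorder_min_induct)
  case empty
  have "atl M \<tau> = M" using empty.prems(3) by (auto simp: atl_def not_less[symmetric])
  then have "flen (atl M \<tau>) M 0" using flen_refl[OF empty.prems(1)] by simp
  then show ?case using empty.prems(4) by auto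
next
  case (insert t A)
  obtain x where x: "x \<noteq> 0" "vl x = t" and t: "t < \<tau>" using insert.prems(2)[of t] by auto
  let ?M = "gtr M t"
  have all_ge: "t \<le> vl z" if "z \<in> M" "z \<noteq> 0" for z
    using insert.prems(3)[OF that] insert.hyps(2) t by (cases "vl z < \<tau>") force+
  then have M_eq: "atl M t = M" by (auto simp: atl_def)
  have at_eq: "atl ?M s = atl M s" if "t < s" for s
    using that by (auto simp: atl_def gtr_def)
  have "\<exists>k. flen (atl ?M \<tau>) ?M k \<and> res_len * card (B - {t}) \<le> k \<and> k \<le> res_len * card A"
  proof (rule insert.IH)
    show "submod ?M" using submod_gtr insert.prems(1) .
    show "s < \<tau> \<and> (\<exists>x. x \<noteq> 0 \<and> vl x = s)" if "s \<in> A" for s using insert.prems(2) that by blast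
    show "vl z \<in> A" if "z \<in> ?M" "z \<noteq> 0" "vl z < \<tau>" for z
      using insert.prems(3)[of z] that by (auto simp: gtr_def)
    show "B - {t} \<subseteq> A" using insert.prems(4) by blast
    show "atl UNIV s \<subseteq> msum (atl ?M s) (gtr UNIV s)" if "s \<in> B - {t}" for s
    proof -
      have "t < s" using that insert.prems(4) insert.hyps(2) by blast
      then show ?thesis using at_eq insert.prems(5)[of s] that by simp
    qed
  qed
  then obtain k where k: "flen (atl M \<tau>) ?M k" "res_len * card (B - {t}) \<le> k" "k \<le> res_len * card A"
    using at_eq[OF t] by auto
  obtain l where l: "l \<le> res_len" "flen ?M M l"
      "atl UNIV t \<subseteq> msum (atl M t) (gtr UNIV t) \<longrightarrow> l = res_len"
    using flen_graded[OF insert.prems(1) x(1)] M_eq x(2) by auto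
  have finB: "finite B" using insert.prems(4) insert.hyps(1) finite_subset by blast
  have "res_len * card B \<le> k + l"
  proof (cases "t \<in> B")
    case True
    then have "l = res_len" using l(3) insert.prems(5) by blast
    moreover have "card B = Suc (card (B - {t}))" using card_Suc_Diff1[OF finB True] by simp
    ultimately show ?thesis using k(2) by simp
  qed (use k(2) in simp)
  moreover have "t \<notin> A" using insert.hyps(2) by blast
  then have "k + l \<le> res_len * card (insert t A)" using k(3) l(1) insert.hyps(1) by simp
  ultimately show ?case using flen_add[OF k(1) l(2)] by blast
qed

end

section \<open>Ideals and p-families\<close>

lemma ideal_0: "is_ideal I \<Longrightarrow> 0 \<in> I"
  and ideal_add: "is_ideal I \<Longrightarrow> x \<in> I \<Longrightarrow> y \<in> I \<Longrightarrow> x + y \<in> I"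
  and ideal_mult: "is_ideal I \<Longrightarrow> x \<in> I \<Longrightarrow> r * x \<in> I"
  by (simp_all add: is_ideal_def)

lemma is_ideal_ideal_gen: "is_ideal (ideal_gen X)"
  unfolding ideal_gen_def is_ideal_def by blast

lemma ideal_gen_superset: "X \<subseteq> ideal_gen X"
  unfolding ideal_gen_def by blast

lemma ideal_gen_least: "is_ideal J \<Longrightarrow> X \<subseteq> J \<Longrightarrow> ideal_gen X \<subseteq> J"
  unfolding ideal_gen_def by blast

lemma is_ideal_UNIV: "is_ideal UNIV"
  by (simp add: is_ideal_def)

lemma is_ideal_colon:
  assumes K: "is_ideal K"
  shows "is_ideal {x. x * y \<in> K}"
  unfolding is_ideal_def
  using ideal_0[OF K] ideal_add[OF K] ideal_mult[OF K] by (simp add: distrib_right mult.assoc)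

lemma is_ideal_ideal_prod: "is_ideal (ideal_prod I J)"
  unfolding ideal_prod_def by (rule is_ideal_ideal_gen)

lemma ideal_prod_mem: "x \<in> I \<Longrightarrow> y \<in> J \<Longrightarrow> x * y \<in> ideal_prod I J"
  unfolding ideal_prod_def using ideal_gen_superset[of "{x * y | x y. x \<in> I \<and> y \<in> J}"] by blast

lemma ideal_prod_least:
  assumes "is_ideal K" "\<And>x y. x \<in> I \<Longrightarrow> y \<in> J \<Longrightarrow> x * y \<in> K"
  shows "ideal_prod I J \<subseteq> K"
  unfolding ideal_prod_def using assms by (intro ideal_gen_least) blast+

lemma ideal_power_mono:
  assumes "is_ideal I" "x ^ n \<in> I" "n \<le> k"
  shows "x ^ k \<in> I"
  using ideal_mult[OF assms(1,2), of "x ^ (k - n)"] assms(3) by (simp add: power_add[symmetric])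

lemma ideal_pow_subset_monomials:
  assumes X: "finite X"
  shows "ideal_pow (ideal_gen X) n \<subseteq> ideal_gen {\<Prod>x\<in>X. x ^ k x | k. sum k X = n}"
proof (induction n)
  case 0
  let ?G = "{\<Prod>x\<in>X. x ^ k x | k. sum k X = 0}"
  have "(\<Prod>x\<in>X. x ^ (\<lambda>_. 0 :: nat) x) \<in> ?G" by (intro CollectI exI[of _ "\<lambda>_. 0"]) simp
  then have "1 \<in> ideal_gen ?G" using ideal_gen_superset[of ?G] by auto
  then have "r * 1 \<in> ideal_gen ?G" for r using ideal_mult[OF is_ideal_ideal_gen] by blast
  then show ?case by auto
next
  case (Suc n)
  let ?G = "\<lambda>n. {\<Prod>x\<in>X. x ^ k x | k. sum k X = n}"
  let ?K = "ideal_gen (?G (Suc n))"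
  have K: "is_ideal ?K" by (rule is_ideal_ideal_gen)
  have gen: "x * g \<in> ?K" if "x \<in> X" "g \<in> ?G n" for x g
  proof -
    obtain k where k: "g = (\<Prod>y\<in>X. y ^ k y)" "sum k X = n" using \<open>g \<in> ?G n\<close> by blast
    define k' where "k' = k(x := Suc (k x))"
    have "(\<Prod>y\<in>X. y ^ k' y) = x ^ k' x * (\<Prod>y\<in>X - {x}. y ^ k' y)"
      using X \<open>x \<in> X\<close> by (rule prod.remove)
    also have "(\<Prod>y\<in>X - {x}. y ^ k' y) = (\<Prod>y\<in>X - {x}. y ^ k y)" by (intro prod.cong) (auto simp: k'_def)
    also have "x ^ k' x * \<dots> = x * (x ^ k x * (\<Prod>y\<in>X - {x}. y ^ k y))" by (simp add: k'_def mult.assoc)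
    also have "x ^ k x * (\<Prod>y\<in>X - {x}. y ^ k y) = g"
      unfolding k(1) using X \<open>x \<in> X\<close> by (rule prod.remove[symmetric])
    finally have 1: "x * g = (\<Prod>y\<in>X. y ^ k' y)" by simp
    have "sum k' X = k' x + sum k' (X - {x})" using X \<open>x \<in> X\<close> by (rule sum.remove)
    also have "sum k' (X - {x}) = sum k (X - {x})" by (intro sum.cong) (auto simp: k'_def)
    also have "k' x + \<dots> = Suc (sum k X)" using sum.remove[OF X \<open>x \<in> X\<close>, of k] by (simp add: k'_def)
    finally have "sum k' X = Suc n" using k(2) by simp
    then show ?thesis using 1 ideal_gen_superset[of "?G (Suc n)"] by blast
  qed
  have "x * y \<in> ?K" if x: "x \<in> X" and y: "y \<in> ideal_gen (?G n)" for x y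
  proof -
    have "is_ideal {y. y * x \<in> ?K}" by (rule is_ideal_colon[OF K])
    moreover have "?G n \<subseteq> {y. y * x \<in> ?K}" using gen[OF x] by (auto simp: mult.commute)
    ultimately have "y * x \<in> ?K" using ideal_gen_least y by blast
    then show ?thesis by (simp add: mult.commute)
  qed
  then have mult: "x * y \<in> ?K" if "x \<in> ideal_gen X" "y \<in> ideal_gen (?G n)" for x y
    using ideal_gen_least[OF is_ideal_colon[OF K, of y], of X] that by blast
  have "ideal_prod (ideal_gen X) (ideal_pow (ideal_gen X) n) \<subseteq> ?K"
    by (rule ideal_prod_least[OF K mult]) (use Suc in blast)+
  then show ?case by simp
qed

text \<open>Pigeonhole: a monomial of degree \<open>card X * b + 1\<close> in the generators has
  some exponent above \<open>b\<close>.\<close>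

lemma ideal_pow_subset_of_powers:
  assumes X: "finite X" and J: "is_ideal J" and pow: "\<And>x. x \<in> X \<Longrightarrow> x ^ b \<in> J"
  shows "ideal_pow (ideal_gen X) (Suc (card X * b)) \<subseteq> J"
proof -
  have "(\<Prod>x\<in>X. x ^ k x) \<in> J" if k: "sum k X = Suc (card X * b)" for k
  proof -
    have "\<exists>x\<in>X. b < k x"
    proof (rule ccontr)
      assume "\<not> (\<exists>x\<in>X. b < k x)"
      then have "sum k X \<le> of_nat (card X) * b" by (intro sum_bounded_above) (auto simp: not_less)
      then show False using k by simp
    qed
    then obtain x where x: "x \<in> X" "b < k x" by blast
    then have "x ^ k x \<in> J" using ideal_power_mono[OF J pow] by simp
    then have "(\<Prod>y\<in>X - {x}. y ^ k y) * x ^ k x \<in> J" by (rule ideal_mult[OF J])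
    then show ?thesis using prod.remove[OF X x(1), of "\<lambda>y. y ^ k y"] by (simp add: mult.commute)
  qed
  then have "ideal_gen {\<Prod>x\<in>X. x ^ k x | k. sum k X = Suc (card X * b)} \<subseteq> J"
    by (intro ideal_gen_least[OF J]) blast
  then show ?thesis using ideal_pow_subset_monomials[OF X] by blast
qed

lemma p_family_ideal: "p_family p I \<Longrightarrow> is_ideal (I e)"
  by (simp add: p_family_def)

lemma p_family_pow:
  assumes "p_family p I" "x \<in> I e"
  shows "x ^ (p ^ f) \<in> I (e + f)"
proof (induction f)
  case 0 then show ?case using assms by simp
next
  case (Suc f)
  have "(x ^ (p ^ f)) ^ p \<in> frob_bracket p (I (e + f))"
    unfolding frob_bracket_def
    using Suc ideal_gen_superset[of "{x ^ p | x. x \<in> I (e + f)}"] by blast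
  then have "(x ^ (p ^ f)) ^ p \<in> I (Suc (e + f))" using assms(1) unfolding p_family_def by blast
  then show ?case by (simp add: power_mult[symmetric] mult.commute)
qed

lemma p_family_Suc: "p_family p I \<Longrightarrow> x \<in> I e \<Longrightarrow> x ^ p \<in> I (Suc e)"
  using p_family_pow[of p I x e 1] by simp

text \<open>In characteristic \<open>p\<close> the elements whose \<open>p\<close>-th power lies in
  the next product ideal form an ideal. It contains all products \<open>x * y\<close>, hence the
  whole product ideal.\<close>

lemma p_family_ideal_prod:
  fixes I J :: "nat \<Rightarrow> 'a::comm_ring_1 set"
  assumes p: "prime p" "of_nat p = (0::'a)" and I: "p_family p I" and J: "p_family p J"
  shows "p_family p (\<lambda>e. ideal_prod (I e) (J e))"
proof -
  have "z ^ p \<in> ideal_prod (I (Suc e)) (J (Suc e))" if "z \<in> ideal_prod (I e) (J e)" for e z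
  proof -
    let ?K = "ideal_prod (I (Suc e)) (J (Suc e))"
    have K: "is_ideal ?K" by (rule is_ideal_ideal_prod)
    have "CHAR('a) dvd p" using p(2) by (simp add: of_nat_eq_0_iff_char_dvd)
    then have CHAR: "CHAR('a) = p" using p(1) CHAR_not_1[where 'a = 'a] by (auto simp: prime_nat_iff)
    have char: "(x + y) ^ p = x ^ p + y ^ p" for x y :: 'a
      by (rule freshmans_dream) (use p(1) CHAR in simp_all)
    have "is_ideal {z. z ^ p \<in> ?K}"
      unfolding is_ideal_def using ideal_0[OF K] ideal_add[OF K] ideal_mult[OF K] prime_gt_0_nat[OF p(1)]
      by (simp add: char power_mult_distrib zero_power)
    moreover have "(x * y) ^ p \<in> ?K" if "x \<in> I e" "y \<in> J e" for x y
      using ideal_prod_mem[OF p_family_Suc[OF I that(1)] p_family_Suc[OF J that(2)]]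
      by (simp add: power_mult_distrib)
    ultimately show ?thesis using ideal_prod_least[of "{z. z ^ p \<in> ?K}" "I e" "J e"] that by blast
  qed
  then have "frob_bracket p (ideal_prod (I e) (J e)) \<subseteq> ideal_prod (I (Suc e)) (J (Suc e))" for e
    unfolding frob_bracket_def by (intro ideal_gen_least is_ideal_ideal_prod) blast
  then show ?thesis unfolding p_family_def by (simp add: is_ideal_ideal_prod)
qed

lemma primary_to_ideal_prod:
  assumes I: "primary_to m I" and J: "primary_to m J"
  shows "primary_to m (ideal_prod I J)"
proof -
  have iI: "is_ideal I" and mI: "\<And>x. x \<in> m \<longleftrightarrow> (\<exists>n. x ^ n \<in> I)" using I by (auto simp: primary_to_def)
  have mJ: "\<And>x. x \<in> m \<longleftrightarrow> (\<exists>n. x ^ n \<in> J)" using J by (auto simp: primary_to_def)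
  have "ideal_prod I J \<subseteq> I"
    using ideal_mult[OF iI] by (intro ideal_prod_least[OF iI]) (simp add: mult.commute)
  then have 1: "x \<in> m" if "x ^ n \<in> ideal_prod I J" for x n using that mI by blast
  have 2: "\<exists>n. x ^ n \<in> ideal_prod I J" if x: "x \<in> m" for x
  proof -
    obtain i j where "x ^ i \<in> I" "x ^ j \<in> J" using x mI mJ by blast
    then have "x ^ (i + j) \<in> ideal_prod I J" using ideal_prod_mem by (simp add: power_add)
    then show ?thesis by blast
  qed
  have "{x. \<exists>n. x ^ n \<in> ideal_prod I J} = m" using 1 2 by blast
  then show ?thesis unfolding primary_to_def by (simp add: is_ideal_ideal_prod)
qed

text \<open>If the \<open>b\<close>-th powers of the finitely many generators of \<open>m\<close>
  lie in \<open>I 0\<close>, their powers of exponent \<open>b * p ^ e\<close> lie in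
  \<open>I e\<close>. So \<open>I e\<close> contains a power of \<open>m\<close> whose exponent
  grows linearly in \<open>p ^ e\<close>, and condition (iv) of an OK valuation places all elements
  of large value in that power.\<close>

lemma (in ok_valuation) p_family_contains_far:
  assumes noeth: "noetherian_ring TYPE('a)" and p: "0 < p"
    and I: "p_family p I" and prim: "primary_to m (I 0)"
  shows "\<exists>U>0. \<forall>e r. r = 0 \<or> U * real p ^ e \<le> vl (emb r) \<longrightarrow> r \<in> I e"
proof -
  have "is_ideal m" using max by (simp add: is_maximal_ideal_def)
  then have "\<exists>X. finite X \<and> m = ideal_gen X" using noeth unfolding noetherian_ring_def by simp
  then obtain X where X: "finite X" "m = ideal_gen X" by (elim exE conjE)
  have "\<exists>n. x ^ n \<in> I 0" if "x \<in> X" for x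
  proof -
    have "x \<in> m" using that X(2) ideal_gen_superset[of X] by blast
    then show ?thesis using prim unfolding primary_to_def by blast
  qed
  then obtain n where n: "\<And>x. x \<in> X \<Longrightarrow> x ^ n x \<in> I 0" by metis
  define b where "b = sum n X"
  have xb: "x ^ b \<in> I 0" if "x \<in> X" for x
    using ideal_power_mono[OF p_family_ideal[OF I] n[OF that]] member_le_sum[OF that, of n] X
    unfolding b_def by simp
  have sub: "ideal_pow m (Suc (card X * (b * p ^ e))) \<subseteq> I e" for e
    unfolding X(2)
  proof (rule ideal_pow_subset_of_powers[OF X(1) p_family_ideal[OF I]])
    fix x assume "x \<in> X"
    from p_family_pow[OF I xb[OF this], of e] show "x ^ (b * p ^ e) \<in> I e" by (simp add: power_mult)
  qed
  have "\<exists>v::nat \<Rightarrow> int. (\<forall>i\<ge>d. v i = 0) \<and> (\<forall>n::nat. \<forall>r. (r = 0 \<or> real n * ipa d a v \<le> ipa d a (\<nu> (emb r))) \<longrightarrow>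
            r \<in> ideal_pow m n)"
    using OK unfolding OK_valuation_def by (elim conjE)
  then obtain v where v: "\<And>n r. r = 0 \<or> real n * ipa d a v \<le> vl (emb r) \<Longrightarrow> r \<in> ideal_pow m n"
    unfolding vl_def by blast
  \<comment> \<open>A positive replacement for the value of \<open>v\<close>, whose sign is
    unknown.\<close>
  define l where "l = \<bar>ipa d a v\<bar> + 1"
  have l: "0 < l" "ipa d a v \<le> l" by (auto simp: l_def)
  define U where "U = real (card X * b + 1) * l"
  have "0 < U" unfolding U_def using l(1) by (intro mult_pos_pos) (simp_all only: of_nat_0_less_iff add_gr_0 zero_less_one simp_thms)
  moreover have "r \<in> I e" if r: "r = 0 \<or> U * real p ^ e \<le> vl (emb r)" for e r
  proof -
    let ?n = "Suc (card X * (b * p ^ e))"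
    have "real ?n \<le> real (card X * b + 1) * real p ^ e"
    proof -
      have "1 \<le> real p ^ e" using p by simp
      then show ?thesis by (simp add: distrib_right)
    qed
    then have "real ?n * l \<le> U * real p ^ e"
      using mult_right_mono[of "real ?n" "real (card X * b + 1) * real p ^ e" l] l(1) unfolding U_def
      by (simp only: ac_simps less_imp_le)
    moreover have "real ?n * ipa d a v \<le> real ?n * l" using l by (intro mult_left_mono) auto
    ultimately have "r = 0 \<or> real ?n * ipa d a v \<le> vl (emb r)" using r by linarith
    then show ?thesis using v sub by blast
  qed
  ultimately show ?thesis by blast
qed

section \<open>Colengths and value semigroups\<close>

context ok_valuation
begin

definition val_set :: "'a set \<Rightarrow> (nat \<Rightarrow> int) set" where
  "val_set I = \<nu> ` emb ` (I - {0})"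

lemma val_setI: "r \<in> I \<Longrightarrow> r \<noteq> 0 \<Longrightarrow> \<nu> (emb r) \<in> val_set I"
  unfolding val_set_def by blast

lemma val_setE:
  assumes "x \<in> val_set I"
  obtains r where "r \<in> I" "r \<noteq> 0" "x = \<nu> (emb r)"
  using assms unfolding val_set_def by blast

lemma val_set_add:
  assumes mult: "\<And>x y. x \<in> I \<Longrightarrow> y \<in> J \<Longrightarrow> x * y \<in> K" and x: "x \<in> val_set I" and y: "y \<in> val_set J"
  shows "x + y \<in> val_set K"
proof -
  obtain r s where rs: "r \<in> I" "r \<noteq> 0" "x = \<nu> (emb r)" "s \<in> J" "s \<noteq> 0" "y = \<nu> (emb s)"
    using val_setE[OF x] val_setE[OF y] by metis
  then have "x + y = \<nu> (emb (r * s))" by (simp add: emb_mult nu_mult)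
  then show ?thesis using val_setI[of "r * s" K] rs mult by simp
qed

lemma nu_emb_power: "r \<noteq> 0 \<Longrightarrow> \<nu> (emb (r ^ k)) = nsm k (\<nu> (emb r))"
proof (induction k)
  case 0 then show ?case by (simp add: nu_1 del: nsm_apply)
next
  case (Suc k)
  have "\<nu> (emb (r ^ Suc k)) = \<nu> (emb r) + \<nu> (emb (r ^ k))"
    using Suc.prems by (simp add: emb_mult nu_mult)
  then show ?case using Suc by (auto simp: fun_eq_iff algebra_simps)
qed

lemma val_set_supp: "x \<in> val_set I \<Longrightarrow> d \<le> i \<Longrightarrow> x i = 0"
  by (erule val_setE) (simp add: nu_supp)

text \<open>Surjectivity of \<nu> provides an element with value the \<open>i\<close>-th unit
  vector; the values of its numerator and denominator are \<open>b i\<close> and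
  \<open>b' i\<close>.\<close>

lemma cone_semigroup_val_set:
  assumes d: "0 < d"
  shows "\<exists>\<kappa> b b'. cone_semigroup d a (val_set UNIV) \<kappa> b b'"
proof -
  have nn: "0 \<le> ipa d a x" if "x \<in> val_set UNIV" for x
    using that by (rule val_setE) (use vl_emb_nonneg in \<open>auto simp: vl_def\<close>)
  have "\<forall>u\<in>closed_cone_gen d (val_set UNIV). (\<Sum>i<d. u i * a i) \<le> 0 \<longrightarrow> u = (\<lambda>_. 0)"
    using OK unfolding OK_valuation_def val_set_def by (elim conjE)
  then obtain \<kappa> where \<kappa>: "0 < \<kappa>" "\<forall>x\<in>val_set UNIV. \<forall>i<d. \<kappa> * real_of_int \<bar>x i\<bar> \<le> ipa d a x"
    using pointed_cone_coord_bound[of "val_set UNIV" d a] nn by blast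
  have "\<exists>u v. u \<in> val_set UNIV \<and> v \<in> val_set UNIV \<and> (\<forall>j. u j - v j = (if i = j then 1 else 0))" if i: "i < d" for i
  proof -
    obtain q where q: "q \<noteq> 0" "\<nu> q = (\<lambda>j. if i = j then 1 else 0)"
      using nu_surj[of "\<lambda>j. if i = j then 1 else 0"] i by auto
    obtain x y where xy: "q = emb x / emb y" "y \<noteq> 0" by (rule fract_eq_divide_emb)
    then have "x \<noteq> 0" "emb x = q * emb y" using q by auto
    then have "\<nu> (emb x) = \<nu> q + \<nu> (emb y)"
      using nu_mult[of q "emb y"] q(1) xy(2) by (metis emb_eq_0_iff)
    then have "\<forall>j. \<nu> (emb x) j - \<nu> (emb y) j = (if i = j then 1 else 0)" using q by simp
    then show ?thesis using val_setI \<open>x \<noteq> 0\<close> xy(2) by blast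
  qed
  then obtain b b' where b: "\<And>i. i < d \<Longrightarrow> b i \<in> val_set UNIV" "\<And>i. i < d \<Longrightarrow> b' i \<in> val_set UNIV"
    "\<And>i j. i < d \<Longrightarrow> b i j - b' i j = (if i = j then 1 else 0)" by metis
  have "cone_semigroup d a (val_set UNIV) \<kappa> b b'"
  proof
    show "0 \<in> val_set UNIV" using val_setI[of 1 UNIV] by (simp add: nu_1)
    show "x + y \<in> val_set UNIV" if "x \<in> val_set UNIV" "y \<in> val_set UNIV" for x y
      using val_set_add[of UNIV UNIV UNIV] that by blast
    show "x i = 0" if "x \<in> val_set UNIV" "d \<le> i" for x i using val_set_supp that .
    show "\<kappa> * real_of_int \<bar>x i\<bar> \<le> ipa d a x" if "x \<in> val_set UNIV" "i < d" for x i using \<kappa> that by blast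
  qed (use d \<kappa> b in auto)
  then show ?thesis by blast
qed

section \<open>Full graded pieces after a fixed shift\<close>

lemma common_denominator: "\<exists>s. s \<noteq> 0 \<and> (\<forall>j<n::nat. emb s * w j \<in> range emb)"
proof (induction n)
  case 0 then show ?case by (intro exI[of _ 1]) simp
next
  case (Suc n)
  then obtain s where s: "s \<noteq> 0" "\<forall>j<n. emb s * w j \<in> range emb" by blast
  obtain x y where xy: "w n = emb x / emb y" "y \<noteq> 0" by (rule fract_eq_divide_emb)
  have "emb (s * y) * w j \<in> range emb" if "j < Suc n" for j
  proof (cases "j = n")
    case True
    then have "emb (s * y) * w j = emb (s * x)" using xy by (simp add: emb_mult)
    then show ?thesis by blast
  next
    case False
    then obtain r where "emb s * w j = emb r" using s \<open>j < Suc n\<close> by (auto simp: less_Suc_eq)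
    then have "emb (s * y) * w j = emb (r * y)" by (simp add: emb_mult ac_simps)
    then show ?thesis by blast
  qed
  then show ?case using s xy by (intro exI[of _ "s * y"]) auto
qed

text \<open>Let \<open>s\<close> clear the denominators of the residue generators
  \<open>w j\<close>. For every nonzero \<open>z\<close> in \<open>M\<close> the elements
  \<open>s * z * w j\<close> then lie in \<open>M\<close>, and their leading terms span the whole
  graded piece at the value of \<open>s * z\<close>. The choice of \<open>s\<close> depends neither
  on \<open>M\<close> nor on \<open>z\<close>.\<close>

lemma full_residues_after_shift:
  "\<exists>s. s \<noteq> 0 \<and> (\<forall>M z. submod M \<and> z \<in> M \<and> z \<noteq> 0 \<longrightarrow>
     atl UNIV (vl (emb s) + vl z) \<subseteq> msum (atl M (vl (emb s) + vl z)) (gtr UNIV (vl (emb s) + vl z)))"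
proof -
  obtain n and w :: "nat \<Rightarrow> 'a fract" where
    gen: "\<forall>v\<in>atl UNIV 0. \<exists>r. v - (\<Sum>j<n. emb (r j) * w j) \<in> gtr UNIV 0"
    using residue_generators by blast
  obtain s where s: "s \<noteq> 0" "\<And>j. j < n \<Longrightarrow> emb s * w j \<in> range emb"
    using common_denominator[of n w] by blast
  have "y \<in> msum (atl M t) (gtr UNIV t)"
    if M: "submod M" and z: "z \<in> M" "z \<noteq> 0" and t: "t = vl (emb s) + vl z" and y: "y \<in> atl UNIV t" for M z t y
  proof -
    define x where "x = emb s * z"
    have x: "x \<noteq> 0" "vl x = t" using s z t by (auto simp: x_def vl_mult)
    have xw: "x * w j \<in> M" if j: "j < n" for j
    proof -
      obtain r where "emb s * w j = emb r" using s(2)[OF j] by blast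
      then have "x * w j = emb r * z" by (simp add: x_def ac_simps)
      then show ?thesis using submod_smult[OF M z(1)] by simp
    qed
    have "y / x \<in> atl UNIV 0" using y x vl_divide[of y x] by (cases "y = 0") (auto simp: atl_def)
    then obtain r where r: "y / x - (\<Sum>j<n. emb (r j) * w j) \<in> gtr UNIV 0" using gen by blast
    define g where "g = y / x - (\<Sum>j<n. emb (r j) * w j)"
    have xg: "x * g \<in> gtr UNIV t"
      using r x vl_mult[of x g] unfolding g_def[symmetric] by (cases "g = 0") (auto simp: gtr_def)
    have "x * (y / x) = y" using x by simp
    then have eq: "y - x * g = (\<Sum>j<n. emb (r j) * (x * w j))"
      by (simp add: g_def right_diff_distrib sum_distrib_left ac_simps)
    have "(\<Sum>j<k. emb (r j) * (x * w j)) \<in> M" if "k \<le> n" for k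
      using that
    proof (induction k)
      case (Suc k)
      then show ?case using submod_add[OF M] submod_smult[OF M xw] by simp
    qed (simp add: submod_0[OF M])
    then have "y - x * g \<in> M" using eq by simp
    moreover have "y - x * g \<in> atl UNIV t"
      using xg y by (intro submod_diff[OF submod_atl[OF submod_UNIV]]) (auto simp: atl_def gtr_def)
    ultimately have "y - x * g \<in> atl M t" by (simp add: atl_def)
    moreover have "y = (y - x * g) + x * g" by simp
    ultimately show ?thesis unfolding msum_def using xg by blast
  qed
  then show ?thesis using s(1) by (intro exI[of _ s]) blast
qed

definition shift_elt :: 'a where
  "shift_elt = (SOME s. s \<noteq> 0 \<and> (\<forall>M z. submod M \<and> z \<in> M \<and> z \<noteq> 0 \<longrightarrow>
     atl UNIV (vl (emb s) + vl z) \<subseteq> msum (atl M (vl (emb s) + vl z)) (gtr UNIV (vl (emb s) + vl z))))"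

abbreviation shift :: real where "shift \<equiv> vl (emb shift_elt)"

lemma shift_elt_nonzero: "shift_elt \<noteq> 0"
  and shift_full: "submod M \<Longrightarrow> z \<in> M \<Longrightarrow> z \<noteq> 0 \<Longrightarrow>
    atl UNIV (shift + vl z) \<subseteq> msum (atl M (shift + vl z)) (gtr UNIV (shift + vl z))"
  using someI_ex[OF full_residues_after_shift, folded shift_elt_def] by simp_all

definition cnt :: "'a set \<Rightarrow> real \<Rightarrow> nat" where
  "cnt I t = card {x \<in> val_set I. ipa d a x < t}"

lemma inj_ipa_val_set: "inj_on (ipa d a) (val_set I)"
  by (intro inj_onI ipa_inj) (auto dest: val_set_supp)

text \<open>All values of \<open>I\<close> below \<tau> give the upper bound. Those below
  \<open>\<tau> - shift\<close>, moved up by \<open>shift\<close>, are still values of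
  \<open>I\<close> below \<tau>, now with full graded pieces, and give the lower bound.\<close>

lemma ideal_length_bounds:
  assumes fin: "finite {x \<in> val_set UNIV. ipa d a x < \<tau>}" and I: "is_ideal I"
  shows "\<exists>k. flen (atl (emb ` I) \<tau>) (emb ` I) k \<and>
    res_len * cnt I (\<tau> - shift) \<le> k \<and> k \<le> res_len * cnt I \<tau>"
proof -
  let ?A' = "{x \<in> val_set I. ipa d a x < \<tau>}" and ?B' = "{x \<in> val_set I. ipa d a x < \<tau> - shift}"
  define A where "A = ipa d a ` ?A'"
  define B where "B = (\<lambda>x. shift + ipa d a x) ` ?B'"
  have "?A' \<subseteq> {x \<in> val_set UNIV. ipa d a x < \<tau>}" unfolding val_set_def by blast
  then have finA: "finite A" unfolding A_def using fin finite_subset by blast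
  have cA: "card A = cnt I \<tau>" unfolding A_def cnt_def
    by (intro card_image inj_on_subset[OF inj_ipa_val_set]) blast
  have cB: "card B = cnt I (\<tau> - shift)" unfolding B_def cnt_def
    using inj_ipa_val_set[of I] by (intro card_image) (auto simp: inj_on_def)
  have BA: "B \<subseteq> A"
  proof
    fix t assume "t \<in> B"
    then obtain x where x: "x \<in> val_set I" "ipa d a x < \<tau> - shift" "t = shift + ipa d a x"
      unfolding B_def by blast
    have "\<nu> (emb shift_elt) + x \<in> val_set I"
      using val_set_add[of UNIV I I, OF _ val_setI[OF UNIV_I shift_elt_nonzero] x(1)] ideal_mult[OF I] by blast
    moreover have "ipa d a (\<nu> (emb shift_elt) + x) = t" using x(3) by (simp add: vl_def)
    ultimately show "t \<in> A" unfolding A_def using x by force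
  qed
  have "\<exists>k. flen (atl (emb ` I) \<tau>) (emb ` I) k \<and> res_len * card B \<le> k \<and> k \<le> res_len * card A"
  proof (rule flen_filtration[OF finA submod_emb_image[OF I] _ _ BA])
    show "t < \<tau> \<and> (\<exists>x. x \<noteq> 0 \<and> vl x = t)" if t: "t \<in> A" for t
    proof -
      obtain x where x: "x \<in> val_set I" "ipa d a x < \<tau>" "t = ipa d a x" using t unfolding A_def by blast
      obtain r where "r \<noteq> 0" "x = \<nu> (emb r)" using x(1) by (auto elim: val_setE)
      then show ?thesis unfolding vl_def using x by (metis emb_eq_0_iff)
    qed
    show "vl x \<in> A" if x: "x \<in> emb ` I" "x \<noteq> 0" "vl x < \<tau>" for x
    proof -
      obtain r where "r \<in> I" "x = emb r" using x(1) by blast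
      then have "\<nu> x \<in> val_set I" using x(2) val_setI by auto
      then show ?thesis using x(3) unfolding A_def vl_def by blast
    qed
    show "atl UNIV t \<subseteq> msum (atl (emb ` I) t) (gtr UNIV t)" if t: "t \<in> B" for t
    proof -
      obtain x where "x \<in> val_set I" "t = shift + ipa d a x" using t unfolding B_def by blast
      then obtain r where r: "r \<in> I" "r \<noteq> 0" "t = shift + vl (emb r)" by (auto elim: val_setE simp: vl_def)
      then show ?thesis using shift_full[OF submod_emb_image[OF I], of "emb r"] by simp
    qed
  qed
  then show ?thesis by (simp add: cA cB)
qed

text \<open>Beyond \<tau> the ideal and the ring agree, so the colength is the difference of two
  truncated lengths. The uncertainty of each is governed by its values between
  \<open>\<tau> - shift\<close> and \<tau>, and the strip of the ideal is contained in that of the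
  ring.\<close>

lemma colength_estimate:
  assumes fin: "finite {x \<in> val_set UNIV. ipa d a x < \<tau>}" and I: "is_ideal I"
    and far: "\<And>r. r = 0 \<or> \<tau> \<le> vl (emb r) \<Longrightarrow> r \<in> I"
  shows "\<bar>real (colength I) - real res_len * real (card (val_set UNIV - val_set I))\<bar>
     \<le> real res_len * (real (cnt UNIV \<tau>) - real (cnt UNIV (\<tau> - shift)))"
proof -
  let ?S = "\<lambda>t. {x \<in> val_set UNIV. ipa d a x < t}" and ?T = "\<lambda>t. {x \<in> val_set I. ipa d a x < t}"
  obtain k where k: "flen (atl (range emb) \<tau>) (range emb) k"
    "res_len * cnt UNIV (\<tau> - shift) \<le> k" "k \<le> res_len * cnt UNIV \<tau>"
    using ideal_length_bounds[OF fin is_ideal_UNIV] by blast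
  obtain l where l: "flen (atl (emb ` I) \<tau>) (emb ` I) l"
    "res_len * cnt I (\<tau> - shift) \<le> l" "l \<le> res_len * cnt I \<tau>"
    using ideal_length_bounds[OF fin I] by blast
  have "atl (range emb) \<tau> = atl (emb ` I) \<tau>" using far by (auto simp: atl_def)
  then have "flen (atl (emb ` I) \<tau>) (range emb) k" using k(1) by simp
  moreover have "atl (emb ` I) \<tau> \<subseteq> emb ` I" by (auto simp: atl_def)
  ultimately obtain l' n where ln: "flen (atl (emb ` I) \<tau>) (emb ` I) l'" "flen (emb ` I) (range emb) n" "k = l' + n"
    using flen_intermediate[OF _ submod_emb_image[OF I]] by (metis image_mono subset_UNIV)
  then have "l' = l" using flen_unique l(1) by blast
  then have k_eq: "k = l + colength I" using ln colength_eq_flen[OF I ln(2)] by simp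
  have TS: "val_set I \<subseteq> val_set UNIV" unfolding val_set_def by blast
  have s0: "0 \<le> shift" using vl_emb_nonneg[OF shift_elt_nonzero] .
  have farT: "x \<in> val_set I" if "x \<in> val_set UNIV" "\<tau> \<le> ipa d a x" for x
    using that(1) by (rule val_setE) (use that far val_setI in \<open>auto simp: vl_def\<close>)
  have fS: "finite (?S \<tau>)" "finite (?S (\<tau> - shift))" "finite (?T \<tau>)" "finite (?T (\<tau> - shift))"
    using fin s0 TS by (auto elim!: finite_subset[rotated])
  have "val_set UNIV - val_set I = ?S \<tau> - ?T \<tau>" using farT by (force simp: not_le[symmetric])
  then have c1: "real (card (val_set UNIV - val_set I)) = real (cnt UNIV \<tau>) - real (cnt I \<tau>)"
    unfolding cnt_def using card_Diff_subset[of "?T \<tau>" "?S \<tau>"] fS TS card_mono[of "?S \<tau>" "?T \<tau>"]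
    by (simp add: Collect_mono_iff subset_iff of_nat_diff)
  have "card (?T \<tau> - ?T (\<tau> - shift)) \<le> card (?S \<tau> - ?S (\<tau> - shift))"
    using TS fS by (intro card_mono) auto
  moreover have "?T (\<tau> - shift) \<subseteq> ?T \<tau>" "?S (\<tau> - shift) \<subseteq> ?S \<tau>" using s0 by auto
  ultimately have c2: "real (cnt I \<tau>) - real (cnt I (\<tau> - shift)) \<le> real (cnt UNIV \<tau>) - real (cnt UNIV (\<tau> - shift))"
    unfolding cnt_def
    using card_Diff_subset[of "?T (\<tau> - shift)" "?T \<tau>"] card_Diff_subset[of "?S (\<tau> - shift)" "?S \<tau>"] fS
      card_mono[of "?T \<tau>" "?T (\<tau> - shift)"] card_mono[of "?S \<tau>" "?S (\<tau> - shift)"] by linarith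
  have kl: "real res_len * real (cnt UNIV (\<tau> - shift)) \<le> real k" "real k \<le> real res_len * real (cnt UNIV \<tau>)"
    "real res_len * real (cnt I (\<tau> - shift)) \<le> real l" "real l \<le> real res_len * real (cnt I \<tau>)"
    using k(2,3) l(2,3) by (metis of_nat_le_iff of_nat_mult)+
  have c2': "real res_len * (real (cnt I \<tau>) - real (cnt I (\<tau> - shift)))
      \<le> real res_len * (real (cnt UNIV \<tau>) - real (cnt UNIV (\<tau> - shift)))"
    using c2 by (intro mult_left_mono) auto
  have "real (colength I) = real k - real l" using k_eq by simp
  then show ?thesis unfolding c1 using kl c2' by (simp add: abs_le_iff algebra_simps)
qed

end

text \<open>A constant change of the radius does not affect the leading term, so the strip in the
  colength estimate has lower order.\<close>

lemma (in p_cone_semigroup) N_shift_asymp: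
  "((\<lambda>t. real (N (U * t - c)) / t ^ d) \<longlongrightarrow> density * U ^ d) at_top"
proof -
  have lim: "filterlim (\<lambda>t. U * t - c) at_top at_top"
    using filterlim_tendsto_add_at_top[OF tendsto_const[of "- c"]
        filterlim_tendsto_pos_mult_at_top[OF tendsto_const U_pos filterlim_ident]] by simp
  have "((\<lambda>t. real (N (U * t - c)) / (U * t - c) ^ d * (U - c / t) ^ d) \<longlongrightarrow> density * (U - 0) ^ d) at_top"
    by (intro tendsto_mult tendsto_power tendsto_diff tendsto_const tendsto_const_divide_at_top
        filterlim_compose[OF N_asymp lim])
  then have lim': "((\<lambda>t. real (N (U * t - c)) / (U * t - c) ^ d * (U - c / t) ^ d) \<longlongrightarrow> density * U ^ d) at_top"
    by simp
  have "eventually (\<lambda>t. 0 < U * t - c) at_top" using lim unfolding filterlim_at_top_dense by (rule spec)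
  then have "eventually (\<lambda>t. real (N (U * t - c)) / (U * t - c) ^ d * (U - c / t) ^ d
      = real (N (U * t - c)) / t ^ d) at_top"
    using eventually_gt_at_top[of 0]
  proof eventually_elim
    case (elim t)
    have "U - c / t = (U * t - c) / t" using elim by (simp add: diff_divide_distrib)
    then show ?case using elim by (simp add: power_divide)
  qed
  then show ?thesis by (rule Lim_transform_eventually[OF lim'])
qed

context ok_valuation
begin

lemma vol_seq_tendsto:
  fixes p :: nat and I :: "nat \<Rightarrow> 'a set" and U V :: real
  assumes cs: "p_cone_semigroup d a (val_set UNIV) \<kappa> b b' p U"
    and I: "p_family p I"
    and far: "\<And>e r. r = 0 \<or> U * real p ^ e \<le> vl (emb r) \<Longrightarrow> r \<in> I e"
    and V: "(\<lambda>e. real (card (val_set UNIV - val_set (I e))) / (real p ^ e) ^ d) \<longlonglongrightarrow> V"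
  shows "vol_seq p d I \<longlonglongrightarrow> real res_len * V"
proof -
  interpret p_cone_semigroup d a "val_set UNIV" \<kappa> b b' p U by fact
  have cnt_N: "cnt UNIV t = N t" for t by (simp add: cnt_def N_def ball_def)
  let ?err = "\<lambda>t. real res_len * (real (N (U * t)) / t ^ d - real (N (U * t - shift)) / t ^ d)"
  have "(?err \<longlongrightarrow> real res_len * (density * U ^ d - density * U ^ d)) at_top"
    by (intro tendsto_mult tendsto_diff tendsto_const N_U_asymp N_shift_asymp)
  then have err: "(\<lambda>e. ?err (real p ^ e)) \<longlonglongrightarrow> 0"
    using filterlim_compose[OF _ p_pow_at_top] by fastforce
  let ?v = "\<lambda>e. real res_len * (real (card (val_set UNIV - val_set (I e))) / (real p ^ e) ^ d)"
  have bound: "norm (vol_seq p d I e - ?v e) \<le> ?err (real p ^ e)" for e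
  proof -
    let ?q = "real p ^ e"
    have "\<bar>real (colength (I e)) - real res_len * real (card (val_set UNIV - val_set (I e)))\<bar>
      \<le> real res_len * (real (N (U * ?q)) - real (N (U * ?q - shift)))"
      unfolding cnt_N[symmetric]
      by (rule colength_estimate[OF finite_ball[unfolded ball_def] p_family_ideal[OF I] far])
    then have "\<bar>real (colength (I e)) - real res_len * real (card (val_set UNIV - val_set (I e)))\<bar> / ?q ^ d
      \<le> real res_len * (real (N (U * ?q)) - real (N (U * ?q - shift))) / ?q ^ d"
      by (intro divide_right_mono) auto
    moreover have "norm (vol_seq p d I e - ?v e) =
        \<bar>real (colength (I e)) - real res_len * real (card (val_set UNIV - val_set (I e)))\<bar> / ?q ^ d"
    proof -
      have "vol_seq p d I e - ?v e =
        (real (colength (I e)) - real res_len * real (card (val_set UNIV - val_set (I e)))) / ?q ^ d"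
        by (simp add: vol_seq_def diff_divide_distrib)
      then show ?thesis by (simp add: abs_divide)
    qed
    moreover have "real res_len * (real (N (U * ?q)) - real (N (U * ?q - shift))) / ?q ^ d = ?err ?q"
      by (simp only: diff_divide_distrib[symmetric] times_divide_eq_right)
    ultimately show ?thesis by linarith
  qed
  have "(\<lambda>e. norm (vol_seq p d I e - ?v e)) \<longlonglongrightarrow> 0"
    by (rule tendsto_sandwich[OF _ _ tendsto_const err]) (use bound in simp_all)
  then have "(\<lambda>e. vol_seq p d I e - ?v e) \<longlonglongrightarrow> 0" by (rule tendsto_norm_zero_cancel)
  from tendsto_add[OF this tendsto_mult[OF tendsto_const V, of "real res_len"]] show ?thesis by simp
qed

lemma volume_inequality:
  fixes p :: nat and I J :: "nat \<Rightarrow> 'a set"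
  assumes d: "0 < d" and noeth: "noetherian_ring TYPE('a)"
    and p: "prime p" "of_nat p = (0::'a)"
    and I: "p_family p I" "\<And>e. primary_to m (I e)"
    and J: "p_family p J" "\<And>e. primary_to m (J e)"
  shows "\<exists>V\<^sub>I V\<^sub>J V\<^sub>L. vol_seq p d I \<longlonglongrightarrow> V\<^sub>I \<and> vol_seq p d J \<longlonglongrightarrow> V\<^sub>J \<and>
    vol_seq p d (\<lambda>e. ideal_prod (I e) (J e)) \<longlonglongrightarrow> V\<^sub>L \<and>
    V\<^sub>L powr (1 / real d) \<le> V\<^sub>I powr (1 / real d) + V\<^sub>J powr (1 / real d)"
proof -
  define K where "K = (\<lambda>e. ideal_prod (I e) (J e))"
  have K: "p_family p K" "primary_to m (K 0)"
    using p_family_ideal_prod[OF p I(1) J(1)] primary_to_ideal_prod[OF I(2) J(2), of 0 0]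
    by (simp_all add: K_def)
  have p0: "0 < p" using prime_gt_0_nat[OF p(1)] .
  obtain U1 where U1: "0 < U1" "\<And>e r. r = 0 \<or> U1 * real p ^ e \<le> vl (emb r) \<Longrightarrow> r \<in> I e"
    using p_family_contains_far[OF noeth p0 I(1) I(2)] by blast
  obtain U2 where U2: "0 < U2" "\<And>e r. r = 0 \<or> U2 * real p ^ e \<le> vl (emb r) \<Longrightarrow> r \<in> J e"
    using p_family_contains_far[OF noeth p0 J(1) J(2)] by blast
  obtain U3 where U3: "0 < U3" "\<And>e r. r = 0 \<or> U3 * real p ^ e \<le> vl (emb r) \<Longrightarrow> r \<in> K e"
    using p_family_contains_far[OF noeth p0 K] by blast
  \<comment> \<open>The three families must share one cone semigroup locale, hence one
    \<open>U\<close>.\<close>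
  define U where "U = max U1 (max U2 U3)"
  have le: "U1 * real p ^ e \<le> U * real p ^ e" "U2 * real p ^ e \<le> U * real p ^ e" "U3 * real p ^ e \<le> U * real p ^ e" for e
    unfolding U_def by (intro mult_right_mono; simp)+
  have far: "r \<in> I e" "r \<in> J e" "r \<in> K e" if "r = 0 \<or> U * real p ^ e \<le> vl (emb r)" for e r
    using that U1(2)[of r e] U2(2)[of r e] U3(2)[of r e] le[of e] by fastforce+
  obtain \<kappa> b b' where cs0: "cone_semigroup d a (val_set UNIV) \<kappa> b b'"
    using cone_semigroup_val_set[OF d] by blast
  have cs: "p_cone_semigroup d a (val_set UNIV) \<kappa> b b' p U"
    by (intro p_cone_semigroup.intro cs0 p_cone_semigroup_axioms.intro)
      (use prime_gt_1_nat[OF p(1)] U1(1) in \<open>auto simp: U_def\<close>)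
  interpret p_cone_semigroup d a "val_set UNIV" \<kappa> b b' p U by (rule cs)
  have fam: "pfam (\<lambda>e. val_set (X e))"
    if X: "p_family p X" and farX: "\<And>e r. r = 0 \<or> U * real p ^ e \<le> vl (emb r) \<Longrightarrow> r \<in> X e" for X
    unfolding pfam_def
  proof (intro allI conjI ballI impI)
    fix e
    show "val_set (X e) \<subseteq> val_set UNIV" unfolding val_set_def by blast
    show "x + y \<in> val_set (X e)" if "x \<in> val_set UNIV" "y \<in> val_set (X e)" for x y
      using val_set_add[of UNIV "X e" "X e", OF _ that] ideal_mult[OF p_family_ideal[OF X]] by blast
    show "nsm p x \<in> val_set (X (Suc e))" if x: "x \<in> val_set (X e)" for x
    proof -
      obtain r where r: "r \<in> X e" "r \<noteq> 0" "x = \<nu> (emb r)" using x by (rule val_setE)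
      then show ?thesis using val_setI[OF p_family_Suc[OF X r(1)]] nu_emb_power[OF r(2), of p]
        by (simp del: nsm_apply)
    qed
    show "x \<in> val_set (X e)" if x: "x \<in> val_set UNIV" "U * real p ^ e \<le> ipa d a x" for x
    proof -
      obtain r where r: "r \<noteq> 0" "x = \<nu> (emb r)" using x(1) by (rule val_setE)
      then show ?thesis using farX[of r e] x(2) val_setI by (simp add: vl_def)
    qed
  qed
  let ?T = "\<lambda>X e. val_set (X e)"
  have fI: "pfam (?T I)" and fJ: "pfam (?T J)" and fK: "pfam (?T K)"
    using fam[OF I(1) far(1)] fam[OF J(1) far(2)] fam[OF K(1) far(3)] by blast+
  obtain V1 where V1: "0 \<le> V1" "((\<lambda>t. real (A (?T I) t) / t ^ d) \<longlongrightarrow> V1) at_top" using A_asymp[OF fI] by blast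
  obtain V2 where V2: "0 \<le> V2" "((\<lambda>t. real (A (?T J) t) / t ^ d) \<longlongrightarrow> V2) at_top" using A_asymp[OF fJ] by blast
  obtain V3 where V3: "0 \<le> V3" "((\<lambda>t. real (A (?T K) t) / t ^ d) \<longlongrightarrow> V3) at_top" using A_asymp[OF fK] by blast
  have sum: "y + z \<in> ?T K e" if "y \<in> ?T I e" "z \<in> ?T J e" for e y z
    using val_set_add[OF _ that] ideal_prod_mem unfolding K_def by blast
  have ineq: "V3 powr (1 / real d) \<le> V1 powr (1 / real d) + V2 powr (1 / real d)"
    by (rule volume_root_triangle[OF fI fJ fK sum V1(2,1) V2(2,1) V3(2,1)])
  let ?h = "real res_len"
  have lims: "vol_seq p d I \<longlonglongrightarrow> ?h * V1" "vol_seq p d J \<longlonglongrightarrow> ?h * V2" "vol_seq p d K \<longlonglongrightarrow> ?h * V3"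
    using vol_seq_tendsto[OF cs I(1) far(1) complement_asymp[OF fI V1(2)]]
      vol_seq_tendsto[OF cs J(1) far(2) complement_asymp[OF fJ V2(2)]]
      vol_seq_tendsto[OF cs K(1) far(3) complement_asymp[OF fK V3(2)]] by blast+
  \<comment> \<open>The residue length multiplies all three volumes alike, so its root factors out
    of the inequality.\<close>
  have "(?h * V3) powr (1 / real d) \<le> (?h * V1) powr (1 / real d) + (?h * V2) powr (1 / real d)"
    using mult_left_mono[OF ineq, of "?h powr (1 / real d)"] V1(1) V2(1) V3(1)
    by (simp add: powr_mult distrib_left)
  then show ?thesis using lims unfolding K_def by blast
qed

end

theorem mainTheorem4:
  fixes m :: "'a::idom set" and d p :: nat and I J :: "nat \<Rightarrow> 'a set"
  assumes "local_ring m"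
    and "krull_dim_eq TYPE('a) d"
    and "OK_domain m d"
    and "prime p" and "of_nat p = (0::'a)"
    and "p_family p I" and "\<forall>e. primary_to m (I e)"
    and "p_family p J" and "\<forall>e. primary_to m (J e)"
  shows "convergent (vol_seq p d I) \<and> convergent (vol_seq p d J) \<and>
         convergent (vol_seq p d (\<lambda>e. ideal_prod (I e) (J e))) \<and>
         vol p d I powr (1 / real d) + vol p d J powr (1 / real d)
           \<ge> vol p d (\<lambda>e. ideal_prod (I e) (J e)) powr (1 / real d)"
proof -
  obtain a \<nu> where "OK_valuation m d a \<nu>" using assms(3) unfolding OK_domain_def by blast
  moreover have "is_maximal_ideal m" "noetherian_ring TYPE('a)"
    using assms(1) by (auto simp: local_ring_def)
  ultimately interpret ok_valuation m d a \<nu> by unfold_locales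
  show ?thesis
  proof (cases "d = 0")
    case False
    then obtain V\<^sub>I V\<^sub>J V\<^sub>L where "vol_seq p d I \<longlonglongrightarrow> V\<^sub>I" "vol_seq p d J \<longlonglongrightarrow> V\<^sub>J"
      "vol_seq p d (\<lambda>e. ideal_prod (I e) (J e)) \<longlonglongrightarrow> V\<^sub>L"
      "V\<^sub>L powr (1 / real d) \<le> V\<^sub>I powr (1 / real d) + V\<^sub>J powr (1 / real d)"
      using volume_inequality[OF _ \<open>noetherian_ring TYPE('a)\<close> assms(4-6) _ assms(8)] assms(7,9) by blast
    then show ?thesis unfolding vol_def by (auto simp: convergent_def limI)
  next
    case True
    \<comment> \<open>With \<open>d = 0\<close> every value is an empty sum, so \<open>m\<close> and
      all ideals involved are zero and the three sequences are the same constant. The exponent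
      \<open>1 / real d\<close> is 0 by convention, and the inequality has the form
      \<open>t \<le> t + t\<close> with \<open>t\<close> nonnegative.\<close>
    have "vl x = 0" for x unfolding vl_def ipa_def using True by simp
    then have m0: "m = {0}" by (auto simp: mem_m_iff)
    have zero: "X = {0}" if "primary_to m X" for X
    proof -
      have "is_ideal X" "\<And>x. (\<exists>n. x ^ n \<in> X) \<Longrightarrow> x = 0" using that m0 by (auto simp: primary_to_def)
      moreover have "x ^ 1 \<in> X" if "x \<in> X" for x using that by simp
      ultimately have "X \<subseteq> {0}" by blast
      then show ?thesis using ideal_0[OF \<open>is_ideal X\<close>] by blast
    qed
    have "I = (\<lambda>_. {0})" "J = (\<lambda>_. {0})" "(\<lambda>e. ideal_prod (I e) (J e)) = (\<lambda>_. {0})"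
      using assms(7,9) zero primary_to_ideal_prod by (metis (no_types, lifting) ext)+
    moreover have "convergent (vol_seq p d (\<lambda>_. {0} :: 'a set))"
      by (simp add: vol_seq_def True convergent_const)
    ultimately show ?thesis by simp
  qed
qed

end
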